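(* Let $n\geqslant 3$, $0<\alpha\leqslant 2$, let $A\subset\mathbb R^n$ be an arbitrary set with $c_\alpha(A)>0$ and $\Omega:=\mathbb R^n\setminus\overline{A}\neq\varnothing$. If there is a measure $\mu\in\mathfrak M^+_\Omega$ with $$\mu^A(\mathbb R^n)<\mu(\mathbb R^n),$$ where $\mu^A$ is the inner balayage of $\mu$ to $A$, then the inner equilibrium measure $\gamma_A$ of $A$ exists.
   Context: For a Radon measure $\nu$ on $\mathbb R^n$, the potential is $U^\nu(x)=\int|x-y|^{\alpha-n}\,d\nu(y)$; the mutual energy is $E(\nu,\nu_1)=\int|x-y|^{\alpha-n}\,d(\nu\otimes\nu_1)(x,y)$ and the energy is $E(\nu)=E(\nu,\nu)$. $\mathfrak M^+$ is the cone of all positive Radon measures $\mu$ on $\mathbb R^n$ such that $U^\mu$ is not identically infinite (standing convention). The signed Radon measures of finite energy form a pre-Hilbert space $\mathcal E$ with inner product $E(\nu,\nu_1)$ and norm $\|\nu\|=\sqrt{E(\nu)}$; the corresponding topology is called strong. $\mathcal E^+$ is the cone of positive measures in $\mathcal E$. For $Q\subset\mathbb R^n$, $\mathfrak M^+_Q$ is the cone of all $\nu\in\mathfrak M^+$ carried by $Q$, i.e. such that $Q$ is $\nu$-measurable and $Q^c$ is $\nu$-negligible, and $\mathcal E^+_Q=\mathcal E\cap\mathfrak M^+_Q$. The inner capacity is $c_\alpha(Q)=1/\inf E(\nu)$, where $\nu$ ranges over all $\nu\in\mathcal E^+_Q$ with $\nu(\mathbb R^n)=1$ ($\inf\varnothing=+\infty$,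 $1/(+\infty)=0$, $1/0=+\infty$). An assertion holds n.e. (nearly everywhere) on $Q$ if the set of points of $Q$ where it fails has zero inner capacity. Inner balayage: for $\lambda\in\mathcal E^+$, $\lambda^A\in\mathcal E^+$ is the orthogonal projection of $\lambda$ onto $\mathcal E'_A$, the strong closure of $\mathcal E^+_A$ (the unique element of $\mathcal E'_A$ nearest to $\lambda$ in the norm). For $\mu\in\mathfrak M^+$, the inner balayage $\mu^A$ is the unique measure in $\mathfrak M^+$ with $E(\mu,\lambda^A)=E(\mu^A,\lambda)$ for all $\lambda\in\mathcal E^+$ (it exists, and for $\mu\in\mathcal E^+$ both definitions agree). Inner equilibrium measure: let $\Theta_A$ be the class of all $\nu\in\mathfrak M^+$ with $U^\nu\geqslant1$ n.e. on $A$. A measure $\gamma_A\in\mathfrak M^+$ is the inner equilibrium measure of $A$ if $U^{\gamma_A}=\inf_{\nu\in\Theta_A}U^\nu$ pointwise on $\mathbb R^n$ (unique if it exists; it can exist only if $\Theta_A\ne\varnothing$). *)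

theory Defs
  imports "HOL-Analysis.Analysis"
begin

text \<open>The order \<open>\<alpha>\<close> of the Riesz kernel is an explicit argument throughout, and \<open>n\<close> is \<open>DIM('a)\<close>.\<close>

text \<open>The diagonal has to be treated separately, since \<open>0 powr a = 0\<close> in HOL
  also for negative \<open>a\<close>, whereas the kernel is infinite there (for \<open>\<alpha> < n\<close>).\<close>

definition riesz_kernel :: "real \<Rightarrow> 'a::euclidean_space \<Rightarrow> 'a \<Rightarrow> ennreal" where
  "riesz_kernel \<alpha> x y =
     (if x = y then \<infinity> else ennreal (norm (x - y) powr (\<alpha> - real DIM('a))))"

definition potential :: "real \<Rightarrow> 'a::euclidean_space measure \<Rightarrow> 'a \<Rightarrow> ennreal" where
  "potential \<alpha> \<nu> x = (\<integral>\<^sup>+ y. riesz_kernel \<alpha> x y \<partial>\<nu>)"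

definition mutual_energy ::
    "real \<Rightarrow> 'a::euclidean_space measure \<Rightarrow> 'a measure \<Rightarrow> ennreal" where
  "mutual_energy \<alpha> \<nu> \<nu>\<^sub>1 = (\<integral>\<^sup>+ (x, y). riesz_kernel \<alpha> x y \<partial>(\<nu> \<Otimes>\<^sub>M \<nu>\<^sub>1))"

text \<open>On a Euclidean space every Borel measure that is finite on compact sets is regular,
  so this is the usual notion of a positive Radon measure.\<close>

definition radon_measure :: "'a::euclidean_space measure \<Rightarrow> bool" where
  "radon_measure \<mu> \<longleftrightarrow> sets \<mu> = sets borel \<and> (\<forall>K. compact K \<longrightarrow> emeasure \<mu> K < \<infinity>)"

text \<open>\<open>pos_measures\<close> is the cone \<open>\<MM>\<^sup>+\<close>, \<open>pos_measures_on\<close> is \<open>\<MM>\<^sup>+\<^sub>Q\<close>; \<open>pos_energy\<close> is the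
  cone \<open>\<E>\<^sup>+\<close>, \<open>pos_energy_on\<close> is \<open>\<E>\<^sup>+\<^sub>Q\<close>.\<close>

definition pos_measures :: "real \<Rightarrow> 'a::euclidean_space measure set" where
  "pos_measures \<alpha> = {\<mu>. radon_measure \<mu> \<and> (\<exists>x. potential \<alpha> \<mu> x \<noteq> \<infinity>)}"

text \<open>The set \<open>Q\<close> need not be Borel; measurability with respect to a measure refers to its
  completion.\<close>

definition carried_by :: "'a::euclidean_space measure \<Rightarrow> 'a set \<Rightarrow> bool" where
  "carried_by \<nu> Q \<longleftrightarrow> Q \<in> sets (completion \<nu>) \<and> - Q \<in> null_sets (completion \<nu>)"

definition pos_measures_on :: "real \<Rightarrow> 'a::euclidean_space set \<Rightarrow> 'a measure set" where
  "pos_measures_on \<alpha> Q = {\<nu> \<in> pos_measures \<alpha>. carried_by \<nu> Q}"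

definition pos_energy :: "real \<Rightarrow> 'a::euclidean_space measure set" where
  "pos_energy \<alpha> = {\<nu> \<in> pos_measures \<alpha>. mutual_energy \<alpha> \<nu> \<nu> < \<infinity>}"

definition pos_energy_on :: "real \<Rightarrow> 'a::euclidean_space set \<Rightarrow> 'a measure set" where
  "pos_energy_on \<alpha> Q = pos_energy \<alpha> \<inter> pos_measures_on \<alpha> Q"

text \<open>The conventions \<open>inf \<emptyset> = \<infinity>\<close>, \<open>1 / \<infinity> = 0\<close> and \<open>1 / 0 = \<infinity>\<close> are those of \<open>ennreal\<close>.\<close>

definition inner_capacity :: "real \<Rightarrow> 'a::euclidean_space set \<Rightarrow> ennreal" where
  "inner_capacity \<alpha> Q =
     1 / (INF \<nu> \<in> {\<nu> \<in> pos_energy_on \<alpha> Q. emeasure \<nu> UNIV = 1}. mutual_energy \<alpha> \<nu> \<nu>)"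

definition nearly_everywhere_on ::
    "real \<Rightarrow> 'a::euclidean_space set \<Rightarrow> ('a \<Rightarrow> bool) \<Rightarrow> bool" where
  "nearly_everywhere_on \<alpha> Q P \<longleftrightarrow> inner_capacity \<alpha> {x \<in> Q. \<not> P x} = 0"

text \<open>A signed Radon measure can take the value \<open>\<infinity> - \<infinity>\<close> on unbounded sets and is therefore
  represented by a pair \<open>(p, q)\<close> of positive ones, standing for \<open>p - q\<close>. Finite energy of a
  signed measure means that its positive and negative parts have finite energy, so the space
  \<open>\<E>\<close> consists of the differences of elements of \<open>\<E>\<^sup>+\<close>. Different pairs may represent the same
  signed measure; the energy form below does not depend on the choice, and all mutual energies
  occurring in it are finite.\<close>

type_synonym 'a signed = "'a measure \<times> 'a measure"

definition signed_energy_space :: "real \<Rightarrow> 'a::euclidean_space signed set" where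
  "signed_energy_space \<alpha> = pos_energy \<alpha> \<times> pos_energy \<alpha>"

definition energy_inner ::
    "real \<Rightarrow> 'a::euclidean_space signed \<Rightarrow> 'a signed \<Rightarrow> real" where
  "energy_inner \<alpha> \<sigma> \<tau> =
     enn2real (mutual_energy \<alpha> (fst \<sigma>) (fst \<tau>)) + enn2real (mutual_energy \<alpha> (snd \<sigma>) (snd \<tau>))
     - enn2real (mutual_energy \<alpha> (fst \<sigma>) (snd \<tau>)) - enn2real (mutual_energy \<alpha> (snd \<sigma>) (fst \<tau>))"

text \<open>The energy norm of \<open>\<sigma> - \<tau>\<close>, with the inner product expanded.\<close>

definition strong_dist ::
    "real \<Rightarrow> 'a::euclidean_space signed \<Rightarrow> 'a signed \<Rightarrow> real" where
  "strong_dist \<alpha> \<sigma> \<tau> =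
     sqrt (energy_inner \<alpha> \<sigma> \<sigma> - 2 * energy_inner \<alpha> \<sigma> \<tau> + energy_inner \<alpha> \<tau> \<tau>)"

definition of_pos :: "'a::euclidean_space measure \<Rightarrow> 'a signed" where
  "of_pos \<nu> = (\<nu>, null_measure borel)"

text \<open>The strong closure \<open>\<E>'\<^sub>A\<close> of \<open>\<E>\<^sup>+\<^sub>A\<close>, taken in the whole space \<open>\<E>\<close>.\<close>

definition strong_closure :: "real \<Rightarrow> 'a::euclidean_space set \<Rightarrow> 'a signed set" where
  "strong_closure \<alpha> A =
     {\<sigma> \<in> signed_energy_space \<alpha>.
        \<forall>e>0. \<exists>\<nu>\<in>pos_energy_on \<alpha> A. strong_dist \<alpha> \<sigma> (of_pos \<nu>) < e}"

text \<open>\<open>is_energy_projection \<alpha> A \<xi> \<xi>'\<close> says that \<open>\<xi>'\<close> is \<open>\<xi>\<^sup>A\<close> for \<open>\<xi> \<in> \<E>\<^sup>+\<close>.\<close>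

definition is_energy_projection ::
    "real \<Rightarrow> 'a::euclidean_space set \<Rightarrow> 'a measure \<Rightarrow> 'a measure \<Rightarrow> bool" where
  "is_energy_projection \<alpha> A \<xi> \<xi>' \<longleftrightarrow>
     \<xi>' \<in> pos_energy \<alpha> \<and> of_pos \<xi>' \<in> strong_closure \<alpha> A \<and>
     (\<forall>\<sigma>\<in>strong_closure \<alpha> A.
        strong_dist \<alpha> (of_pos \<xi>) (of_pos \<xi>') \<le> strong_dist \<alpha> (of_pos \<xi>) \<sigma>)"

text \<open>\<open>is_inner_balayage \<alpha> A \<mu> \<mu>'\<close> says that \<open>\<mu>'\<close> is \<open>\<mu>\<^sup>A\<close>. Existence and
  uniqueness of \<open>\<xi>\<^sup>A\<close> and \<open>\<mu>\<^sup>A\<close> are theorems of the theory and not part of the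
  definitions.\<close>

definition is_inner_balayage ::
    "real \<Rightarrow> 'a::euclidean_space set \<Rightarrow> 'a measure \<Rightarrow> 'a measure \<Rightarrow> bool" where
  "is_inner_balayage \<alpha> A \<mu> \<mu>' \<longleftrightarrow>
     \<mu>' \<in> pos_measures \<alpha> \<and>
     (\<forall>\<xi>\<in>pos_energy \<alpha>. \<forall>\<xi>'. is_energy_projection \<alpha> A \<xi> \<xi>' \<longrightarrow>
        mutual_energy \<alpha> \<mu> \<xi>' = mutual_energy \<alpha> \<mu>' \<xi>)"

text \<open>The class \<open>\<Theta>\<^sub>A\<close>.\<close>

definition equilibrium_class :: "real \<Rightarrow> 'a::euclidean_space set \<Rightarrow> 'a measure set" where
  "equilibrium_class \<alpha> A =
     {\<nu> \<in> pos_measures \<alpha>. nearly_everywhere_on \<alpha> A (\<lambda>x. potential \<alpha> \<nu> x \<ge> 1)}"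

definition is_inner_equilibrium ::
    "real \<Rightarrow> 'a::euclidean_space set \<Rightarrow> 'a measure \<Rightarrow> bool" where
  "is_inner_equilibrium \<alpha> A \<gamma> \<longleftrightarrow>
     \<gamma> \<in> pos_measures \<alpha> \<and>
     (\<forall>x. potential \<alpha> \<gamma> x = (INF \<nu> \<in> equilibrium_class \<alpha> A. potential \<alpha> \<nu> x))"

end

theory Submission
  imports Defs "HOL-Probability.Probability"
begin

text \<open>
  The Riesz kernel is the mixture of the heat kernels at times \<open>t\<close> with weight \<open>c t powr (\<alpha> / 2 - 1)\<close>, and for \<open>\<alpha> \<le> 2\<close> there are probability
  measures \<open>\<eta>\<^sub>e\<close> on \<open>[e, \<infinity>)\<close> whose convolution with this weight is the weight restricted to \<open>(e, \<infinity>)\<close>. Averaging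
  over \<open>\<eta>\<^sub>e\<close> makes potentials and constants, hence minima of them, superaveraging, and a superaveraging
  function below a potential is approximated by potentials of positive densities. This gives the
  domination principle.

  For compact \<open>K \<subseteq> A\<close> let \<open>\<gamma>\<^sub>K\<close> be the equilibrium measure. By domination the potentials of the \<open>\<gamma>\<^sub>K\<close> increase
  with \<open>K\<close> and lie below the potential of every measure in the equilibrium class; by vague compactness
  their supremum \<open>u\<close> is \<open>U\<^sup>\<gamma> + c\<close> with a constant \<open>c \<ge> 0\<close>, the part of the mass escaping to infinity.
  If \<open>c > 0\<close>, domination applied to \<open>\<gamma>\<^sub>K\<close> and \<open>\<gamma> / (1 - c)\<close> yields \<open>u = 1\<close>. But each \<open>\<gamma>\<^sub>K\<close> is its own projection, so
  \<open>\<integral> u d\<mu> \<le> \<mu>\<^sup>A(\<real>\<^sup>n) < \<mu>(\<real>\<^sup>n)\<close>, a contradiction. Hence \<open>c = 0\<close> and \<open>\<gamma>\<close> is the inner equilibrium measure.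
\<close>

section \<open>Integrals on the half-line and the heat kernel\<close>

text \<open>Because heat kernels form a semigroup, composing two mixtures of them convolves their
  time weights, so facts about the kernel in n dimensions become identities on the time axis.
  Positive definiteness of the energy is the same law with every time halved. The bound \<alpha>
  \<le> 2 enters there as well: it makes the smoothing measures positive, the case \<alpha> = 2
  being degenerate with Dirac measures, and it makes the weight nonincreasing, which controls the
  effect of small delays. Energies take values in [0, \<infinity>], hence inequalities are arranged
  without subtraction. The set A may be wild and is seen only through its compact subsets. This
  suffices since a unit measure carried by any set charges a compact part of it. The danger is that
  the measures of growing compact sets lose mass at infinity. That loss shows up as an additive
  constant in the limit potential, and domination then lifts the limit to 1 at every point.
  Integrating 1 against mu gives the full mass of mu, whereas each compact piece yields at most the
  mass of the balayage; the strict inequality between the two masses excludes the loss.\<close>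

lemma nn_integral_inverse:
  fixes F :: "real \<Rightarrow> real"
  assumes [measurable]: "F \<in> borel_measurable borel" and nn: "\<And>s. 0 \<le> F s"
  shows "(\<integral>\<^sup>+s. ennreal (F s) * indicator {0<..} s \<partial>lborel) =
    (\<integral>\<^sup>+r. ennreal (F (1 / r)) * ennreal (1 / r\<^sup>2) * indicator {0<..} r \<partial>lborel)"
proof -
  define f where "f s = ennreal (F s)" for s
  have [measurable]: "f \<in> borel_measurable borel" unfolding f_def by measurable
  \<comment> \<open>These intervals exhaust the half-line and are mapped onto themselves by 1 / r.
    That map is decreasing, so it is split below into the reflection s \<mapsto> - s and the
    increasing map r \<mapsto> - 1 / r.\<close>
  let ?I = "\<lambda>j::nat. {1 / real (Suc j) .. real (Suc j)}"
  have I_sub: "?I i \<subseteq> ?I j" if "i \<le> j" for i j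
    using that by (auto intro!: order_trans[of "1 / real (Suc j)" "1 / real (Suc i)"] divide_left_mono)
  have I_ind: "(SUP j. c * indicator (?I j) s) = c * indicator {0<..} s" for c :: ennreal and s :: real
  proof (cases "s > 0")
    case True
    obtain i where i: "inverse (real (Suc i)) < s" using reals_Archimedean True by blast
    obtain k where k: "s \<le> real k" using real_arch_simple by blast
    have "s \<in> ?I (max i k)"
    proof -
      have "1 / real (Suc (max i k)) \<le> inverse (real (Suc i))"
        by (auto simp: inverse_eq_divide intro!: divide_left_mono)
      then show ?thesis using i k by auto
    qed
    then have "c \<le> (SUP j. c * indicator (?I j) s)"
      by (intro SUP_upper2[of "max i k"]) auto
    moreover have "(SUP j. c * indicator (?I j) s) \<le> c"
      by (intro SUP_least) (auto simp: indicator_def)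
    ultimately show ?thesis using True by (simp add: antisym)
  next
    case False
    then have "s \<notin> ?I j" for j
      using less_le_trans[of 0 "1 / real (Suc j)" s] by (auto simp del: of_nat_Suc)
    then have "indicator (?I j) s = (0::ennreal)" for j by (simp add: indicator_def)
    then show ?thesis using False by simp
  qed
  have eq: "(\<integral>\<^sup>+s. f s * indicator (?I j) s \<partial>lborel) =
    (\<integral>\<^sup>+r. f (1 / r) * ennreal (1 / r\<^sup>2) * indicator (?I j) r \<partial>lborel)" for j
  proof -
    have "(\<integral>\<^sup>+s. f s * indicator (?I j) s \<partial>lborel) = (\<integral>\<^sup>+s. f (0 + (-1) * s) * indicator (?I j) (0 + (-1) * s) \<partial>lborel)"
      by (subst nn_integral_real_affine[where c="-1" and t=0]) auto
    also have "\<dots> = (\<integral>\<^sup>+s. f (- s) * indicator {- 1 / (1 / real (Suc j)) .. - 1 / real (Suc j)} s \<partial>lborel)"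
      by (intro nn_integral_cong) (auto simp: indicator_def)
    also have "\<dots> = (\<integral>\<^sup>+s. ennreal (F (- s) * indicator {- 1 / (1 / real (Suc j)) .. - 1 / real (Suc j)} s) \<partial>lborel)"
      by (intro nn_integral_cong) (auto simp: indicator_def f_def)
    also have "\<dots> = (\<integral>\<^sup>+r. ennreal (F (- (- 1 / r)) * (1 / r\<^sup>2) * indicator (?I j) r) \<partial>lborel)"
    proof (rule nn_integral_substitution[where g="\<lambda>r. - 1 / r" and g'="\<lambda>r. 1 / r\<^sup>2"])
      fix x assume "x \<in> ?I j"
      then have "x > 0" using less_le_trans[of 0 "1 / real (Suc j)" x] by (auto simp del: of_nat_Suc)
      then show "((\<lambda>r. - 1 / r) has_real_derivative 1 / x\<^sup>2) (at x)"
        by (auto intro!: derivative_eq_intros simp: power2_eq_square)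
    next
      show "continuous_on (?I j) (\<lambda>r. 1 / r\<^sup>2)"
        by (intro continuous_intros) (auto simp: divide_simps simp del: of_nat_Suc)
    next
      show "set_borel_measurable borel {- 1 / (1 / real (Suc j))..- 1 / real (Suc j)} (\<lambda>s. F (- s))"
        unfolding set_borel_measurable_def by measurable
    next
      show "1 / real (Suc j) \<le> real (Suc j)"
        by (rule order_trans[of _ 1]) auto
    qed auto
    also have "\<dots> = (\<integral>\<^sup>+r. f (- (- 1 / r)) * ennreal (1 / r\<^sup>2) * indicator (?I j) r \<partial>lborel)"
      by (intro nn_integral_cong) (auto simp: f_def ennreal_mult''[symmetric] nn split: split_indicator)
    finally show ?thesis by simp
  qed
  have inc: "incseq (\<lambda>j s. c s * indicator (?I j) s)" for c :: "real \<Rightarrow> ennreal"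
  proof (rule incseq_SucI, rule le_funI)
    fix j and s :: real
    show "c s * indicator (?I j) s \<le> c s * indicator (?I (Suc j)) s"
      using I_sub[of j "Suc j"] by (intro mult_left_mono) (auto simp: indicator_def simp del: of_nat_Suc)
  qed
  have "(\<integral>\<^sup>+s. f s * indicator {0<..} s \<partial>lborel) = (SUP j. \<integral>\<^sup>+s. f s * indicator (?I j) s \<partial>lborel)"
    unfolding I_ind[symmetric] by (intro nn_integral_monotone_convergence_SUP inc) auto
  also have "\<dots> = (SUP j. \<integral>\<^sup>+r. f (1 / r) * ennreal (1 / r\<^sup>2) * indicator (?I j) r \<partial>lborel)"
    by (simp only: eq)
  also have "\<dots> = (\<integral>\<^sup>+r. f (1 / r) * ennreal (1 / r\<^sup>2) * indicator {0<..} r \<partial>lborel)"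
    unfolding I_ind[symmetric] by (intro nn_integral_monotone_convergence_SUP[symmetric] inc) auto
  finally show ?thesis by (simp only: f_def)
qed

text \<open>The kernel of the semigroup generated by the Laplacian, hence variance
  \<open>2 * t\<close> in each coordinate. The product form reduces total mass and semigroup law to
  the one-dimensional normal density.\<close>

definition heat :: "real \<Rightarrow> 'a::euclidean_space \<Rightarrow> real" where
  "heat t x = (\<Prod>b\<in>Basis. normal_density 0 (sqrt (2 * t)) (x \<bullet> b))"

lemma heat_nonneg [simp]: "0 \<le> heat t x"
  by (auto simp: heat_def intro!: prod_nonneg normal_density_nonneg)

lemma borel_measurable_heat [measurable]:
  assumes [measurable]: "f \<in> borel_measurable M" "g \<in> borel_measurable M"
  shows "(\<lambda>p. heat (f p) (g p)) \<in> borel_measurable M"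
  unfolding heat_def normal_density_def by measurable

lemma heat_uminus [simp]: "heat t (- x) = heat t x"
  by (simp add: heat_def normal_density_def)

lemma heat_commute: "heat t (x - y) = heat t (y - x)"
  using heat_uminus[of t "x - y"] by simp

lemma heat_eq:
  assumes "t > 0"
  shows "heat t (x::'a::euclidean_space) =
    (4 * pi * t) powr (- real DIM('a) / 2) * exp (- (norm x)\<^sup>2 / (4 * t))"
proof -
  have "heat t x = (\<Prod>b\<in>Basis. (4 * pi * t) powr (- 1 / 2) * exp (- (x \<bullet> b)\<^sup>2 / (4 * t)))"
    unfolding heat_def normal_density_def using assms
    by (intro prod.cong refl) (simp add: powr_minus powr_half_sqrt field_simps)
  also have "\<dots> = ((4 * pi * t) powr (- 1 / 2)) ^ DIM('a) * exp (\<Sum>b\<in>Basis. - (x \<bullet> b)\<^sup>2 / (4 * t))"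
    by (simp add: prod.distrib exp_sum)
  also have "((4 * pi * t) powr (- 1 / 2)) ^ DIM('a) = (4 * pi * t) powr (- real DIM('a) / 2)"
    using assms by (subst powr_realpow[symmetric]) (auto simp: powr_powr)
  also have "(\<Sum>b\<in>Basis. - (x \<bullet> b)\<^sup>2 / (4 * t)) = - (norm x)\<^sup>2 / (4 * t)"
    unfolding power2_norm_eq_inner euclidean_inner[of x x] power2_eq_square[of "_ \<bullet> _"]
    by (simp add: sum_divide_distrib sum_negf)
  finally show ?thesis .
qed

lemma heat_pos: "t > 0 \<Longrightarrow> heat t x > 0"
  by (simp add: heat_eq)

lemma nn_integral_heat:
  assumes "t > 0"
  shows "(\<integral>\<^sup>+y. ennreal (heat t (y::'a::euclidean_space)) \<partial>lborel) = 1"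
proof -
  have 1: "(\<integral>\<^sup>+y. ennreal (normal_density 0 (sqrt (2 * t)) y) \<partial>lborel) = 1"
    using assms by (subst nn_integral_eq_integral) (auto simp: integral_normal_density normal_density_nonneg)
  have "(\<integral>\<^sup>+y. ennreal (heat t (y::'a)) \<partial>lborel) =
      (\<integral>\<^sup>+y. (\<Prod>b\<in>(Basis::'a set). ennreal (normal_density 0 (sqrt (2 * t)) (y \<bullet> b))) \<partial>lborel)"
    by (simp add: heat_def prod_ennreal normal_density_nonneg)
  also have "\<dots> = (\<Prod>b\<in>(Basis::'a set). 1)"
    by (subst nn_integral_lborel_prod) (simp_all add: 1)
  finally show ?thesis by simp
qed

lemma heat_semigroup:
  assumes "s > 0" "t > 0"
  shows "(\<integral>\<^sup>+y. ennreal (heat s (x - y)) * ennreal (heat t (y::'a::euclidean_space)) \<partial>lborel) = ennreal (heat (s + t) x)"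
proof -
  let ?d = "\<lambda>t. normal_density 0 (sqrt (2 * t))"
  have 1: "(\<integral>\<^sup>+y. ennreal (?d s (a - y)) * ennreal (?d t y) \<partial>lborel) = ennreal (?d (s + t) a)" for a
    using fun_cong[OF conv_normal_density_zero_mean[of "sqrt (2 * s)" "sqrt (2 * t)"], of a] assms
    by (simp add: ennreal_mult normal_density_nonneg algebra_simps)
  have "(\<integral>\<^sup>+y. ennreal (heat s (x - y)) * ennreal (heat t (y::'a)) \<partial>lborel) =
      (\<integral>\<^sup>+y. (\<Prod>b\<in>(Basis::'a set). ennreal (?d s (x \<bullet> b - y \<bullet> b)) * ennreal (?d t (y \<bullet> b))) \<partial>lborel)"
    by (simp add: heat_def prod_ennreal normal_density_nonneg prod.distrib inner_diff_left)
  also have "\<dots> = (\<Prod>b\<in>(Basis::'a set). \<integral>\<^sup>+y. ennreal (?d s (x \<bullet> b - y)) * ennreal (?d t y) \<partial>lborel)"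
    by (intro nn_integral_lborel_prod) auto
  also have "\<dots> = ennreal (heat (s + t) x)"
    by (simp add: 1 heat_def prod_ennreal normal_density_nonneg)
  finally show ?thesis .
qed

lemma nn_integral_lborel_translate:
  fixes f :: "'a::euclidean_space \<Rightarrow> ennreal"
  assumes [measurable]: "f \<in> borel_measurable borel"
  shows "(\<integral>\<^sup>+y. f (y - a) \<partial>lborel) = (\<integral>\<^sup>+y. f y \<partial>lborel)"
proof -
  have "(\<integral>\<^sup>+y. f y \<partial>lborel) = (\<integral>\<^sup>+y. f y \<partial>(distr lborel borel ((+) (- a))))"
    by (subst lborel_distr_plus) simp
  also have "\<dots> = (\<integral>\<^sup>+y. f (- a + y) \<partial>lborel)"
    by (subst nn_integral_distr) auto
  finally show ?thesis by simp
qed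

lemma nn_integral_heat':
  assumes "t > 0"
  shows "(\<integral>\<^sup>+y. ennreal (heat t (x - y::'a::euclidean_space)) \<partial>lborel) = 1"
  using nn_integral_lborel_translate[of "\<lambda>y. ennreal (heat t y)" x] nn_integral_heat[OF assms, where 'a='a]
  by (simp add: heat_commute[of t x])

lemma heat_semigroup':
  assumes "s > 0" "t > 0"
  shows "(\<integral>\<^sup>+z. ennreal (heat s (x - z)) * ennreal (heat t (z - y::'a::euclidean_space)) \<partial>lborel) = ennreal (heat (s + t) (x - y))"
  using nn_integral_lborel_translate[of "\<lambda>z. ennreal (heat s (x - y - z)) * ennreal (heat t z)" y]
    heat_semigroup[OF assms, of "x - y"]
  by (simp add: algebra_simps)

lemma nn_integral_scaled_Gamma:
  fixes p a :: real
  assumes "p > 0" "a > 0"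
  shows "(\<integral>\<^sup>+s. ennreal (s powr (p - 1) * exp (- (a * s))) * indicator {0<..} s \<partial>lborel) = ennreal (a powr (- p) * Gamma p)"
proof -
  have "ennreal (Gamma p) = (\<integral>\<^sup>+t. ennreal (indicator {0..} t * t powr (p - 1) / exp t) \<partial>lborel)"
    by (rule Gamma_conv_nn_integral_real[OF assms(1)])
  also have "\<dots> = (\<integral>\<^sup>+t. ennreal (indicator {0<..} t * t powr (p - 1) / exp t) \<partial>lborel)"
    by (intro nn_integral_cong) (auto simp: indicator_def)
  also have "\<dots> = ennreal \<bar>a\<bar> * (\<integral>\<^sup>+s. ennreal (indicator {0<..} (0 + a * s) * (0 + a * s) powr (p - 1) / exp (0 + a * s)) \<partial>lborel)"
    using assms by (intro nn_integral_real_affine) auto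
  also have "\<dots> = ennreal a * (\<integral>\<^sup>+s. ennreal (a powr (p - 1)) * (ennreal (s powr (p - 1) * exp (- (a * s))) * indicator {0<..} s) \<partial>lborel)"
    using assms by (intro arg_cong2[where f="(*)"] nn_integral_cong)
      (auto simp: powr_mult exp_minus field_simps zero_less_mult_iff ennreal_mult'[symmetric] split: split_indicator)
  also have "\<dots> = ennreal (a powr p) * (\<integral>\<^sup>+s. (ennreal (s powr (p - 1) * exp (- (a * s))) * indicator {0<..} s) \<partial>lborel)"
    using assms by (subst nn_integral_cmult) (auto simp: mult.assoc[symmetric] ennreal_mult'[symmetric] powr_mult_base)
  finally have "ennreal (a powr (- p)) * ennreal (Gamma p) = ennreal (a powr (- p)) * (ennreal (a powr p) * (\<integral>\<^sup>+s. (ennreal (s powr (p - 1) * exp (- (a * s))) * indicator {0<..} s) \<partial>lborel))"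
    by simp
  also have "\<dots> = (\<integral>\<^sup>+s. (ennreal (s powr (p - 1) * exp (- (a * s))) * indicator {0<..} s) \<partial>lborel)"
    using assms by (simp add: mult.assoc[symmetric] ennreal_mult'[symmetric] powr_minus)
  finally show ?thesis
    by (simp add: ennreal_mult')
qed

lemma nn_integral_shifted_Beta:
  fixes a b p :: real
  assumes "a < b" "0 < p" "p < 1"
  shows "(\<integral>\<^sup>+r. ennreal ((r - a) powr (p - 1) * (b - r) powr (- p)) * indicator {a<..<b} r \<partial>lborel) = ennreal (Beta p (1 - p))"
proof -
  have "(\<integral>\<^sup>+r. ennreal ((r - a) powr (p - 1) * (b - r) powr (- p)) * indicator {a<..<b} r \<partial>lborel)
    = ennreal \<bar>b - a\<bar> * (\<integral>\<^sup>+v. ennreal ((a + (b - a) * v - a) powr (p - 1) * (b - (a + (b - a) * v)) powr (- p)) * indicator {a<..<b} (a + (b - a) * v) \<partial>lborel)"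
    using assms by (intro nn_integral_real_affine) auto
  also have "\<dots> = (\<integral>\<^sup>+v. ennreal (b - a) * (ennreal ((a + (b - a) * v - a) powr (p - 1) * (b - (a + (b - a) * v)) powr (- p)) * indicator {a<..<b} (a + (b - a) * v)) \<partial>lborel)"
    using assms by (subst nn_integral_cmult) auto
  also have "\<dots> = (\<integral>\<^sup>+v. ennreal (indicator {0..1} v * (v powr (p - 1) * (1 - v) powr ((1 - p) - 1))) \<partial>lborel)"
  proof (rule nn_integral_cong_AE)
    have "AE v in lborel. v \<noteq> (0::real) \<and> v \<noteq> 1"
      by (auto intro!: AE_conjI AE_lborel_singleton)
    then show "AE v in lborel. ennreal (b - a) * (ennreal ((a + (b - a) * v - a) powr (p - 1) * (b - (a + (b - a) * v)) powr (- p)) * indicator {a<..<b} (a + (b - a) * v))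
      = ennreal (indicator {0..1} v * (v powr (p - 1) * (1 - v) powr ((1 - p) - 1)))"
    proof eventually_elim
      case (elim v)
      show ?case
      proof (cases "0 < v \<and> v < 1")
        case True
        have 1: "b - (a + (b - a) * v) = (b - a) * (1 - v)" by (simp add: algebra_simps)
        have "(b - a) * v > 0" "(b - a) * v < (b - a) * 1"
          using True assms by (simp, intro mult_strict_left_mono) auto
        then have 2: "a + (b - a) * v \<in> {a<..<b}" by auto
        have 3: "(b - a) * ((b - a) powr (p - 1) * (b - a) powr (- p)) = 1"
          using assms by (simp add: powr_diff powr_minus)
        have "(b - a) * ((a + (b - a) * v - a) powr (p - 1) * (b - (a + (b - a) * v)) powr (- p))
          = ((b - a) * ((b - a) powr (p - 1) * (b - a) powr (- p))) * (v powr (p - 1) * (1 - v) powr (- p))"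
          unfolding 1 using True assms by (simp add: powr_mult)
        then show ?thesis using True assms 2 unfolding 3
          by (simp add: ennreal_mult'[symmetric])
      next
        case False
        then have "v \<notin> {0..1}" using elim by auto
        moreover have "a + (b - a) * v \<notin> {a<..<b}"
        proof (cases "v \<ge> 1")
          case True
          then have "(b - a) * 1 \<le> (b - a) * v" using assms by (intro mult_left_mono) auto
          then have "b \<le> a + (b - a) * v" by (simp add: algebra_simps)
          then show ?thesis by simp
        next
          case v: False
          with False have "v \<le> 0" by simp
          then have "(b - a) * v \<le> 0" using assms by (simp add: mult_nonneg_nonpos)
          then show ?thesis by simp
        qed
        ultimately show ?thesis by simp
      qed
    qed
  qed
  also have "\<dots> = ennreal (Beta p (1 - p))"
    using assms by (intro nn_integral_has_integral_lebesgue has_integral_Beta_real) auto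
  finally show ?thesis .
qed

section \<open>The Riesz kernel as a mixture of heat kernels\<close>

text \<open>The parameter \<open>dummy\<close> only fixes the type of the space, on whose dimension the constants depend.\<close>

locale riesz =
  fixes \<alpha> :: real and dummy :: "'a::euclidean_space itself"
  assumes \<alpha>_pos: "0 < \<alpha>" and \<alpha>_le: "\<alpha> \<le> 2" and \<alpha>_less: "\<alpha> < real DIM('a)"
begin

text \<open>Normalised so that the mixture is exactly the Riesz kernel: the first factor of the
  denominator stems from the heat kernel, the other two from the Gamma integral that remains after
  inverting time.\<close>

definition weight_const :: real where
  "weight_const = 1 / ((4 * pi) powr (- real DIM('a) / 2) * 4 powr ((real DIM('a) - \<alpha>) / 2) * Gamma ((real DIM('a) - \<alpha>) / 2))"

lemma weight_const_pos: "weight_const > 0"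
  unfolding weight_const_def using \<alpha>_less by (auto intro!: divide_pos_pos mult_pos_pos Gamma_real_pos)

definition weight :: "real \<Rightarrow> real" where
  "weight t = weight_const * t powr (\<alpha> / 2 - 1)"

lemma weight_nonneg [simp]: "0 \<le> weight t"
  using weight_const_pos by (simp add: weight_def)

lemma weight_pos: "t > 0 \<Longrightarrow> 0 < weight t"
  using weight_const_pos by (simp add: weight_def)

lemma borel_measurable_weight [measurable]: "weight \<in> borel_measurable borel"
  unfolding weight_def by measurable

text \<open>Restricting the times to \<open>I\<close> truncates the kernel near or away from its
  singularity. Times at most 0 are dropped because the laws of the heat kernel hold for positive
  times.\<close>

definition prof :: "real set \<Rightarrow> real measure" where
  "prof I = density lborel (\<lambda>t. ennreal (indicator (I \<inter> {0<..}) t * weight t))"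

lemma sets_prof [simp, measurable_cong]: "sets (prof I) = sets borel"
  and space_prof [simp]: "space (prof I) = UNIV"
  by (simp_all add: prof_def)

lemma sigma_finite_prof: "I \<in> sets borel \<Longrightarrow> sigma_finite_measure (prof I)"
  unfolding prof_def by (subst sigma_finite_measure.sigma_finite_iff_density_finite[OF sigma_finite_lborel]) auto

lemma nn_integral_prof:
  assumes "I \<in> sets borel" "f \<in> borel_measurable borel"
  shows "(\<integral>\<^sup>+t. f t \<partial>prof I) = (\<integral>\<^sup>+t. indicator (I \<inter> {0<..}) t * ennreal (weight t) * f t \<partial>lborel)"
  using assms unfolding prof_def
  by (subst nn_integral_density) (auto simp: ennreal_mult' ennreal_indicator intro!: nn_integral_cong)

lemma AE_prof: "I \<in> sets borel \<Longrightarrow> AE t in prof I. t \<in> I \<and> 0 < t"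
  unfolding prof_def by (subst AE_density) (auto simp: indicator_def)

lemma AE_prof_pos: "I \<in> sets borel \<Longrightarrow> AE t in prof I. 0 < t"
  using AE_prof[of I] by simp

lemma nn_integral_prof_split:
  assumes [measurable]: "f \<in> borel_measurable borel"
  shows "(\<integral>\<^sup>+t. f t \<partial>prof UNIV) = (\<integral>\<^sup>+t. f t \<partial>prof {..e}) + (\<integral>\<^sup>+t. f t \<partial>prof {e<..})"
  by (simp add: nn_integral_prof, subst nn_integral_add[symmetric])
     (auto intro!: nn_integral_cong split: split_indicator)

lemma nn_integral_prof_mono:
  assumes "I \<subseteq> J" "I \<in> sets borel" "J \<in> sets borel" "f \<in> borel_measurable borel"
  shows "(\<integral>\<^sup>+t. f t \<partial>prof I) \<le> (\<integral>\<^sup>+t. f t \<partial>prof J)"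
  using assms by (auto simp: nn_integral_prof intro!: nn_integral_mono split: split_indicator)

text \<open>Inverting time turns the Gaussian factor into exp (- a s) with a = |x|^2 / 4 and leaves
  a Gamma integral with parameter (n - \<alpha>) / 2, which is positive because \<alpha> <
  n.\<close>

lemma nn_integral_heat_prof_nz:
  assumes "x \<noteq> (0::'a)"
  shows "(\<integral>\<^sup>+t. ennreal (heat t x) \<partial>prof UNIV) = ennreal (norm x powr (\<alpha> - real DIM('a)))"
proof -
  let ?n = "real DIM('a)" and ?r = "norm x"
  let ?p = "(?n - \<alpha>) / 2"
  define c where "c = weight_const * (4 * pi) powr (- ?n / 2)"
  have c: "c \<ge> 0" using weight_const_pos by (simp add: c_def)
  have p: "?p > 0" using \<alpha>_less by simp
  define F where "F t = c * (t powr (\<alpha> / 2 - 1 - ?n / 2) * exp (- ?r\<^sup>2 / (4 * t)))" for t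
  have [measurable]: "F \<in> borel_measurable borel" unfolding F_def by measurable
  have "(\<integral>\<^sup>+t. ennreal (heat t x) \<partial>prof UNIV) = (\<integral>\<^sup>+t. ennreal (F t) * indicator {0<..} t \<partial>lborel)"
  proof (subst nn_integral_prof, simp, simp, rule nn_integral_cong)
    fix t :: real
    have "t powr (\<alpha> / 2 - 1) * (4 * pi * t) powr (- ?n / 2) = (4 * pi) powr (- ?n / 2) * t powr (\<alpha> / 2 - 1 - ?n / 2)" if "t > 0"
      using that by (simp add: powr_mult powr_add[symmetric])
    then have "weight t * heat t x = F t" if "t > 0"
      using that by (simp add: heat_eq weight_def F_def c_def)
    then show "indicator (UNIV \<inter> {0<..}) t * ennreal (weight t) * ennreal (heat t x) = ennreal (F t) * indicator {0<..} t"
      by (auto simp: ennreal_mult'[symmetric] split: split_indicator)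
  qed
  also have "\<dots> = (\<integral>\<^sup>+s. ennreal (F (1 / s)) * ennreal (1 / s\<^sup>2) * indicator {0<..} s \<partial>lborel)"
    by (rule nn_integral_inverse) (auto simp: F_def c)
  also have "\<dots> = (\<integral>\<^sup>+s. ennreal c * (ennreal (s powr (?p - 1) * exp (- (?r\<^sup>2 / 4 * s))) * indicator {0<..} s) \<partial>lborel)"
  proof (rule nn_integral_cong)
    fix s :: real
    have *: "(1 / s) powr (\<alpha> / 2 - 1 - ?n / 2) * (1 / s\<^sup>2) = s powr (?p - 1)" if "s > 0"
    proof -
      have "(1 / s) powr (\<alpha> / 2 - 1 - ?n / 2) = s powr (- (\<alpha> / 2 - 1 - ?n / 2))"
        using that by (subst powr_minus_divide, subst powr_divide) auto
      moreover have "s powr (- (\<alpha> / 2 - 1 - ?n / 2)) * (1 / s\<^sup>2) = s powr (- (\<alpha> / 2 - 1 - ?n / 2) - 2)"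
        using that unfolding powr_diff[of _ _ 2] by simp
      moreover have "- (\<alpha> / 2 - 1 - ?n / 2) - 2 = ?p - 1" by (simp add: field_simps)
      ultimately show ?thesis by (simp only:)
    qed
    have **: "F (1 / s) * (1 / s\<^sup>2) = c * (s powr (?p - 1) * exp (- (?r\<^sup>2 / 4 * s)))" if "s > 0"
    proof -
      have e: "- ?r\<^sup>2 / (4 * (1 / s)) = - (?r\<^sup>2 / 4 * s)" using that by (simp add: field_simps)
      have "F (1 / s) * (1 / s\<^sup>2) = c * (((1 / s) powr (\<alpha> / 2 - 1 - ?n / 2) * (1 / s\<^sup>2)) * exp (- (?r\<^sup>2 / 4 * s)))"
        unfolding F_def e by (simp only: mult.assoc mult.commute mult.left_commute)
      with * that show ?thesis by (simp only:)
    qed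
    then have "ennreal (F (1 / s)) * ennreal (1 / s\<^sup>2) = ennreal c * ennreal (s powr (?p - 1) * exp (- (?r\<^sup>2 / 4 * s)))" if "s > 0"
    proof -
      have "ennreal (F (1 / s)) * ennreal (1 / s\<^sup>2) = ennreal (F (1 / s) * (1 / s\<^sup>2))"
        by (rule ennreal_mult''[symmetric]) simp
      also have "\<dots> = ennreal (c * (s powr (?p - 1) * exp (- (?r\<^sup>2 / 4 * s))))"
        using ** that by (simp only:)
      also have "\<dots> = ennreal c * ennreal (s powr (?p - 1) * exp (- (?r\<^sup>2 / 4 * s)))"
        by (rule ennreal_mult'') simp
      finally show ?thesis .
    qed
    then show "ennreal (F (1 / s)) * ennreal (1 / s\<^sup>2) * indicator {0<..} s = ennreal c * (ennreal (s powr (?p - 1) * exp (- (?r\<^sup>2 / 4 * s))) * indicator {0<..} s)"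
      by (cases "s > 0") (simp_all only: mult.assoc indicator_simps greaterThan_iff not_False_eq_True mult_zero_right)
  qed
  also have "\<dots> = ennreal c * ennreal ((?r\<^sup>2 / 4) powr (- ?p) * Gamma ?p)"
    using assms p by (subst nn_integral_cmult, simp, subst nn_integral_scaled_Gamma) auto
  also have "\<dots> = ennreal (norm x powr (\<alpha> - ?n))"
  proof -
    have "(?r\<^sup>2 / 4) powr (- ?p) = ?r powr (\<alpha> - ?n) * 4 powr ?p"
    proof -
      have "(?r\<^sup>2) powr (- ?p) = ?r powr (\<alpha> - ?n)"
      proof -
        have "?r\<^sup>2 = ?r powr 2" using assms by (simp add: powr_numeral)
        then have "(?r\<^sup>2) powr (- ?p) = ?r powr (2 * (- ?p))" by (simp only: powr_powr)
        moreover have "2 * (- ?p) = \<alpha> - ?n" by (simp add: field_simps)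
        ultimately show ?thesis by (simp only:)
      qed
      moreover have "(?r\<^sup>2 / 4) powr (- ?p) = (?r\<^sup>2) powr (- ?p) / 4 powr (- ?p)"
        by (rule powr_divide)
      moreover have "1 / 4 powr (- ?p) = (4::real) powr ?p" by (simp add: powr_minus_divide)
      ultimately show ?thesis
        using times_divide_eq_right[of "?r powr (\<alpha> - ?n)" 1 "4 powr (- ?p)"] by (simp only: mult_1_right)
    qed
    moreover have "Gamma ?p > 0" using p by (rule Gamma_real_pos)
    ultimately have "c * ((?r\<^sup>2 / 4) powr (- ?p) * Gamma ?p) = ?r powr (\<alpha> - ?n)"
      by (simp add: c_def weight_const_def)
    then show ?thesis using c by (simp add: ennreal_mult'[symmetric])
  qed
  finally show ?thesis .
qed

lemma heat_mono_norm: "t > 0 \<Longrightarrow> norm x \<le> norm y \<Longrightarrow> heat t (y::'a) \<le> heat t (x::'a)"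
  by (auto simp: heat_eq intro!: mult_left_mono divide_right_mono)

text \<open>At every time the heat kernel is largest at the origin. The integral therefore dominates
  r^(\<alpha> - n) for every r > 0, which is unbounded as r tends to 0.\<close>

lemma nn_integral_heat_prof_0:
  "(\<integral>\<^sup>+t. ennreal (heat t (0::'a)) \<partial>prof UNIV) = \<infinity>"
proof -
  obtain e :: 'a where e: "norm e = 1" using vector_choose_size[of 1] by auto
  have *: "ennreal (r powr (\<alpha> - real DIM('a))) \<le> (\<integral>\<^sup>+t. ennreal (heat t (0::'a)) \<partial>prof UNIV)" if "r > 0" for r
  proof -
    have "ennreal (r powr (\<alpha> - real DIM('a))) = (\<integral>\<^sup>+t. ennreal (heat t (r *\<^sub>R e)) \<partial>prof UNIV)"
      using that e by (subst nn_integral_heat_prof_nz) auto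
    also have "\<dots> \<le> (\<integral>\<^sup>+t. ennreal (heat t (0::'a)) \<partial>prof UNIV)"
      using AE_prof[of UNIV] by (intro nn_integral_mono_AE) (auto elim!: eventually_mono intro!: ennreal_leI heat_mono_norm)
    finally show ?thesis .
  qed
  have "ennreal (real k) \<le> (\<integral>\<^sup>+t. ennreal (heat t (0::'a)) \<partial>prof UNIV)" for k :: nat
  proof (cases "k = 0")
    case False
    have "(real k powr (1 / (\<alpha> - real DIM('a)))) powr (\<alpha> - real DIM('a)) = real k"
      using \<alpha>_less False by (simp add: powr_powr)
    with *[of "real k powr (1 / (\<alpha> - real DIM('a)))"] False show ?thesis by simp
  qed simp
  then have "(SUP k. of_nat k) \<le> (\<integral>\<^sup>+t. ennreal (heat t (0::'a)) \<partial>prof UNIV)"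
    by (intro SUP_least) (simp add: ennreal_of_nat_eq_real_of_nat)
  then show ?thesis by (simp add: ennreal_SUP_of_nat_eq_top top_unique)
qed

lemma riesz_kernel_eq: "riesz_kernel \<alpha> (x::'a) y = (\<integral>\<^sup>+t. ennreal (heat t (x - y)) \<partial>prof UNIV)"
  by (auto simp: riesz_kernel_def nn_integral_heat_prof_nz nn_integral_heat_prof_0)

text \<open>For \<open>\<alpha> < 2\<close> this is the law of the first position above \<open>e\<close> of a stable subordinator of index \<open>\<alpha> / 2\<close>,
  whose potential density is \<open>weight\<close>; by the strong Markov property, convolving it with \<open>weight\<close>
  gives \<open>weight\<close> restricted to \<open>(e, \<infinity>)\<close>.\<close>

definition eta :: "real \<Rightarrow> real measure" where
  "eta e = (if \<alpha> = 2 then return borel e else density lborel (\<lambda>s. ennreal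
     (indicator {e<..} s * (e powr (\<alpha> / 2) * s powr (- 1) * (s - e) powr (- \<alpha> / 2) / Beta (\<alpha> / 2) (1 - \<alpha> / 2)))))"

lemma sets_eta [simp, measurable_cong]: "sets (eta e) = sets borel"
  and space_eta [simp]: "space (eta e) = UNIV"
  by (simp_all add: eta_def)

lemma sigma_finite_eta: "sigma_finite_measure (eta e)"
proof (cases "\<alpha> = 2")
  case True
  interpret prob_space "return borel e" by (rule prob_space_return) simp
  show ?thesis using sigma_finite_measure_axioms True unfolding eta_def by simp
next
  case False
  then show ?thesis unfolding eta_def by (simp, subst sigma_finite_measure.sigma_finite_iff_density_finite[OF sigma_finite_lborel]) auto
qed

lemma AE_eta: "AE s in eta e. e \<le> s"
  unfolding eta_def by (auto simp: AE_density AE_return indicator_def)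

text \<open>With s = 1 / r both t - s and s - e become linear in r up to powers of r. These powers
  cancel against the Jacobian, and a Beta integral over (1 / t, 1 / e) remains.\<close>

lemma eta_inner_integral:
  assumes "0 < e" "e < t" "\<alpha> < 2"
  shows "(\<integral>\<^sup>+s. ennreal ((t - s) powr (\<alpha> / 2 - 1) * (s powr (- 1) * (s - e) powr (- \<alpha> / 2))) * indicator {e<..<t} s \<partial>lborel)
    = ennreal (t powr (\<alpha> / 2 - 1) * e powr (- \<alpha> / 2) * Beta (\<alpha> / 2) (1 - \<alpha> / 2))"
proof -
  let ?b = "\<alpha> / 2"
  define F where "F s = indicator {e<..<t} s * ((t - s) powr (?b - 1) * (s powr (- 1) * (s - e) powr (- ?b)))" for s
  have [measurable]: "F \<in> borel_measurable borel" unfolding F_def by measurable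
  have "(\<integral>\<^sup>+s. ennreal ((t - s) powr (?b - 1) * (s powr (- 1) * (s - e) powr (- \<alpha> / 2))) * indicator {e<..<t} s \<partial>lborel)
    = (\<integral>\<^sup>+s. ennreal (F s) * indicator {0<..} s \<partial>lborel)"
    using assms by (intro nn_integral_cong) (auto simp: F_def split: split_indicator)
  also have "\<dots> = (\<integral>\<^sup>+r. ennreal (F (1 / r)) * ennreal (1 / r\<^sup>2) * indicator {0<..} r \<partial>lborel)"
    by (rule nn_integral_inverse) (auto simp: F_def)
  also have "\<dots> = (\<integral>\<^sup>+r. ennreal (t powr (?b - 1) * e powr (- ?b)) * (ennreal ((r - 1 / t) powr (?b - 1) * (1 / e - r) powr (- ?b)) * indicator {1 / t<..<1 / e} r) \<partial>lborel)"
  proof (rule nn_integral_cong)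
    fix r :: real
    show "ennreal (F (1 / r)) * ennreal (1 / r\<^sup>2) * indicator {0<..} r =
      ennreal (t powr (?b - 1) * e powr (- ?b)) * (ennreal ((r - 1 / t) powr (?b - 1) * (1 / e - r) powr (- ?b)) * indicator {1 / t<..<1 / e} r)"
    proof (cases "1 / t < r \<and> r < 1 / e")
      case True
      have r: "r > 0" using True assms less_trans[of 0 "1 / t" r] by simp
      have in1: "1 / r \<in> {e<..<t}" using True r assms by (auto simp: field_simps)
      have e1: "t - 1 / r = t * (r - 1 / t) / r" "1 / r - e = e * (1 / e - r) / r"
        using r assms by (auto simp: field_simps)
      have "F (1 / r) * (1 / r\<^sup>2) = (t * (r - 1 / t) / r) powr (?b - 1) * ((1 / r) powr (- 1) * (e * (1 / e - r) / r) powr (- ?b)) * (1 / r\<^sup>2)"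
        using in1 by (simp add: F_def e1)
      also have "\<dots> = t powr (?b - 1) * e powr (- ?b) * ((r - 1 / t) powr (?b - 1) * (1 / e - r) powr (- ?b)) * (r / (r powr (?b - 1) * r powr (- ?b) * r\<^sup>2))"
        using r assms True by (simp add: powr_mult powr_divide powr_minus_divide[of _ 1])
      also have "r powr (?b - 1) * r powr (- ?b) * r\<^sup>2 = r"
        using r by (simp add: powr_diff powr_minus power2_eq_square)
      finally have "F (1 / r) * (1 / r\<^sup>2) = t powr (?b - 1) * e powr (- ?b) * ((r - 1 / t) powr (?b - 1) * (1 / e - r) powr (- ?b))"
        using r by simp
      then show ?thesis using True r by (simp add: ennreal_mult'[symmetric] ennreal_mult''[symmetric])
    next
      case False
      then have "\<not> (0 < r \<and> 1 / r \<in> {e<..<t})" using assms by (auto simp: field_simps)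
      then have "F (1 / r) = 0 \<or> r \<notin> {0<..}" by (auto simp: F_def)
      then show ?thesis using False by auto
    qed
  qed
  also have "\<dots> = ennreal (t powr (?b - 1) * e powr (- ?b)) * ennreal (Beta ?b (1 - ?b))"
    by (subst nn_integral_cmult, simp, subst nn_integral_shifted_Beta[of "1 / t" "1 / e" ?b])
      (use assms \<alpha>_pos in \<open>auto simp: field_simps\<close>)
  finally show ?thesis by (simp add: ennreal_mult')
qed

text \<open>The same substitution with 1 / t replaced by 0; the value is what makes
  \<open>eta\<close> a probability measure.\<close>

lemma eta_total_aux:
  assumes "0 < e" "\<alpha> < 2"
  shows "(\<integral>\<^sup>+s. ennreal (s powr (- 1) * (s - e) powr (- \<alpha> / 2)) * indicator {e<..} s \<partial>lborel)
    = ennreal (e powr (- \<alpha> / 2) * Beta (\<alpha> / 2) (1 - \<alpha> / 2))"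
proof -
  let ?b = "\<alpha> / 2"
  define F where "F s = indicator {e<..} s * (s powr (- 1) * (s - e) powr (- ?b))" for s
  have [measurable]: "F \<in> borel_measurable borel" unfolding F_def by measurable
  have "(\<integral>\<^sup>+s. ennreal (s powr (- 1) * (s - e) powr (- \<alpha> / 2)) * indicator {e<..} s \<partial>lborel)
    = (\<integral>\<^sup>+s. ennreal (F s) * indicator {0<..} s \<partial>lborel)"
    using assms by (intro nn_integral_cong) (auto simp: F_def split: split_indicator)
  also have "\<dots> = (\<integral>\<^sup>+r. ennreal (F (1 / r)) * ennreal (1 / r\<^sup>2) * indicator {0<..} r \<partial>lborel)"
    by (rule nn_integral_inverse) (auto simp: F_def)
  also have "\<dots> = (\<integral>\<^sup>+r. ennreal (e powr (- ?b)) * (ennreal ((r - 0) powr (?b - 1) * (1 / e - r) powr (- ?b)) * indicator {0<..<1 / e} r) \<partial>lborel)"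
  proof (rule nn_integral_cong)
    fix r :: real
    show "ennreal (F (1 / r)) * ennreal (1 / r\<^sup>2) * indicator {0<..} r =
      ennreal (e powr (- ?b)) * (ennreal ((r - 0) powr (?b - 1) * (1 / e - r) powr (- ?b)) * indicator {0<..<1 / e} r)"
    proof (cases "0 < r \<and> r < 1 / e")
      case True
      then have r: "r > 0" by simp
      have in1: "1 / r \<in> {e<..}" using True r assms by (auto simp: field_simps)
      have e1: "1 / r - e = e * (1 / e - r) / r"
        using r assms by (auto simp: field_simps)
      have "F (1 / r) * (1 / r\<^sup>2) = ((1 / r) powr (- 1) * (e * (1 / e - r) / r) powr (- ?b)) * (1 / r\<^sup>2)"
        using in1 by (simp add: F_def e1)
      also have "\<dots> = e powr (- ?b) * (1 / e - r) powr (- ?b) * (r / (r powr (- ?b) * r\<^sup>2))"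
        using r assms True by (simp add: powr_mult powr_divide powr_minus_divide[of _ 1])
      also have "r / (r powr (- ?b) * r\<^sup>2) = r powr ?b / r"
        using r by (simp add: powr_minus_divide power2_eq_square)
      also have "r powr ?b / r = r powr (?b - 1)"
        using r by (simp add: powr_diff)
      finally have "F (1 / r) * (1 / r\<^sup>2) = e powr (- ?b) * ((r - 0) powr (?b - 1) * (1 / e - r) powr (- ?b))"
        using r by simp
      then show ?thesis using True r by (simp add: ennreal_mult'[symmetric] ennreal_mult''[symmetric])
    next
      case False
      then have "\<not> (0 < r \<and> 1 / r \<in> {e<..})" using assms by (auto simp: field_simps)
      then have "F (1 / r) = 0 \<or> r \<notin> {0<..}" by (auto simp: F_def)
      then show ?thesis using False by auto
    qed
  qed
  also have "\<dots> = ennreal (e powr (- ?b)) * ennreal (Beta ?b (1 - ?b))"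
    by (subst nn_integral_cmult, simp, subst nn_integral_shifted_Beta[of 0 "1 / e" ?b])
      (use assms \<alpha>_pos in \<open>auto simp: field_simps\<close>)
  finally show ?thesis by (simp add: ennreal_mult')
qed

end

section \<open>Mixtures of heat kernels\<close>

text \<open>The heat mean of the measure with density \<open>g\<close> with respect to
  \<open>\<nu>\<close>. With \<open>g\<close> constant it acts on measures, with
  \<open>\<nu>\<close> the Lebesgue measure on functions, so that one set of symmetry and semigroup
  laws serves both.\<close>

definition smear :: "real \<Rightarrow> 'a::euclidean_space measure \<Rightarrow> ('a \<Rightarrow> ennreal) \<Rightarrow> 'a \<Rightarrow> ennreal" where
  "smear t \<nu> g x = (\<integral>\<^sup>+y. ennreal (heat t (x - y)) * g y \<partial>\<nu>)"

definition mix :: "real measure \<Rightarrow> 'a::euclidean_space measure \<Rightarrow> ('a \<Rightarrow> ennreal) \<Rightarrow> 'a \<Rightarrow> ennreal" where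
  "mix \<theta> \<nu> g x = (\<integral>\<^sup>+t. smear t \<nu> g x \<partial>\<theta>)"

definition sfin :: "'a::topological_space measure \<Rightarrow> bool" where
  "sfin \<nu> \<longleftrightarrow> sets \<nu> = sets borel \<and> sigma_finite_measure \<nu>"

lemma sfin_sets: "sfin \<nu> \<Longrightarrow> sets \<nu> = sets borel"
  and sfin_sigma_finite: "sfin \<nu> \<Longrightarrow> sigma_finite_measure \<nu>"
  by (auto simp: sfin_def)

lemma sfin_lborel [simp]: "sfin lborel"
  by (simp add: sfin_def sigma_finite_lborel)

lemma sfin_return [simp]: "sfin (return borel x)"
proof -
  interpret prob_space "return borel x" by (rule prob_space_return) simp
  show ?thesis by (simp add: sfin_def sigma_finite_measure_axioms)
qed

lemma sfin_measurable: "sfin \<nu> \<Longrightarrow> measurable \<nu> M = measurable borel M"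
  by (intro measurable_cong_sets) (auto simp: sfin_sets)

lemma nn_integral_swap:
  assumes \<nu>: "sfin \<nu>" and \<mu>: "sfin \<mu>" and f: "(\<lambda>p. f (fst p) (snd p)) \<in> borel_measurable (borel \<Otimes>\<^sub>M borel)"
  shows "(\<integral>\<^sup>+x. \<integral>\<^sup>+y. f x y \<partial>\<nu> \<partial>\<mu>) = (\<integral>\<^sup>+y. \<integral>\<^sup>+x. f x y \<partial>\<mu> \<partial>\<nu>)"
proof -
  interpret N: sigma_finite_measure \<nu> using \<nu> by (rule sfin_sigma_finite)
  interpret M: sigma_finite_measure \<mu> using \<mu> by (rule sfin_sigma_finite)
  interpret pair_sigma_finite \<nu> \<mu> ..
  have s: "sets (\<mu> \<Otimes>\<^sub>M \<nu>) = sets (borel \<Otimes>\<^sub>M borel)" "sets (\<nu> \<Otimes>\<^sub>M \<mu>) = sets (borel \<Otimes>\<^sub>M borel)"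
    using \<nu> \<mu> by (auto simp: sfin_sets intro!: sets_pair_measure_cong)
  have "(\<lambda>(y, x). f x y) \<in> borel_measurable (borel \<Otimes>\<^sub>M borel)"
    using measurable_compose[OF measurable_pair_swap' f] by (simp add: split_def)
  then have "(\<lambda>(y, x). f x y) \<in> borel_measurable (\<nu> \<Otimes>\<^sub>M \<mu>)"
    by (subst measurable_cong_sets[OF s(2) refl])
  from Fubini'[OF this] show ?thesis .
qed

lemma borel_measurable_nn_integral_sfin:
  assumes "sfin \<nu>" "(\<lambda>p. f (fst p) (snd p)) \<in> borel_measurable (M \<Otimes>\<^sub>M borel)"
  shows "(\<lambda>x. \<integral>\<^sup>+y. f x y \<partial>\<nu>) \<in> borel_measurable M"
proof -
  interpret N: sigma_finite_measure \<nu> using assms by (simp add: sfin_sigma_finite)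
  have s: "sets (M \<Otimes>\<^sub>M \<nu>) = sets (M \<Otimes>\<^sub>M borel)"
    using assms by (auto simp: sfin_sets intro!: sets_pair_measure_cong)
  show ?thesis
    using assms(2) by (intro N.borel_measurable_nn_integral) (simp add: split_def measurable_cong_sets[OF s refl])
qed

lemma smear_measurable [measurable (raw)]:
  assumes "sfin \<nu>" and [measurable]: "g \<in> borel_measurable borel" "a \<in> borel_measurable M" "b \<in> borel_measurable M"
  shows "(\<lambda>p. smear (a p) \<nu> g (b p)) \<in> borel_measurable M"
  unfolding smear_def by (rule borel_measurable_nn_integral_sfin[OF assms(1)]) measurable

lemma mix_measurable [measurable (raw)]:
  assumes "sfin \<nu>" "sfin \<theta>" and [measurable]: "g \<in> borel_measurable borel" "b \<in> borel_measurable M"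
  shows "(\<lambda>p. mix \<theta> \<nu> g (b p)) \<in> borel_measurable M"
  unfolding mix_def using assms by (intro borel_measurable_nn_integral_sfin[OF assms(2)] smear_measurable) measurable

lemma smear_smear:
  assumes "sfin \<nu>" and g[measurable]: "g \<in> borel_measurable borel" and st: "0 < s" "0 < t"
  shows "smear s lborel (smear t \<nu> g) x = smear (s + t) \<nu> g x"
proof -
  have "smear s lborel (smear t \<nu> g) x = (\<integral>\<^sup>+z. \<integral>\<^sup>+y. ennreal (heat s (x - z)) * (ennreal (heat t (z - y)) * g y) \<partial>\<nu> \<partial>lborel)"
    unfolding smear_def by (subst nn_integral_cmult) (auto simp: sfin_measurable[OF assms(1)])
  also have "\<dots> = (\<integral>\<^sup>+y. \<integral>\<^sup>+z. ennreal (heat s (x - z)) * (ennreal (heat t (z - y)) * g y) \<partial>lborel \<partial>\<nu>)"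
    by (rule nn_integral_swap) (auto simp: assms(1))
  also have "\<dots> = (\<integral>\<^sup>+y. (\<integral>\<^sup>+z. ennreal (heat s (x - z)) * ennreal (heat t (z - y)) \<partial>lborel) * g y \<partial>\<nu>)"
    by (subst nn_integral_multc[symmetric]) (auto simp: mult.assoc)
  also have "\<dots> = smear (s + t) \<nu> g x"
    unfolding smear_def heat_semigroup'[OF st] ..
  finally show ?thesis .
qed

lemma smear_sym:
  assumes "sfin \<nu>" "sfin \<mu>" and g[measurable]: "g \<in> borel_measurable borel" and h[measurable]: "h \<in> borel_measurable borel"
  shows "(\<integral>\<^sup>+x. smear t \<nu> g x * h x \<partial>\<mu>) = (\<integral>\<^sup>+y. smear t \<mu> h y * g y \<partial>\<nu>)"
proof -
  have "(\<integral>\<^sup>+x. smear t \<nu> g x * h x \<partial>\<mu>) = (\<integral>\<^sup>+x. \<integral>\<^sup>+y. ennreal (heat t (x - y)) * g y * h x \<partial>\<nu> \<partial>\<mu>)"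
    unfolding smear_def by (subst nn_integral_multc) (auto simp: sfin_measurable[OF assms(1)])
  also have "\<dots> = (\<integral>\<^sup>+y. \<integral>\<^sup>+x. ennreal (heat t (x - y)) * g y * h x \<partial>\<mu> \<partial>\<nu>)"
    by (rule nn_integral_swap) (auto simp: assms)
  also have "\<dots> = (\<integral>\<^sup>+y. \<integral>\<^sup>+x. ennreal (heat t (y - x)) * h x * g y \<partial>\<mu> \<partial>\<nu>)"
    by (intro nn_integral_cong) (simp add: mult_ac heat_commute[of t])
  also have "\<dots> = (\<integral>\<^sup>+y. smear t \<mu> h y * g y \<partial>\<nu>)"
    unfolding smear_def by (subst nn_integral_multc) (auto simp: sfin_measurable[OF assms(2)])
  finally show ?thesis .
qed

lemma mix_sym:
  assumes "sfin \<nu>" "sfin \<mu>" "sfin \<theta>" and g[measurable]: "g \<in> borel_measurable borel" and h[measurable]: "h \<in> borel_measurable borel"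
  shows "(\<integral>\<^sup>+x. mix \<theta> \<nu> g x * h x \<partial>\<mu>) = (\<integral>\<^sup>+y. mix \<theta> \<mu> h y * g y \<partial>\<nu>)"
proof -
  have *: "(\<integral>\<^sup>+x. mix \<theta> \<nu> g x * h x \<partial>\<mu>) = (\<integral>\<^sup>+t. \<integral>\<^sup>+x. smear t \<nu> g x * h x \<partial>\<mu> \<partial>\<theta>)"
    if [simp]: "sfin \<nu>" "sfin \<mu>" "sfin \<theta>" and [measurable]: "g \<in> borel_measurable borel" "h \<in> borel_measurable borel"
    for \<nu> \<mu> :: "'a measure" and g h
  proof -
    have "(\<integral>\<^sup>+x. mix \<theta> \<nu> g x * h x \<partial>\<mu>) = (\<integral>\<^sup>+x. \<integral>\<^sup>+t. smear t \<nu> g x * h x \<partial>\<theta> \<partial>\<mu>)"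
      unfolding mix_def by (subst nn_integral_multc) (auto simp: sfin_measurable)
    also have "\<dots> = (\<integral>\<^sup>+t. \<integral>\<^sup>+x. smear t \<nu> g x * h x \<partial>\<mu> \<partial>\<theta>)"
      by (rule nn_integral_swap) auto
    finally show ?thesis .
  qed
  show ?thesis using assms by (simp add: * smear_sym[of \<nu> \<mu> g h])
qed

definition profile :: "real measure \<Rightarrow> bool" where
  "profile \<theta> \<longleftrightarrow> sfin \<theta> \<and> (AE t in \<theta>. 0 < t)"

lemma profile_sfin: "profile \<theta> \<Longrightarrow> sfin \<theta>" by (simp add: profile_def)

lemma smear_mix:
  assumes "sfin \<nu>" "profile \<eta>" and g[measurable]: "g \<in> borel_measurable borel" and "0 < s"
  shows "smear s lborel (mix \<eta> \<nu> g) x = (\<integral>\<^sup>+t. smear (s + t) \<nu> g x \<partial>\<eta>)"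
proof -
  have \<eta>: "sfin \<eta>" "AE t in \<eta>. 0 < t" using assms by (auto simp: profile_def)
  note [simp] = \<eta>(1) assms(1)
  have "smear s lborel (mix \<eta> \<nu> g) x = (\<integral>\<^sup>+z. \<integral>\<^sup>+t. ennreal (heat s (x - z)) * smear t \<nu> g z \<partial>\<eta> \<partial>lborel)"
    unfolding smear_def[of s] mix_def by (subst nn_integral_cmult) (auto simp: sfin_measurable)
  also have "\<dots> = (\<integral>\<^sup>+t. \<integral>\<^sup>+z. ennreal (heat s (x - z)) * smear t \<nu> g z \<partial>lborel \<partial>\<eta>)"
    by (rule nn_integral_swap) auto
  also have "\<dots> = (\<integral>\<^sup>+t. smear (s + t) \<nu> g x \<partial>\<eta>)"
    using \<eta>(2) by (intro nn_integral_cong_AE) (auto elim!: eventually_mono simp: smear_smear[OF assms(1) g assms(4), symmetric] smear_def[of s])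
  finally show ?thesis .
qed

lemma mix_mix:
  assumes "sfin \<nu>" "profile \<theta>" "profile \<eta>" and g[measurable]: "g \<in> borel_measurable borel"
  shows "mix \<theta> lborel (mix \<eta> \<nu> g) x = (\<integral>\<^sup>+s. \<integral>\<^sup>+t. smear (s + t) \<nu> g x \<partial>\<eta> \<partial>\<theta>)"
  unfolding mix_def[of \<theta>] using assms
  by (intro nn_integral_cong_AE) (auto elim!: eventually_mono simp: profile_def smear_mix)

text \<open>Both sides mix heat kernels at times s + t over the product of the two profiles. This
  allows truncation, averaging and the formation of potentials to be exchanged.\<close>

lemma mix_commute:
  assumes "sfin \<nu>" "profile \<theta>" "profile \<eta>" and g[measurable]: "g \<in> borel_measurable borel"
  shows "mix \<theta> lborel (mix \<eta> \<nu> g) x = mix \<eta> lborel (mix \<theta> \<nu> g) x"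
proof -
  note [simp] = profile_sfin[OF assms(2)] profile_sfin[OF assms(3)] assms(1)
  show ?thesis
    unfolding mix_mix[OF assms(1,2,3) g] mix_mix[OF assms(1,3,2) g]
    by (subst nn_integral_swap) (auto simp: add.commute)
qed

lemma smear_mono: "(\<And>y. f y \<le> g y) \<Longrightarrow> smear t \<nu> f x \<le> smear t \<nu> g x"
  unfolding smear_def by (intro nn_integral_mono mult_left_mono) auto

lemma mix_mono: "(\<And>y. f y \<le> g y) \<Longrightarrow> mix \<theta> \<nu> f x \<le> mix \<theta> \<nu> g x"
  unfolding mix_def by (intro nn_integral_mono smear_mono) auto

lemma mix_add:
  assumes [simp]: "sfin \<nu>" "sfin \<theta>" and [measurable]: "f \<in> borel_measurable borel" "g \<in> borel_measurable borel"
  shows "mix \<theta> \<nu> (\<lambda>y. f y + g y) x = mix \<theta> \<nu> f x + mix \<theta> \<nu> g x"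
proof -
  have "smear t \<nu> (\<lambda>y. f y + g y) x = smear t \<nu> f x + smear t \<nu> g x" for t
    unfolding smear_def by (subst nn_integral_add[symmetric]) (auto simp: sfin_measurable distrib_left)
  then show ?thesis unfolding mix_def by (subst nn_integral_add[symmetric]) (auto simp: sfin_measurable)
qed

lemma mix_cmult:
  assumes [simp]: "sfin \<nu>" "sfin \<theta>" and [measurable]: "f \<in> borel_measurable borel"
  shows "mix \<theta> \<nu> (\<lambda>y. c * f y) x = c * mix \<theta> \<nu> f x"
proof -
  have "smear t \<nu> (\<lambda>y. c * f y) x = c * smear t \<nu> f x" for t
    unfolding smear_def by (subst nn_integral_cmult[symmetric]) (auto simp: sfin_measurable mult_ac)
  then show ?thesis unfolding mix_def by (simp add: nn_integral_cmult sfin_measurable)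
qed

lemma mix_const:
  assumes "profile \<theta>"
  shows "mix \<theta> lborel (\<lambda>_. c) x = c * emeasure \<theta> UNIV"
proof -
  have [simp]: "space \<theta> = UNIV"
    using sets_eq_imp_space_eq[OF sfin_sets[OF profile_sfin[OF assms]]] by simp
  have "smear t lborel (\<lambda>_. c) x = c" if "t > 0" for t
    unfolding smear_def using that by (subst nn_integral_multc) (auto simp: nn_integral_heat')
  then have "mix \<theta> lborel (\<lambda>_. c) x = (\<integral>\<^sup>+t. c \<partial>\<theta>)"
    unfolding mix_def using assms by (intro nn_integral_cong_AE) (auto simp: profile_def elim!: eventually_mono)
  then show ?thesis by simp
qed

section \<open>Averaging with the measures \<open>eta\<close>\<close>

context riesz
begin

lemma profile_prof [simp]: "I \<in> sets borel \<Longrightarrow> profile (prof I)"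
  using AE_prof[of I] by (auto simp: profile_def sfin_def sigma_finite_prof)

lemma sfin_prof [simp]: "I \<in> sets borel \<Longrightarrow> sfin (prof I)"
  by (simp add: profile_sfin)

lemma profile_eta [simp]: "0 < e \<Longrightarrow> profile (eta e)"
  using AE_eta[of e] by (auto simp: profile_def sfin_def sigma_finite_eta)

lemma sfin_eta [simp]: "sfin (eta e)"
  by (auto simp: sfin_def sigma_finite_eta)

lemma emeasure_eta:
  assumes "0 < e" shows "emeasure (eta e) UNIV = 1"
proof (cases "\<alpha> = 2")
  case True
  then show ?thesis unfolding eta_def by simp
next
  case False
  let ?b = "\<alpha> / 2"
  have B: "Beta ?b (1 - ?b) > 0"
    using False \<alpha>_le \<alpha>_pos unfolding Beta_def by (auto intro!: divide_pos_pos mult_pos_pos Gamma_real_pos)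
  have "emeasure (eta e) UNIV = (\<integral>\<^sup>+s. ennreal (e powr ?b / Beta ?b (1 - ?b)) *
      (ennreal (s powr (- 1) * (s - e) powr (- \<alpha> / 2)) * indicator {e<..} s) \<partial>lborel)"
    unfolding eta_def using False B
    by (simp add: emeasure_density, intro nn_integral_cong) (auto simp: ennreal_mult'[symmetric] split: split_indicator)
  also have "\<dots> = ennreal (e powr ?b / Beta ?b (1 - ?b)) * ennreal (e powr (- \<alpha> / 2) * Beta ?b (1 - ?b))"
    using False \<alpha>_le assms by (subst nn_integral_cmult, simp, subst eta_total_aux) auto
  also have "\<dots> = 1"
    using B assms by (simp add: ennreal_mult'[symmetric] powr_minus)
  finally show ?thesis .
qed

lemma nn_integral_prof_shift:
  assumes [measurable]: "\<phi> \<in> borel_measurable borel"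
  shows "(\<integral>\<^sup>+t. \<phi> (s + t) \<partial>prof {d<..}) = (\<integral>\<^sup>+t. indicator ({d<..} \<inter> {0<..}) (t - s) * ennreal (weight (t - s)) * \<phi> t \<partial>lborel)"
  by (simp add: nn_integral_prof, subst nn_integral_real_affine[where c=1 and t="-s"]) auto

lemma nn_integral_prof_shift_UNIV:
  assumes [measurable]: "\<phi> \<in> borel_measurable borel"
  shows "(\<integral>\<^sup>+t. \<phi> (s + t) \<partial>prof UNIV) = (\<integral>\<^sup>+t. indicator {0<..} (t - s) * ennreal (weight (t - s)) * \<phi> t \<partial>lborel)"
  by (simp add: nn_integral_prof, subst nn_integral_real_affine[where c=1 and t="-s"]) auto

lemma eta_weight:
  assumes "0 < e" "t \<noteq> e"
  shows "(\<integral>\<^sup>+s. indicator {0<..} (t - s) * ennreal (weight (t - s)) \<partial>eta e) = indicator {e<..} t * ennreal (weight t)"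
proof (cases "\<alpha> = 2")
  case True
  then have "eta e = return borel e" "\<And>t. t > 0 \<Longrightarrow> weight t = weight_const"
    unfolding eta_def weight_def by auto
  then show ?thesis using assms
    by (simp, subst nn_integral_return) (auto split: split_indicator)
next
  case False
  let ?b = "\<alpha> / 2"
  have B: "Beta ?b (1 - ?b) > 0"
    using False \<alpha>_le \<alpha>_pos unfolding Beta_def by (auto intro!: divide_pos_pos mult_pos_pos Gamma_real_pos)
  have "(\<integral>\<^sup>+s. indicator {0<..} (t - s) * ennreal (weight (t - s)) \<partial>eta e) =
    (\<integral>\<^sup>+s. ennreal (weight_const * e powr ?b / Beta ?b (1 - ?b)) *
      (ennreal ((t - s) powr (\<alpha> / 2 - 1) * (s powr (- 1) * (s - e) powr (- \<alpha> / 2))) * indicator {e<..<t} s) \<partial>lborel)"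
    unfolding eta_def using False B weight_const_pos
    by (simp add: nn_integral_density, intro nn_integral_cong)
       (auto simp: weight_def ennreal_mult'[symmetric] mult_ac split: split_indicator)
  also have "\<dots> = ennreal (weight_const * e powr ?b / Beta ?b (1 - ?b)) *
      (\<integral>\<^sup>+s. (ennreal ((t - s) powr (\<alpha> / 2 - 1) * (s powr (- 1) * (s - e) powr (- \<alpha> / 2))) * indicator {e<..<t} s) \<partial>lborel)"
    by (subst nn_integral_cmult) auto
  also have "\<dots> = indicator {e<..} t * ennreal (weight t)"
  proof (cases "e < t")
    case True
    then show ?thesis
      using False \<alpha>_le assms B weight_const_pos
      by (subst eta_inner_integral) (auto simp: weight_def ennreal_mult'[symmetric] powr_minus)
  next
    case False
    then have "{e<..<t} = {}" by auto
    then show ?thesis using False by simp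
  qed
  finally show ?thesis .
qed

lemma nn_integral_eta_prof:
  assumes "0 < e" and [measurable]: "\<phi> \<in> borel_measurable borel"
  shows "(\<integral>\<^sup>+s. \<integral>\<^sup>+t. \<phi> (s + t) \<partial>prof UNIV \<partial>eta e) = (\<integral>\<^sup>+t. \<phi> t \<partial>prof {e<..})"
proof -
  have "(\<integral>\<^sup>+s. \<integral>\<^sup>+t. \<phi> (s + t) \<partial>prof UNIV \<partial>eta e) =
    (\<integral>\<^sup>+s. \<integral>\<^sup>+t. indicator {0<..} (t - s) * ennreal (weight (t - s)) * \<phi> t \<partial>lborel \<partial>eta e)"
    by (simp add: nn_integral_prof_shift_UNIV)
  also have "\<dots> = (\<integral>\<^sup>+t. \<integral>\<^sup>+s. indicator {0<..} (t - s) * ennreal (weight (t - s)) * \<phi> t \<partial>eta e \<partial>lborel)"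
    by (rule nn_integral_swap) auto
  also have "\<dots> = (\<integral>\<^sup>+t. (\<integral>\<^sup>+s. indicator {0<..} (t - s) * ennreal (weight (t - s)) \<partial>eta e) * \<phi> t \<partial>lborel)"
    by (subst nn_integral_multc) auto
  also have "\<dots> = (\<integral>\<^sup>+t. indicator {e<..} t * ennreal (weight t) * \<phi> t \<partial>lborel)"
    using assms(1) AE_lborel_singleton[of e]
    by (intro nn_integral_cong_AE) (auto elim!: eventually_mono simp: eta_weight)
  also have "\<dots> = (\<integral>\<^sup>+t. \<phi> t \<partial>prof {e<..})"
    using assms(1) by (subst nn_integral_prof) (auto intro!: nn_integral_cong split: split_indicator)
  finally show ?thesis .
qed

text \<open>Averaging a potential over \<open>eta e\<close> deletes exactly the times up to e.
  Truncation is thus an averaging operation, and potentials can only decrease under it.\<close>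

lemma mix_eta_prof:
  assumes "0 < e" "sfin \<nu>" "g \<in> borel_measurable borel"
  shows "mix (eta e) lborel (mix (prof UNIV) \<nu> g) x = mix (prof {e<..}) \<nu> g x"
  using assms by (subst mix_mix) (auto intro!: nn_integral_eta_prof simp: mix_def)

lemma mix_prof_mono:
  assumes "sfin \<nu>" "g \<in> borel_measurable borel" "I \<subseteq> J" "I \<in> sets borel" "J \<in> sets borel"
  shows "mix (prof I) \<nu> g x \<le> mix (prof J) \<nu> g x"
  unfolding mix_def using assms by (intro nn_integral_prof_mono) auto

lemma potential_eq:
  assumes "sfin \<nu>"
  shows "potential \<alpha> \<nu> x = mix (prof UNIV) \<nu> (\<lambda>_. 1) (x::'a)"
  unfolding potential_def riesz_kernel_eq mix_def smear_def mult_1_right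
  using assms by (intro nn_integral_swap) auto

end

section \<open>Energy\<close>

text \<open>The square of a + s c - b is nonnegative; its negative terms are moved to the left
  because \<open>ennreal\<close> has no negative values.\<close>

lemma nn_integral_square_ineq3:
  fixes a b c s :: ennreal
  shows "2 * (a * b) + 2 * (s * (b * c)) \<le> a * a + b * b + s * s * (c * c) + 2 * (s * (a * c))"
proof -
  have *: "2 * (a * b) + 2 * (b * c) \<le> a * a + b * b + c * c + 2 * (a * c)" for a b c :: ennreal
  proof (cases "a = \<top> \<or> b = \<top> \<or> c = \<top>")
    case True
    then show ?thesis by (auto simp: ennreal_top_mult ennreal_mult_top)
  next
    case False
    then obtain a' b' c' where [simp]: "a = ennreal a'" "b = ennreal b'" "c = ennreal c'"
      and nn: "0 \<le> a'" "0 \<le> b'" "0 \<le> c'"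
      by (metis ennreal_cases infinity_ennreal_def)
    have "0 \<le> (a' + c' - b')\<^sup>2" by simp
    then have "2 * (a' * b') + 2 * (b' * c') \<le> a' * a' + b' * b' + c' * c' + 2 * (a' * c')"
      by (simp add: power2_eq_square algebra_simps)
    then have "ennreal (2 * (a' * b') + 2 * (b' * c')) \<le> ennreal (a' * a' + b' * b' + c' * c' + 2 * (a' * c'))"
      by (rule ennreal_leI)
    then show ?thesis using nn
      by (simp add: ennreal_plus ennreal_mult' del: ennreal_le_iff)
  qed
  from *[of a b "s * c"] show ?thesis by (simp add: ac_simps)
qed

context riesz
begin

text \<open>A pair \<open>(\<mu>, f)\<close> stands for the measure with density \<open>f\<close> with respect to \<open>\<mu>\<close>; this avoids
  the question whether that measure is \<open>\<sigma>\<close>-finite.\<close>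

definition pot :: "'a measure \<Rightarrow> ('a \<Rightarrow> ennreal) \<Rightarrow> 'a \<Rightarrow> ennreal" where
  "pot = mix (prof UNIV)"

definition energy :: "'a measure \<Rightarrow> ('a \<Rightarrow> ennreal) \<Rightarrow> 'a measure \<Rightarrow> ('a \<Rightarrow> ennreal) \<Rightarrow> ennreal" where
  "energy \<mu> f \<nu> g = (\<integral>\<^sup>+x. pot \<nu> g x * f x \<partial>\<mu>)"

lemma pot_measurable [measurable (raw)]:
  assumes "sfin \<nu>" "g \<in> borel_measurable borel" "b \<in> borel_measurable M"
  shows "(\<lambda>p. pot \<nu> g (b p)) \<in> borel_measurable M"
  unfolding pot_def using assms by (intro mix_measurable) auto

lemma energy_commute:
  assumes "sfin \<mu>" "sfin \<nu>" "f \<in> borel_measurable borel" "g \<in> borel_measurable borel"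
  shows "energy \<mu> f \<nu> g = energy \<nu> g \<mu> f"
  unfolding energy_def pot_def using assms by (intro mix_sym) auto

text \<open>The heat kernel at time t is the convolution of two heat kernels at time t / 2, so the
  energy becomes an integral of products in L^2. Positive definiteness rests on this.\<close>

lemma energy_eq_half_heat:
  assumes [simp]: "sfin \<mu>" "sfin \<nu>" and [measurable]: "f \<in> borel_measurable borel" "g \<in> borel_measurable borel"
  shows "energy \<mu> f \<nu> g = (\<integral>\<^sup>+t. \<integral>\<^sup>+z. smear (t / 2) \<mu> f z * smear (t / 2) \<nu> g z \<partial>lborel \<partial>prof UNIV)"
proof -
  have "energy \<mu> f \<nu> g = (\<integral>\<^sup>+x. \<integral>\<^sup>+t. smear t \<nu> g x * f x \<partial>prof UNIV \<partial>\<mu>)"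
    unfolding energy_def pot_def mix_def by (subst nn_integral_multc) (auto simp: sfin_measurable)
  also have "\<dots> = (\<integral>\<^sup>+t. \<integral>\<^sup>+x. smear t \<nu> g x * f x \<partial>\<mu> \<partial>prof UNIV)"
    by (rule nn_integral_swap) auto
  also have "\<dots> = (\<integral>\<^sup>+t. \<integral>\<^sup>+z. smear (t / 2) \<mu> f z * smear (t / 2) \<nu> g z \<partial>lborel \<partial>prof UNIV)"
  proof (rule nn_integral_cong_AE)
    show "AE t in prof UNIV. (\<integral>\<^sup>+x. smear t \<nu> g x * f x \<partial>\<mu>) = (\<integral>\<^sup>+z. smear (t / 2) \<mu> f z * smear (t / 2) \<nu> g z \<partial>lborel)"
      using AE_prof[of UNIV, simplified]
    proof eventually_elim
      case (elim t)
      have "smear t \<nu> g x = smear (t / 2) lborel (smear (t / 2) \<nu> g) x" for x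
        using elim by (subst smear_smear) auto
      then show ?case by (simp add: smear_sym[of lborel \<mu>])
    qed
  qed
  finally show ?thesis .
qed

text \<open>Nonnegativity of the energy of f \<rho> + s h \<nu> - g \<mu>. A small s gives a
  Cauchy-Schwarz argument in the domination principle, s = 0 the two-measure inequality, and s = 1
  covers signed measures.\<close>

lemma energy_psd3:
  assumes [simp]: "sfin \<rho>" "sfin \<mu>" "sfin \<nu>"
    and [measurable]: "f \<in> borel_measurable borel" "g \<in> borel_measurable borel" "h \<in> borel_measurable borel"
  shows "2 * energy \<rho> f \<mu> g + 2 * (s * energy \<mu> g \<nu> h) \<le>
    energy \<rho> f \<rho> f + energy \<mu> g \<mu> g + s * s * energy \<nu> h \<nu> h + 2 * (s * energy \<rho> f \<nu> h)"
proof -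
  let ?a = "\<lambda>t. smear (t / 2) \<rho> f" and ?b = "\<lambda>t. smear (t / 2) \<mu> g" and ?c = "\<lambda>t. smear (t / 2) \<nu> h"
  have "2 * energy \<rho> f \<mu> g + 2 * (s * energy \<mu> g \<nu> h) =
    (\<integral>\<^sup>+t. \<integral>\<^sup>+z. 2 * (?a t z * ?b t z) + 2 * (s * (?b t z * ?c t z)) \<partial>lborel \<partial>prof UNIV)"
    by (simp add: energy_eq_half_heat nn_integral_cmult nn_integral_add)
  also have "\<dots> \<le> (\<integral>\<^sup>+t. \<integral>\<^sup>+z. ?a t z * ?a t z + ?b t z * ?b t z + s * s * (?c t z * ?c t z) + 2 * (s * (?a t z * ?c t z)) \<partial>lborel \<partial>prof UNIV)"
    by (intro nn_integral_mono nn_integral_square_ineq3)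
  also have "\<dots> = energy \<rho> f \<rho> f + energy \<mu> g \<mu> g + s * s * energy \<nu> h \<nu> h + 2 * (s * energy \<rho> f \<nu> h)"
    by (simp add: energy_eq_half_heat nn_integral_cmult nn_integral_add)
  finally show ?thesis .
qed

lemma energy_psd:
  assumes "sfin \<rho>" "sfin \<mu>" "f \<in> borel_measurable borel" "g \<in> borel_measurable borel"
  shows "2 * energy \<rho> f \<mu> g \<le> energy \<rho> f \<rho> f + energy \<mu> g \<mu> g"
  using energy_psd3[of \<rho> \<mu> \<mu> f g g 0] assms by simp

lemma energy_finite:
  assumes "sfin \<rho>" "sfin \<mu>" "f \<in> borel_measurable borel" "g \<in> borel_measurable borel"
    "energy \<rho> f \<rho> f < \<infinity>" "energy \<mu> g \<mu> g < \<infinity>"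
  shows "energy \<rho> f \<mu> g < \<infinity>"
proof -
  have "2 * energy \<rho> f \<mu> g < \<infinity>"
    using energy_psd[OF assms(1-4)] assms(5,6) by (auto intro: le_less_trans)
  then show ?thesis by (auto simp: ennreal_mult_less_top)
qed

section \<open>Truncated kernels and the mass of small times\<close>

definition trunc_bound :: "real \<Rightarrow> ennreal" where
  "trunc_bound d = (\<integral>\<^sup>+t. ennreal (heat t (0::'a)) \<partial>prof {d<..})"

text \<open>The kernel is finite at a unit vector, and for times above d the heat kernel at the
  origin exceeds the one at that vector by a factor of at most exp (1 / (4 d)).\<close>

lemma trunc_bound_finite:
  assumes "0 < d" shows "trunc_bound d < \<infinity>"
proof -
  obtain e :: 'a where e: "norm e = 1" using vector_choose_size[of 1] by auto
  have "trunc_bound d \<le> (\<integral>\<^sup>+t. ennreal (exp (1 / (4 * d))) * ennreal (heat t e) \<partial>prof {d<..})"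
    unfolding trunc_bound_def
  proof (rule nn_integral_mono_AE)
    show "AE t in prof {d<..}. ennreal (heat t (0::'a)) \<le> ennreal (exp (1 / (4 * d))) * ennreal (heat t e)"
    proof -
      have "AE t in prof {d<..}. t \<in> {d<..} \<and> 0 < t" by (rule AE_prof) simp
      then show ?thesis
    proof eventually_elim
      case (elim t)
      have "1 / (4 * t) \<le> 1 / (4 * d)" using elim assms by (intro divide_left_mono) auto
      then have "1 \<le> exp (1 / (4 * d)) * exp (- 1 / (4 * t))" by (simp add: exp_add[symmetric])
      then have "heat t (0::'a) * 1 \<le> heat t (0::'a) * (exp (1 / (4 * d)) * exp (- 1 / (4 * t)))"
        by (intro mult_left_mono) auto
      also have "\<dots> = exp (1 / (4 * d)) * heat t e"
        using elim e by (simp add: heat_eq)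
      finally show ?case by (simp add: ennreal_mult'[symmetric])
    qed
    qed
  qed
  also have "\<dots> = ennreal (exp (1 / (4 * d))) * (\<integral>\<^sup>+t. ennreal (heat t e) \<partial>prof {d<..})"
    by (subst nn_integral_cmult) auto
  also have "\<dots> \<le> ennreal (exp (1 / (4 * d))) * (\<integral>\<^sup>+t. ennreal (heat t e) \<partial>prof UNIV)"
    by (intro mult_left_mono nn_integral_prof_mono) auto
  also have "\<dots> < \<infinity>"
    using e by (subst nn_integral_heat_prof_nz) (auto simp: ennreal_mult_less_top)
  finally show ?thesis .
qed

text \<open>The truncated kernel is bounded by its value at the origin, so this is uniform decay as
  the cutoff grows; it removes the remainder in \<open>pot_superaverage\<close>.\<close>

lemma trunc_bound_INF: "(INF k::nat. trunc_bound (real (Suc k))) = 0"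
proof -
  let ?f = "\<lambda>k t. indicator ({real (Suc k)<..} \<inter> {0<..}) t * ennreal (weight t) * ennreal (heat t (0::'a))"
  have eq: "trunc_bound (real (Suc k)) = (\<integral>\<^sup>+t. ?f k t \<partial>lborel)" for k
    unfolding trunc_bound_def by (simp add: nn_integral_prof)
  have "(INF k. \<integral>\<^sup>+t. ?f k t \<partial>lborel) = (\<integral>\<^sup>+t. (INF k. ?f k t) \<partial>lborel)"
  proof (rule nn_integral_monotone_convergence_INF_decseq[symmetric])
    show "decseq ?f"
      by (rule decseq_SucI, rule le_funI) (auto split: split_indicator)
    show "(\<integral>\<^sup>+t. ?f 0 t \<partial>lborel) < \<infinity>"
      using trunc_bound_finite[of 1] eq[of 0] by simp
  qed auto
  also have "\<dots> = (\<integral>\<^sup>+t. 0 \<partial>(lborel::real measure))"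
  proof (rule nn_integral_cong)
    fix t :: real
    obtain k :: nat where "t \<le> real k" using real_arch_simple by blast
    then have "?f k t = 0" by (simp add: indicator_def)
    then have "(INF k. ?f k t) \<le> 0" by (intro INF_lower2[of k]) auto
    then show "(INF k. ?f k t) = 0" by simp
  qed
  finally show ?thesis by (simp add: eq del: of_nat_Suc)
qed

lemma mix_trunc_le:
  assumes [simp]: "sfin \<nu>"
  shows "mix (prof {d<..}) \<nu> (\<lambda>_. 1) (x::'a) \<le> trunc_bound d * emeasure \<nu> UNIV"
proof -
  have [simp]: "space \<nu> = UNIV" using sets_eq_imp_space_eq[OF sfin_sets[OF assms]] by simp
  have "mix (prof {d<..}) \<nu> (\<lambda>_. 1) x \<le> (\<integral>\<^sup>+t. ennreal (heat t (0::'a)) * emeasure \<nu> UNIV \<partial>prof {d<..})"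
    unfolding mix_def
  proof (rule nn_integral_mono_AE)
    show "AE t in prof {d<..}. smear t \<nu> (\<lambda>_. 1) x \<le> ennreal (heat t (0::'a)) * emeasure \<nu> UNIV"
    proof -
      have "AE t in prof {d<..}. t \<in> {d<..} \<and> 0 < t" by (rule AE_prof) simp
      then show ?thesis
    proof eventually_elim
      case (elim t)
      have "smear t \<nu> (\<lambda>_. 1) x \<le> (\<integral>\<^sup>+y. ennreal (heat t (0::'a)) \<partial>\<nu>)"
        unfolding smear_def
      proof (rule nn_integral_mono)
        fix y
        show "ennreal (heat t (x - y)) * 1 \<le> ennreal (heat t (0::'a))"
          using heat_mono_norm[of t "0::'a" "x - y"] elim by (simp add: ennreal_leI)
      qed
      then show ?case by simp
    qed
    qed
  qed
  also have "\<dots> = trunc_bound d * emeasure \<nu> UNIV"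
    unfolding trunc_bound_def by (subst nn_integral_multc) auto
  finally show ?thesis .
qed

definition mass :: "real \<Rightarrow> ennreal" where "mass e = emeasure (prof {..e}) UNIV"

lemma mass_eq: "mass e = (\<integral>\<^sup>+t. indicator {0<..e} t * ennreal (weight t) \<partial>lborel)"
proof -
  have "mass e = (\<integral>\<^sup>+t. 1 \<partial>prof {..e})" by (simp add: mass_def)
  also have "\<dots> = (\<integral>\<^sup>+t. indicator {0<..e} t * ennreal (weight t) \<partial>lborel)"
    by (subst nn_integral_prof) (auto intro!: nn_integral_cong split: split_indicator)
  finally show ?thesis .
qed

lemma mass_finite: assumes "0 < e" shows "mass e < \<infinity>"
proof -
  have "mass e = (\<integral>\<^sup>+t. ennreal weight_const * ennreal (indicator {0..e} t * t powr (\<alpha> / 2 - 1)) \<partial>lborel)"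
    unfolding mass_eq using weight_const_pos
    by (intro nn_integral_cong) (auto simp: weight_def ennreal_mult' split: split_indicator)
  also have "\<dots> = ennreal weight_const * (\<integral>\<^sup>+t. ennreal (indicator {0..e} t * t powr (\<alpha> / 2 - 1)) \<partial>lborel)"
    by (subst nn_integral_cmult) auto
  also have "(\<integral>\<^sup>+t. ennreal (indicator {0..e} t * t powr (\<alpha> / 2 - 1)) \<partial>lborel) = ennreal (e powr (\<alpha> / 2 - 1 + 1) / (\<alpha> / 2 - 1 + 1))"
    using assms \<alpha>_pos by (intro nn_integral_has_integral_lebesgue has_integral_powr_from_0) auto
  finally show ?thesis by (simp add: ennreal_mult_less_top)
qed

lemma mass_pos: assumes "0 < e" shows "mass e > 0"
proof (rule ccontr)
  assume "\<not> 0 < mass e"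
  then have "(\<integral>\<^sup>+t. indicator {0<..e} t * ennreal (weight t) \<partial>lborel) = 0"
    by (simp add: mass_eq zero_less_iff_neq_zero)
  then have "AE t in lborel. indicator {0<..e} t * ennreal (weight t) = 0"
    by (subst (asm) nn_integral_0_iff_AE) auto
  then have "AE t in lborel. t \<notin> {0<..e}"
  proof eventually_elim
    case (elim t)
    then show ?case using weight_pos[of t] by auto
  qed
  then have "emeasure lborel {0<..e} = 0"
    by (subst (asm) AE_iff_measurable[of "{0<..e}"]) auto
  then show False using assms by simp
qed

text \<open>For a delay s \<le> e and t - s > d one has s / t \<le> e / d, and since \<alpha> / 2 -
  1 is not positive the delayed weight exceeds the weight at t by at most the stated factor. The
  factor tends to 1 as e tends to 0.\<close>

lemma prof_shift_bound:
  assumes "0 < e" "e < d" and [measurable]: "\<phi> \<in> borel_measurable borel"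
  shows "(\<integral>\<^sup>+s. \<integral>\<^sup>+t. \<phi> (s + t) \<partial>prof {d<..} \<partial>prof {..e}) \<le>
    ennreal ((1 - e / d) powr (\<alpha> / 2 - 1)) * mass e * (\<integral>\<^sup>+t. \<phi> t \<partial>prof UNIV)"
proof -
  let ?c = "(1 - e / d) powr (\<alpha> / 2 - 1)"
  have *: "(\<integral>\<^sup>+t. \<phi> (s + t) \<partial>prof {d<..}) \<le> ennreal ?c * (\<integral>\<^sup>+t. \<phi> t \<partial>prof UNIV)" if s: "0 < s" "s \<le> e" for s
  proof -
    have w: "weight (t - s) \<le> ?c * weight t" if "t - s > d" for t
    proof -
      have t: "t > 0" using s that assms by simp
      have "d * s \<le> t * e" using s that assms by (intro mult_mono) auto
      then have "1 - e / d \<le> 1 - s / t" using t assms by (simp add: field_simps)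
      moreover have "0 < 1 - e / d" using assms by simp
      ultimately have "(1 - s / t) powr (\<alpha> / 2 - 1) \<le> ?c" using \<alpha>_le by (intro powr_mono2') auto
      moreover have **: "t - s = t * (1 - s / t)" using t by (simp add: field_simps)
      have "weight (t - s) = weight t * (1 - s / t) powr (\<alpha> / 2 - 1)"
        unfolding weight_def by (subst **, subst powr_mult) simp
      ultimately show ?thesis
        using mult_left_mono[of "(1 - s / t) powr (\<alpha> / 2 - 1)" ?c "weight t"] by (simp add: mult.commute[of ?c])
    qed
    have "(\<integral>\<^sup>+t. \<phi> (s + t) \<partial>prof {d<..}) = (\<integral>\<^sup>+t. indicator ({d<..} \<inter> {0<..}) (t - s) * ennreal (weight (t - s)) * \<phi> t \<partial>lborel)"
      by (rule nn_integral_prof_shift) measurable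
    also have "\<dots> \<le> (\<integral>\<^sup>+t. ennreal ?c * (indicator {0<..} t * ennreal (weight t) * \<phi> t) \<partial>lborel)"
    proof (rule nn_integral_mono)
      fix t
      show "indicator ({d<..} \<inter> {0<..}) (t - s) * ennreal (weight (t - s)) * \<phi> t \<le> ennreal ?c * (indicator {0<..} t * ennreal (weight t) * \<phi> t)"
      proof (cases "t - s > d")
        case True
        then have "t > 0" using s assms by simp
        have "ennreal (weight (t - s)) \<le> ennreal ?c * ennreal (weight t)"
          using w[OF True] by (simp add: ennreal_mult'[symmetric])
        then have "ennreal (weight (t - s)) * \<phi> t \<le> (ennreal ?c * ennreal (weight t)) * \<phi> t"
          by (intro mult_right_mono) auto
        then show ?thesis using True \<open>t > 0\<close> s assms by (simp add: mult.assoc)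
      qed (simp add: indicator_def)
    qed
    also have "\<dots> = ennreal ?c * (\<integral>\<^sup>+t. \<phi> t \<partial>prof UNIV)"
      by (subst nn_integral_cmult) (auto simp: nn_integral_prof)
    finally show ?thesis .
  qed
  have "(\<integral>\<^sup>+s. \<integral>\<^sup>+t. \<phi> (s + t) \<partial>prof {d<..} \<partial>prof {..e}) \<le> (\<integral>\<^sup>+s. ennreal ?c * (\<integral>\<^sup>+t. \<phi> t \<partial>prof UNIV) \<partial>prof {..e})"
  proof (intro nn_integral_mono_AE)
    have "AE s in prof {..e}. s \<in> {..e} \<and> 0 < s" by (rule AE_prof) simp
    then show "AE s in prof {..e}. (\<integral>\<^sup>+t. \<phi> (s + t) \<partial>prof {d<..}) \<le> ennreal ?c * (\<integral>\<^sup>+t. \<phi> t \<partial>prof UNIV)"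
      by eventually_elim (use * in auto)
  qed
  also have "\<dots> = ennreal ?c * mass e * (\<integral>\<^sup>+t. \<phi> t \<partial>prof UNIV)"
    by (simp add: mass_def mult_ac)
  finally show ?thesis .
qed

end

section \<open>The domination principle\<close>

context riesz
begin

abbreviation U :: "'a measure \<Rightarrow> 'a \<Rightarrow> ennreal" where "U \<nu> \<equiv> pot \<nu> (\<lambda>_. 1)"
abbreviation smooth :: "real \<Rightarrow> ('a \<Rightarrow> ennreal) \<Rightarrow> 'a \<Rightarrow> ennreal" where "smooth e \<equiv> mix (eta e) lborel"
text \<open>Not normalised: constants are multiplied by \<open>mass e\<close>, and division by that
  number gives the small-time mean.\<close>

abbreviation near :: "real \<Rightarrow> ('a \<Rightarrow> ennreal) \<Rightarrow> 'a \<Rightarrow> ennreal" where "near e \<equiv> mix (prof {..e}) lborel"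

lemma nn_integral_prof_SUP:
  assumes [measurable]: "\<phi> \<in> borel_measurable borel" "\<And>k. I k \<in> sets borel"
    and I: "incseq I" "{0<..} \<subseteq> (\<Union>k::nat. I k)"
  shows "(SUP k. \<integral>\<^sup>+t. \<phi> t \<partial>prof (I k)) = (\<integral>\<^sup>+t. \<phi> t \<partial>prof UNIV)"
proof -
  let ?f = "\<lambda>k t. indicator (I k \<inter> {0<..}) t * ennreal (weight t) * \<phi> t"
  have "(SUP k. ?f k t) = indicator {0<..} t * ennreal (weight t) * \<phi> t" for t
  proof (rule antisym)
    show "(SUP k. ?f k t) \<le> indicator {0<..} t * ennreal (weight t) * \<phi> t"
      by (rule SUP_least) (auto split: split_indicator)
    show "indicator {0<..} t * ennreal (weight t) * \<phi> t \<le> (SUP k. ?f k t)"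
    proof (cases "t > 0")
      case True
      then obtain k where "t \<in> I k" using I(2) by auto
      then show ?thesis by (intro SUP_upper2[of k]) (auto split: split_indicator)
    qed simp
  qed
  moreover have "(\<integral>\<^sup>+t. (SUP k. ?f k t) \<partial>lborel) = (SUP k. \<integral>\<^sup>+t. ?f k t \<partial>lborel)"
    using incseqD[OF I(1)]
    by (intro nn_integral_monotone_convergence_SUP) (auto simp: incseq_def le_fun_def split: split_indicator)
  ultimately show ?thesis by (simp add: nn_integral_prof)
qed

text \<open>The kernels \<open>weight\<close> cut off at \<open>e\<close> and at \<open>r\<close> satisfy
  \<open>(\<delta> - \<eta>\<^sub>e) * w\<^sub>r = (\<delta> - \<eta>\<^sub>r) * w\<^sub>e\<close>, as both are \<open>(\<delta> - \<eta>\<^sub>e) * (\<delta> - \<eta>\<^sub>r) * weight\<close>.\<close>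

lemma eta_prof_balance_finite:
  assumes "0 < e" "0 < r" and [measurable]: "\<phi> \<in> borel_measurable borel" and fin: "(\<integral>\<^sup>+t. \<phi> t \<partial>prof UNIV) < \<infinity>"
  shows "(\<integral>\<^sup>+t. \<phi> t \<partial>prof {..r}) + (\<integral>\<^sup>+s. \<integral>\<^sup>+t. \<phi> (s + t) \<partial>prof {..e} \<partial>eta r) =
    (\<integral>\<^sup>+t. \<phi> t \<partial>prof {..e}) + (\<integral>\<^sup>+s. \<integral>\<^sup>+t. \<phi> (s + t) \<partial>prof {..r} \<partial>eta e)"
proof -
  \<comment> \<open>This convolves \<open>eta r\<close> with the weight above e, that is with
    \<open>eta e\<close> and the full weight. It is symmetric in e and r, and finite here, so it can
    be cancelled.\<close>
  define X where "X e r = (\<integral>\<^sup>+s. \<integral>\<^sup>+t. \<phi> (s + t) \<partial>prof {e<..} \<partial>eta r)" for e r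
  have [measurable]: "(\<lambda>s. \<integral>\<^sup>+t. \<phi> (s + t) \<partial>prof I) \<in> borel_measurable borel" if "I \<in> sets borel" for I
    using that by (intro borel_measurable_nn_integral_sfin) auto
  have sum: "(\<integral>\<^sup>+t. \<phi> t \<partial>prof {..r}) + (\<integral>\<^sup>+s. \<integral>\<^sup>+t. \<phi> (s + t) \<partial>prof {..e} \<partial>eta r) + X e r = (\<integral>\<^sup>+t. \<phi> t \<partial>prof UNIV)"
    if "0 < r" for e r
  proof -
    have "(\<integral>\<^sup>+s. \<integral>\<^sup>+t. \<phi> (s + t) \<partial>prof {..e} \<partial>eta r) + X e r = (\<integral>\<^sup>+s. \<integral>\<^sup>+t. \<phi> (s + t) \<partial>prof UNIV \<partial>eta r)"
      unfolding X_def by (subst nn_integral_add[symmetric]) (auto simp: nn_integral_prof_split[symmetric])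
    also have "\<dots> = (\<integral>\<^sup>+t. \<phi> t \<partial>prof {r<..})" using that by (intro nn_integral_eta_prof) auto
    finally show ?thesis by (simp add: add.assoc nn_integral_prof_split[symmetric])
  qed
  have X: "X e r = (\<integral>\<^sup>+s. \<integral>\<^sup>+u. \<integral>\<^sup>+t. \<phi> (s + (u + t)) \<partial>prof UNIV \<partial>eta e \<partial>eta r)" if "0 < e" for e r
    unfolding X_def using that by (intro nn_integral_cong nn_integral_eta_prof[symmetric]) auto
  have "X e r = X r e"
  proof -
    have "X e r = (\<integral>\<^sup>+u. \<integral>\<^sup>+s. \<integral>\<^sup>+t. \<phi> (s + (u + t)) \<partial>prof UNIV \<partial>eta r \<partial>eta e)"
      unfolding X[OF assms(1)]
      by (rule nn_integral_swap) (auto intro!: borel_measurable_nn_integral_sfin)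
    also have "\<dots> = X r e"
      unfolding X[OF assms(2)] by (simp add: add.left_commute)
    finally show ?thesis .
  qed
  moreover have "X e r \<noteq> \<infinity>"
    using sum[OF assms(2), of e] fin by auto
  moreover have "X e r + ((\<integral>\<^sup>+t. \<phi> t \<partial>prof {..r}) + (\<integral>\<^sup>+s. \<integral>\<^sup>+t. \<phi> (s + t) \<partial>prof {..e} \<partial>eta r)) =
    X r e + ((\<integral>\<^sup>+t. \<phi> t \<partial>prof {..e}) + (\<integral>\<^sup>+s. \<integral>\<^sup>+t. \<phi> (s + t) \<partial>prof {..r} \<partial>eta e))"
    using sum[OF assms(2), of e] sum[OF assms(1), of r] by (simp only: add.commute[of "X _ _"])
  ultimately show ?thesis by (simp add: ennreal_add_left_cancel)
qed

lemma eta_prof_balance: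
  assumes e: "0 < e" "0 < r" and [measurable]: "\<phi> \<in> borel_measurable borel"
  shows "(\<integral>\<^sup>+t. \<phi> t \<partial>prof {..r}) + (\<integral>\<^sup>+s. \<integral>\<^sup>+t. \<phi> (s + t) \<partial>prof {..e} \<partial>eta r) =
    (\<integral>\<^sup>+t. \<phi> t \<partial>prof {..e}) + (\<integral>\<^sup>+s. \<integral>\<^sup>+t. \<phi> (s + t) \<partial>prof {..r} \<partial>eta e)"
proof -
  \<comment> \<open>Bounding the function and cutting off large times makes its integral finite,
    because bounded times have finite total weight. Monotone convergence then gives the general
    case.\<close>
  define f where "f k t = min (\<phi> t) (of_nat k) * indicator {..real k} t" for k :: nat and t
  have [measurable]: "f k \<in> borel_measurable borel" for k unfolding f_def by measurable
  have inc: "f i t \<le> f j t" if "i \<le> j" for i j t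
    using that unfolding f_def by (auto intro: min.coboundedI2 split: split_indicator)
  have sup: "(SUP k. f k t) = \<phi> t" for t
  proof (rule antisym)
    show "(SUP k. f k t) \<le> \<phi> t" by (rule SUP_least) (auto simp: f_def split: split_indicator)
    obtain k :: nat where k: "t \<le> real k" using real_arch_simple by blast
    have "min (\<phi> t) (of_nat j) \<le> (SUP k. f k t)" for j
      using k by (intro SUP_upper2[of "max j k"]) (auto simp: f_def indicator_def intro: min.coboundedI2)
    then have "(SUP j. min (\<phi> t) (of_nat j)) \<le> (SUP k. f k t)" by (rule SUP_least)
    moreover have "(SUP j. min (\<phi> t) (of_nat j)) = \<phi> t"
      by (subst inf_min[symmetric], subst inf_SUP[symmetric]) (simp add: ennreal_SUP_of_nat_eq_top)
    ultimately show "\<phi> t \<le> (SUP k. f k t)" by simp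
  qed
  have fin: "(\<integral>\<^sup>+t. f k t \<partial>prof UNIV) < \<infinity>" for k
  proof (cases "k = 0")
    case False
    have "(\<integral>\<^sup>+t. f k t \<partial>prof UNIV) \<le> (\<integral>\<^sup>+t. of_nat k * (indicator {0<..real k} t * ennreal (weight t)) \<partial>lborel)"
      by (subst nn_integral_prof) (auto intro!: nn_integral_mono mult_left_mono simp: f_def mult.commute[of "of_nat k"] split: split_indicator)
    also have "\<dots> = of_nat k * mass (real k)"
      unfolding mass_eq by (subst nn_integral_cmult) auto
    also have "\<dots> < \<infinity>" using False mass_finite[of "real k"] by (simp add: ennreal_mult_less_top of_nat_less_top)
    finally show ?thesis .
  qed (simp add: f_def)
  have 1: "(SUP k. \<integral>\<^sup>+t. f k t \<partial>prof I) = (\<integral>\<^sup>+t. \<phi> t \<partial>prof I)" if "I \<in> sets borel" for I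
    using that by (subst nn_integral_monotone_convergence_SUP[symmetric]) (auto simp: sup incseq_def le_fun_def inc)
  have [measurable]: "(\<lambda>s. \<integral>\<^sup>+t. f k (s + t) \<partial>prof I) \<in> borel_measurable borel" if "I \<in> sets borel" for I k
    using that by (intro borel_measurable_nn_integral_sfin) auto
  have 2: "(SUP k. \<integral>\<^sup>+s. \<integral>\<^sup>+t. f k (s + t) \<partial>prof I \<partial>eta r) = (\<integral>\<^sup>+s. \<integral>\<^sup>+t. \<phi> (s + t) \<partial>prof I \<partial>eta r)" if "I \<in> sets borel" for I r
  proof -
    have "(SUP k. \<integral>\<^sup>+t. f k (s + t) \<partial>prof I) = (\<integral>\<^sup>+t. \<phi> (s + t) \<partial>prof I)" for s
      using that by (subst nn_integral_monotone_convergence_SUP[symmetric]) (auto simp: sup incseq_def le_fun_def inc)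
    then show ?thesis
      using that by (subst nn_integral_monotone_convergence_SUP[symmetric])
        (auto simp: incseq_def le_fun_def intro!: nn_integral_mono inc)
  qed
  have "(SUP k. (\<integral>\<^sup>+t. f k t \<partial>prof {..r}) + (\<integral>\<^sup>+s. \<integral>\<^sup>+t. f k (s + t) \<partial>prof {..e} \<partial>eta r)) =
    (SUP k. (\<integral>\<^sup>+t. f k t \<partial>prof {..e}) + (\<integral>\<^sup>+s. \<integral>\<^sup>+t. f k (s + t) \<partial>prof {..r} \<partial>eta e))"
    by (intro SUP_cong refl eta_prof_balance_finite e fin) auto
  also have "(SUP k. (\<integral>\<^sup>+t. f k t \<partial>prof {..r}) + (\<integral>\<^sup>+s. \<integral>\<^sup>+t. f k (s + t) \<partial>prof {..e} \<partial>eta r)) =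
     (\<integral>\<^sup>+t. \<phi> t \<partial>prof {..r}) + (\<integral>\<^sup>+s. \<integral>\<^sup>+t. \<phi> (s + t) \<partial>prof {..e} \<partial>eta r)"
    by (subst ennreal_SUP_add) (auto simp: 1 2 incseq_def intro!: nn_integral_mono inc)
  also have "(SUP k. (\<integral>\<^sup>+t. f k t \<partial>prof {..e}) + (\<integral>\<^sup>+s. \<integral>\<^sup>+t. f k (s + t) \<partial>prof {..r} \<partial>eta e)) =
     (\<integral>\<^sup>+t. \<phi> t \<partial>prof {..e}) + (\<integral>\<^sup>+s. \<integral>\<^sup>+t. \<phi> (s + t) \<partial>prof {..r} \<partial>eta e)"
    by (subst ennreal_SUP_add) (auto simp: 1 2 incseq_def intro!: nn_integral_mono inc)
  finally show ?thesis .
qed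

lemma near_smooth_balance:
  assumes "0 < e" "0 < r" and [measurable]: "f \<in> borel_measurable borel"
  shows "near r f x + smooth r (near e f) x = near e f x + smooth e (near r f) x"
  unfolding mix_mix[OF sfin_lborel profile_eta[OF assms(2)] profile_prof[of "{..e}"] assms(3), simplified]
    mix_mix[OF sfin_lborel profile_eta[OF assms(1)] profile_prof[of "{..r}"] assms(3), simplified]
  using eta_prof_balance[OF assms(1,2), of "\<lambda>t. smear t lborel f x"] by (simp add: mix_def)

text \<open>Formally, convolving the weight with \<delta> - \<open>eta e\<close> leaves its part on
  (0, e]. The potential of w itself may be infinite, so the weight is first cut off at r. By the
  balance identity the error is \<open>smooth r (near e w)\<close>, and the bound of w by the
  potential of a finite measure sends it to 0 as r grows.\<close>

lemma pot_superaverage: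
  assumes fin: "sfin \<rho>" "emeasure \<rho> UNIV < \<infinity>" and [measurable]: "w \<in> borel_measurable borel"
    and w: "\<And>y. w y \<le> U \<rho> y" "\<And>y. smooth e w y \<le> w y" and e: "0 < e"
  shows "pot lborel (\<lambda>y. w y - smooth e w y) x = near e w x"
proof -
  note [simp] = fin(1)
  define \<kappa> where "\<kappa> y = w y - smooth e w y" for y
  have [measurable]: "\<kappa> \<in> borel_measurable borel" unfolding \<kappa>_def by measurable
  have w_eq: "w = (\<lambda>y. \<kappa> y + smooth e w y)" unfolding \<kappa>_def using w(2) by (auto simp: diff_add_cancel_ennreal)
  have smU: "smooth r (U \<rho>) y \<le> trunc_bound r * emeasure \<rho> UNIV" if "0 < r" for r y
    unfolding pot_def using that by (simp add: mix_eta_prof mix_trunc_le)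
  have bound: "smooth r (near s w) x \<le> trunc_bound r * emeasure \<rho> UNIV * mass s" if "0 < r" for r s
  proof -
    have "smooth r (near s w) x = near s (smooth r w) x" using that by (intro mix_commute) auto
    also have "\<dots> \<le> near s (\<lambda>_. trunc_bound r * emeasure \<rho> UNIV) x"
      using smU[OF that] by (intro mix_mono) (blast intro: order_trans[OF mix_mono] w(1))
    also have "\<dots> = trunc_bound r * emeasure \<rho> UNIV * mass s" by (subst mix_const) (auto simp: mass_def)
    finally show ?thesis .
  qed
  have eq: "near r \<kappa> x + smooth r (near e w) x = near e w x" if r: "0 < r" for r
  proof -
    have "near r w x = near r \<kappa> x + near r (smooth e w) x"
      by (subst w_eq, subst mix_add) auto
    also have "near r (smooth e w) x = smooth e (near r w) x" using e by (intro mix_commute) auto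
    finally have "near r \<kappa> x + smooth r (near e w) x + smooth e (near r w) x = near e w x + smooth e (near r w) x"
      using near_smooth_balance[OF e r, of w x] by (simp add: ac_simps)
    moreover have "smooth e (near r w) x \<noteq> \<top>"
      using bound[OF e, of r] trunc_bound_finite[OF e] fin(2) mass_finite[OF r]
      by (auto simp: ennreal_mult_eq_top_iff top_unique)
    ultimately show ?thesis by (simp add: add.commute[of _ "smooth e (near r w) x"] ennreal_add_left_cancel)
  qed
  have pot: "pot lborel \<kappa> x = (SUP k::nat. near (real k) \<kappa> x)"
    unfolding pot_def mix_def
    by (rule nn_integral_prof_SUP[symmetric]) (auto simp: incseq_def intro: real_arch_simple)
  have "pot lborel \<kappa> x \<le> near e w x"
    unfolding pot
  proof (rule SUP_least)
    fix k :: nat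
    have "near (real k) \<kappa> x \<le> near (real (Suc k)) \<kappa> x" by (intro mix_prof_mono) auto
    also have "\<dots> \<le> near e w x" unfolding eq[of "real (Suc k)", simplified, symmetric] by simp
    finally show "near (real k) \<kappa> x \<le> near e w x" .
  qed
  moreover have "near e w x \<le> pot lborel \<kappa> x"
  proof -
    let ?C = "emeasure \<rho> UNIV * mass e"
    have "near e w x \<le> pot lborel \<kappa> x + trunc_bound (real (Suc k)) * ?C" for k
    proof -
      have "near e w x = near (real (Suc k)) \<kappa> x + smooth (real (Suc k)) (near e w) x"
        by (rule eq[symmetric]) simp
      also have "\<dots> \<le> pot lborel \<kappa> x + trunc_bound (real (Suc k)) * emeasure \<rho> UNIV * mass e"
        by (intro add_mono bound) (auto simp: pot simp del: of_nat_Suc intro!: SUP_upper2[of "Suc k"])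
      finally show ?thesis by (simp add: mult.assoc)
    qed
    moreover have "(\<lambda>k. pot lborel \<kappa> x + ?C * trunc_bound (real (Suc k))) \<longlonglongrightarrow> pot lborel \<kappa> x + ?C * 0"
    proof (intro tendsto_add tendsto_const ennreal_tendsto_cmult)
      have "decseq (\<lambda>k. trunc_bound (real (Suc k)))"
        unfolding trunc_bound_def by (auto simp: decseq_def intro!: nn_integral_prof_mono)
      from LIMSEQ_INF[OF this] show "(\<lambda>k. trunc_bound (real (Suc k))) \<longlonglongrightarrow> 0"
        by (simp only: trunc_bound_INF)
      show "?C < \<top>"
        using fin(2) mass_finite[OF e] by (auto simp: ennreal_mult_less_top)
    qed
    ultimately have "near e w x \<le> pot lborel \<kappa> x + ?C * 0"
      by (intro LIMSEQ_le_const[where a="near e w x"]) (auto simp: mult.commute[of ?C])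
    then show ?thesis by simp
  qed
  ultimately show ?thesis unfolding \<kappa>_def by (rule antisym)
qed

end

section \<open>Lower semicontinuity and heat means for small times\<close>

definition seq_lsc :: "('a::metric_space \<Rightarrow> ennreal) \<Rightarrow> bool" where
  "seq_lsc w \<longleftrightarrow> (\<forall>X x. X \<longlonglongrightarrow> x \<longrightarrow> w x \<le> liminf (\<lambda>n. w (X n)))"

lemma seq_lsc_min:
  fixes f g :: "'a::metric_space \<Rightarrow> ennreal"
  assumes "seq_lsc f" "seq_lsc g"
  shows "seq_lsc (\<lambda>x. min (f x) (g x))"
  unfolding seq_lsc_def
proof (intro allI impI)
  fix X and x :: 'a assume X: "X \<longlonglongrightarrow> x"
  with assms have "f x \<le> liminf (\<lambda>n. f (X n))" "g x \<le> liminf (\<lambda>n. g (X n))" by (auto simp: seq_lsc_def)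
  then show "min (f x) (g x) \<le> liminf (\<lambda>n. min (f (X n)) (g (X n)))"
    unfolding le_Liminf_iff by (auto intro: eventually_conj)
qed

lemma seq_lsc_add_const:
  fixes f :: "'a::metric_space \<Rightarrow> ennreal"
  assumes "seq_lsc f" "c < \<top>"
  shows "seq_lsc (\<lambda>x. f x + c)"
  unfolding seq_lsc_def
proof (intro allI impI)
  fix X and x :: 'a assume X: "X \<longlonglongrightarrow> x"
  with assms have f: "f x \<le> liminf (\<lambda>n. f (X n))" by (auto simp: seq_lsc_def)
  show "f x + c \<le> liminf (\<lambda>n. f (X n) + c)"
    unfolding le_Liminf_iff
  proof (intro allI impI)
    fix y assume y: "y < f x + c"
    show "eventually (\<lambda>n. y < f (X n) + c) sequentially"
    proof (cases "y < c")
      case True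
      then show ?thesis by (auto intro!: always_eventually less_le_trans[OF True])
    next
      case False
      then have yc: "y - c + c = y" by (simp add: diff_add_cancel_ennreal not_less)
      then have "y - c + c < f x + c" using y by simp
      then have "y - c < f x" by (meson add_right_mono leD leI)
      with f have "eventually (\<lambda>n. y - c < f (X n)) sequentially" unfolding le_Liminf_iff by blast
      then show ?thesis
      proof eventually_elim
        case (elim n)
        then have "c + (y - c) < c + f (X n)"
          using assms(2) by (auto simp: ennreal_add_left_cancel_less)
        moreover have "c + (y - c) = y" using yc by (simp add: add.commute)
        ultimately show ?case by (simp only: add.commute)
      qed
    qed
  qed
qed

text \<open>After scaling space by sqrt t the Gaussian no longer depends on t, so Fatou's lemma
  applies with a fixed density when t tends to 0.\<close>

lemma smear_scale:
  fixes w :: "'a::euclidean_space \<Rightarrow> ennreal"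
  assumes "0 < t" and [measurable]: "w \<in> borel_measurable borel"
  shows "smear t lborel w x = (\<integral>\<^sup>+z. ennreal (heat 1 z) * w (x + sqrt t *\<^sub>R z) \<partial>lborel)"
proof -
  have "smear t lborel w x = (\<integral>\<^sup>+y. ennreal (heat t (x - y)) * w y \<partial>(density (distr lborel borel (\<lambda>z. x + sqrt t *\<^sub>R z)) (\<lambda>_. ennreal (\<bar>sqrt t\<bar> ^ DIM('a)))))"
    unfolding smear_def using assms(1) by (subst lborel_affine[of "sqrt t" x]) auto
  also have "\<dots> = (\<integral>\<^sup>+z. ennreal (\<bar>sqrt t\<bar> ^ DIM('a)) * (ennreal (heat t (sqrt t *\<^sub>R z)) * w (x + sqrt t *\<^sub>R z)) \<partial>lborel)"
    by (subst nn_integral_density, simp, simp, subst nn_integral_distr, simp, simp, simp)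
  also have "\<dots> = (\<integral>\<^sup>+z. ennreal (heat 1 z) * w (x + sqrt t *\<^sub>R z) \<partial>lborel)"
  proof (rule nn_integral_cong)
    fix z :: 'a
    have 1: "sqrt t ^ DIM('a) = t powr (real DIM('a) / 2)"
      using assms(1) by (simp add: powr_half_sqrt[symmetric] powr_powr flip: powr_realpow)
    have "sqrt t ^ DIM('a) * heat t (sqrt t *\<^sub>R z) = t powr (real DIM('a) / 2) * ((4 * pi * t) powr (- real DIM('a) / 2)) * exp (- (norm z)\<^sup>2 / 4)"
      unfolding 1 using assms(1) by (simp add: heat_eq power_mult_distrib)
    also have "(4 * pi * t) powr (- real DIM('a) / 2) = (4 * pi) powr (- real DIM('a) / 2) * t powr (- real DIM('a) / 2)"
      by (rule powr_mult)
    also have "t powr (real DIM('a) / 2) * ((4 * pi) powr (- real DIM('a) / 2) * t powr (- real DIM('a) / 2)) = (4 * pi) powr (- real DIM('a) / 2)"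
      using assms(1) by (simp add: powr_minus)
    finally have "sqrt t ^ DIM('a) * heat t (sqrt t *\<^sub>R z) = heat 1 z" by (simp add: heat_eq)
    then show "ennreal (\<bar>sqrt t\<bar> ^ DIM('a)) * (ennreal (heat t (sqrt t *\<^sub>R z)) * w (x + sqrt t *\<^sub>R z)) = ennreal (heat 1 z) * w (x + sqrt t *\<^sub>R z)"
      using assms(1) by (simp add: mult.assoc[symmetric] ennreal_mult'[symmetric])
  qed
  finally show ?thesis .
qed

lemma smear_lsc_lower:
  fixes w :: "'a::euclidean_space \<Rightarrow> ennreal"
  assumes "seq_lsc w" and [measurable]: "w \<in> borel_measurable borel" and r: "r < w x"
  shows "eventually (\<lambda>t. r < smear t lborel w x) (at_right 0)"
proof (rule sequentially_imp_eventually_at_right[of 0 1])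
  fix T :: "nat \<Rightarrow> real" assume T: "\<And>n. 0 < T n" "T \<longlonglongrightarrow> 0"
  have "w x = (\<integral>\<^sup>+z. ennreal (heat 1 z) * w x \<partial>(lborel::'a measure))"
    by (subst nn_integral_multc) (auto simp: nn_integral_heat)
  also have "\<dots> \<le> (\<integral>\<^sup>+z. liminf (\<lambda>n. ennreal (heat 1 z) * w (x + sqrt (T n) *\<^sub>R z)) \<partial>lborel)"
  proof (rule nn_integral_mono)
    fix z :: 'a
    have "(\<lambda>n. x + sqrt (T n) *\<^sub>R z) \<longlonglongrightarrow> x + sqrt 0 *\<^sub>R z"
      by (intro tendsto_intros T)
    then have "w x \<le> liminf (\<lambda>n. w (x + sqrt (T n) *\<^sub>R z))"
      using assms(1) by (simp add: seq_lsc_def)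
    then have "ennreal (heat 1 z) * w x \<le> ennreal (heat 1 z) * liminf (\<lambda>n. w (x + sqrt (T n) *\<^sub>R z))"
      by (intro mult_left_mono) auto
    also have "\<dots> = liminf (\<lambda>n. ennreal (heat 1 z) * w (x + sqrt (T n) *\<^sub>R z))"
      by (subst Liminf_compose_continuous_mono[where f="\<lambda>u. ennreal (heat 1 z) * u", symmetric])
         (auto intro!: ennreal_continuous_on_cmult monoI mult_left_mono)
    finally show "ennreal (heat 1 z) * w x \<le> liminf (\<lambda>n. ennreal (heat 1 z) * w (x + sqrt (T n) *\<^sub>R z))" .
  qed
  also have "\<dots> \<le> liminf (\<lambda>n. \<integral>\<^sup>+z. ennreal (heat 1 z) * w (x + sqrt (T n) *\<^sub>R z) \<partial>lborel)"
    by (rule nn_integral_liminf) auto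
  also have "\<dots> = liminf (\<lambda>n. smear (T n) lborel w x)"
    using T by (simp add: smear_scale)
  finally show "eventually (\<lambda>n. r < smear (T n) lborel w x) sequentially"
    using r unfolding le_Liminf_iff by blast
qed simp

lemma smear_one_lsc:
  assumes "sfin \<nu>" "0 < t" "X \<longlonglongrightarrow> (x::'a::euclidean_space)"
  shows "smear t \<nu> (\<lambda>_. 1) x \<le> liminf (\<lambda>n. smear t \<nu> (\<lambda>_. 1) (X n))"
proof -
  have "smear t \<nu> (\<lambda>_. 1) x = (\<integral>\<^sup>+y. liminf (\<lambda>n. ennreal (heat t (X n - y))) \<partial>\<nu>)"
    unfolding smear_def mult_1_right
  proof (rule nn_integral_cong)
    fix y
    have "(\<lambda>n. ennreal (heat t (X n - y))) \<longlonglongrightarrow> ennreal (heat t (x - y))"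
      using assms(2,3) by (auto simp: heat_eq intro!: tendsto_intros)
    then show "ennreal (heat t (x - y)) = liminf (\<lambda>n. ennreal (heat t (X n - y)))"
      by (intro lim_imp_Liminf[symmetric]) auto
  qed
  also have "\<dots> \<le> liminf (\<lambda>n. \<integral>\<^sup>+y. ennreal (heat t (X n - y)) \<partial>\<nu>)"
    by (rule nn_integral_liminf) (auto simp: sfin_measurable[OF assms(1)])
  finally show ?thesis by (simp add: smear_def)
qed

section \<open>Small-time means and energies of averaged measures\<close>

context riesz
begin

lemma U_lsc: "sfin \<nu> \<Longrightarrow> seq_lsc (U \<nu>)"
  unfolding seq_lsc_def
proof (intro allI impI)
  fix X and x :: 'a assume [simp]: "sfin \<nu>" and X: "X \<longlonglongrightarrow> x"
  have "AE t in prof UNIV. 0 < t" by (rule AE_prof_pos) simp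
  then have "U \<nu> x \<le> (\<integral>\<^sup>+t. liminf (\<lambda>n. smear t \<nu> (\<lambda>_. 1) (X n)) \<partial>prof UNIV)"
    unfolding pot_def mix_def
    by (intro nn_integral_mono_AE) (auto elim!: eventually_mono intro!: smear_one_lsc X)
  also have "\<dots> \<le> liminf (\<lambda>n. U \<nu> (X n))"
    unfolding pot_def mix_def by (rule nn_integral_liminf) auto
  finally show "U \<nu> x \<le> liminf (\<lambda>n. U \<nu> (X n))" .
qed

lemma near_lsc_lower:
  assumes "seq_lsc w" and [measurable]: "w \<in> borel_measurable borel" and r: "r < w x"
  shows "eventually (\<lambda>e. mass e * r \<le> near e w x) (at_right 0)"
proof -
  obtain b where b: "b > 0" "\<And>t. 0 < t \<Longrightarrow> t < b \<Longrightarrow> r < smear t lborel w x"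
    using smear_lsc_lower[OF assms] unfolding eventually_at_right_field by blast
  have "mass e * r \<le> near e w x" if e: "0 < e" "e < b" for e
  proof -
    have "AE t in prof {..e}. t \<in> {..e} \<and> 0 < t" by (rule AE_prof) simp
    then have "AE t in prof {..e}. r \<le> smear t lborel w x"
      by eventually_elim (use b e in \<open>auto intro!: less_imp_le\<close>)
    then have "(\<integral>\<^sup>+t. r \<partial>prof {..e}) \<le> near e w x"
      unfolding mix_def by (intro nn_integral_mono_AE)
    then show ?thesis by (simp add: mass_def mult.commute)
  qed
  then show ?thesis using b(1) unfolding eventually_at_right_field by blast
qed

lemma liminf_near_ge:
  assumes "seq_lsc w" "w \<in> borel_measurable borel" and E: "\<And>n. 0 < E n" "E \<longlonglongrightarrow> 0"
  shows "w x \<le> liminf (\<lambda>n. near (E n) w x / mass (E n))"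
  unfolding le_Liminf_iff
proof (intro allI impI)
  fix r assume "r < w x"
  then obtain s where s: "r < s" "s < w x" using dense by blast
  have "filterlim E (at_right 0) sequentially"
    using E by (auto simp: filterlim_at less_imp_neq[OF E(1), symmetric] intro!: always_eventually)
  with near_lsc_lower[OF assms(1,2) s(2)] have "eventually (\<lambda>n. mass (E n) * s \<le> near (E n) w x) sequentially"
    by (rule eventually_compose_filterlim)
  then show "eventually (\<lambda>n. r < near (E n) w x / mass (E n)) sequentially"
  proof eventually_elim
    case (elim n)
    have m: "mass (E n) \<noteq> 0" "mass (E n) \<noteq> \<top>" using mass_finite[OF E(1)] less_imp_neq[OF mass_pos[OF E(1)], symmetric] by (auto simp: less_top)
    have "s = mass (E n) * s / mass (E n)"
      using m by (simp add: ennreal_mult_divide_eq mult.commute[of _ s])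
    also have "\<dots> \<le> near (E n) w x / mass (E n)" using elim by (rule divide_right_mono_ennreal)
    finally show ?case using s(1) by simp
  qed
qed

text \<open>The integral is the mutual energy of \<rho> and a translate of it. Positive definiteness
  bounds it by the mean of the two self-energies, which agree by translation invariance.\<close>

lemma energy_translate:
  assumes [simp]: "sfin \<rho>"
  shows "(\<integral>\<^sup>+x. U \<rho> (x + z) \<partial>\<rho>) \<le> energy \<rho> (\<lambda>_. 1) \<rho> (\<lambda>_. 1)"
proof -
  define \<sigma> where "\<sigma> = distr \<rho> borel (\<lambda>x. x + z)"
  have m: "(\<lambda>x. x + z) \<in> \<rho> \<rightarrow>\<^sub>M borel" by (simp add: sfin_measurable)
  have [simp]: "sfin \<sigma>"
  proof -
    interpret sigma_finite_measure \<rho> by (rule sfin_sigma_finite) simp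
    obtain A :: "nat \<Rightarrow> 'a set" where A: "range A \<subseteq> sets \<rho>" "(\<Union>i. A i) = space \<rho>" "\<And>i. emeasure \<rho> (A i) \<noteq> \<infinity>"
      using sigma_finite by blast
    have sp: "space \<rho> = UNIV" using sets_eq_imp_space_eq[OF sfin_sets[of \<rho>]] by simp
    have Ab: "A i \<in> sets borel" for i using A(1) sfin_sets[of \<rho>] by auto
    define B where "B i = (\<lambda>x. x - z) -` A i" for i
    have Bb: "B i \<in> sets borel" for i
      unfolding B_def using measurable_sets[of "\<lambda>x. x - z" borel borel "A i"] Ab by simp
    have "sigma_finite_measure \<sigma>"
    proof (rule sigma_finite_measure.intro, intro exI conjI)
      show "countable (range B)" by simp
      show "range B \<subseteq> sets \<sigma>" using Bb by (auto simp: \<sigma>_def)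
      have "x - z \<in> \<Union> (range A)" for x using A(2) sp by simp
      then show "\<Union> (range B) = space \<sigma>" unfolding B_def \<sigma>_def by auto
      have "emeasure \<sigma> (B i) = emeasure \<rho> (A i)" for i
        unfolding \<sigma>_def using Bb m by (subst emeasure_distr) (auto simp: B_def sp vimage_def)
      then show "\<forall>a\<in>range B. emeasure \<sigma> a \<noteq> \<infinity>" using A(3) by auto
    qed
    then show ?thesis by (simp add: sfin_def \<sigma>_def)
  qed
  have pot: "U \<sigma> x = U \<rho> (x - z)" for x
    unfolding pot_def mix_def smear_def \<sigma>_def using m
    by (subst nn_integral_distr) (auto simp: algebra_simps)
  have en: "energy \<sigma> (\<lambda>_. 1) \<sigma> (\<lambda>_. 1) = energy \<rho> (\<lambda>_. 1) \<rho> (\<lambda>_. 1)"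
    unfolding energy_def pot unfolding \<sigma>_def using m by (subst nn_integral_distr) auto
  have "(\<integral>\<^sup>+x. U \<rho> (x + z) \<partial>\<rho>) = energy \<sigma> (\<lambda>_. 1) \<rho> (\<lambda>_. 1)"
    unfolding energy_def unfolding \<sigma>_def using m by (subst nn_integral_distr) auto
  moreover have "2 * energy \<sigma> (\<lambda>_. 1) \<rho> (\<lambda>_. 1) \<le> 2 * energy \<rho> (\<lambda>_. 1) \<rho> (\<lambda>_. 1)"
    using energy_psd[of \<sigma> \<rho> "\<lambda>_. 1" "\<lambda>_. 1"] en by (simp add: mult_2)
  ultimately show ?thesis by (simp add: ennreal_mult_le_mult_iff)
qed

text \<open>A heat mean averages translates of \<open>U \<rho>\<close>, and each translate obeys
  \<open>energy_translate\<close>.\<close>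

lemma energy_smear_le:
  assumes [simp]: "sfin \<rho>" and "0 < t"
  shows "(\<integral>\<^sup>+x. smear t lborel (U \<rho>) x \<partial>\<rho>) \<le> energy \<rho> (\<lambda>_. 1) \<rho> (\<lambda>_. 1)"
proof -
  have "smear t lborel (U \<rho>) x = (\<integral>\<^sup>+z. ennreal (heat t z) * U \<rho> (x + z) \<partial>lborel)" for x
    unfolding smear_def heat_commute[of t x]
    by (subst nn_integral_lborel_translate[of "\<lambda>z. ennreal (heat t z) * U \<rho> (x + z)" x, symmetric]) auto
  then have "(\<integral>\<^sup>+x. smear t lborel (U \<rho>) x \<partial>\<rho>) = (\<integral>\<^sup>+x. \<integral>\<^sup>+z. ennreal (heat t z) * U \<rho> (x + z) \<partial>lborel \<partial>\<rho>)"
    by simp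
  also have "\<dots> = (\<integral>\<^sup>+z. \<integral>\<^sup>+x. ennreal (heat t z) * U \<rho> (x + z) \<partial>\<rho> \<partial>lborel)"
    by (rule nn_integral_swap) auto
  also have "\<dots> = (\<integral>\<^sup>+z. ennreal (heat t z) * (\<integral>\<^sup>+x. U \<rho> (x + z) \<partial>\<rho>) \<partial>lborel)"
    by (subst nn_integral_cmult) (auto simp: sfin_measurable)
  also have "\<dots> \<le> (\<integral>\<^sup>+z. ennreal (heat t z) * energy \<rho> (\<lambda>_. 1) \<rho> (\<lambda>_. 1) \<partial>(lborel::'a measure))"
    by (intro nn_integral_mono mult_left_mono energy_translate) auto
  also have "\<dots> = energy \<rho> (\<lambda>_. 1) \<rho> (\<lambda>_. 1)"
    using assms(2) by (subst nn_integral_multc) (auto simp: nn_integral_heat)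
  finally show ?thesis .
qed

text \<open>The density \<open>h\<close> is \<rho> averaged, without normalisation, over times up to
  e. Its energy integrates heat means of \<open>U \<rho>\<close> against \<rho> over two such times,
  and each of the two contributes one factor \<open>mass e\<close>.\<close>

lemma energy_near_le:
  assumes [simp]: "sfin \<rho>" and e: "0 < e"
  defines "h \<equiv> mix (prof {..e}) \<rho> (\<lambda>_. 1)"
  shows "energy lborel h lborel h \<le> mass e * mass e * energy \<rho> (\<lambda>_. 1) \<rho> (\<lambda>_. 1)"
proof -
  let ?E = "energy \<rho> (\<lambda>_. 1) \<rho> (\<lambda>_. 1)"
  have [measurable]: "h \<in> borel_measurable borel" unfolding h_def by simp
  have pot_h: "pot lborel h x = near e (U \<rho>) x" for x
    unfolding pot_def h_def by (rule mix_commute) auto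
  have "energy lborel h lborel h = (\<integral>\<^sup>+x. near e (U \<rho>) x * h x \<partial>lborel)"
    by (simp add: energy_def pot_h)
  also have "\<dots> = (\<integral>\<^sup>+x. mix (prof {..e}) \<rho> (\<lambda>_. 1) x * near e (U \<rho>) x \<partial>lborel)"
    by (simp add: h_def mult.commute)
  also have "\<dots> = (\<integral>\<^sup>+x. near e (near e (U \<rho>)) x \<partial>\<rho>)"
    by (subst mix_sym) auto
  also have "\<dots> = (\<integral>\<^sup>+x. \<integral>\<^sup>+s. \<integral>\<^sup>+t. smear (s + t) lborel (U \<rho>) x \<partial>prof {..e} \<partial>prof {..e} \<partial>\<rho>)"
    by (subst mix_mix) auto
  also have "\<dots> = (\<integral>\<^sup>+s. \<integral>\<^sup>+x. \<integral>\<^sup>+t. smear (s + t) lborel (U \<rho>) x \<partial>prof {..e} \<partial>\<rho> \<partial>prof {..e})"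
    by (rule nn_integral_swap) (auto intro!: borel_measurable_nn_integral_sfin)
  also have "\<dots> = (\<integral>\<^sup>+s. \<integral>\<^sup>+t. \<integral>\<^sup>+x. smear (s + t) lborel (U \<rho>) x \<partial>\<rho> \<partial>prof {..e} \<partial>prof {..e})"
    by (intro nn_integral_cong nn_integral_swap) auto
  also have "\<dots> \<le> (\<integral>\<^sup>+s. \<integral>\<^sup>+t. ?E \<partial>prof {..e} \<partial>prof {..e})"
  proof (rule nn_integral_mono_AE)
    have ae: "AE s in prof {..e}. 0 < s" by (rule AE_prof_pos) simp
    from ae show "AE s in prof {..e}. (\<integral>\<^sup>+t. \<integral>\<^sup>+x. smear (s + t) lborel (U \<rho>) x \<partial>\<rho> \<partial>prof {..e}) \<le> (\<integral>\<^sup>+t. ?E \<partial>prof {..e})"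
    proof eventually_elim
      case (elim s)
      from ae show ?case
        by (intro nn_integral_mono_AE) (use elim in \<open>auto elim!: eventually_mono intro!: energy_smear_le\<close>)
    qed
  qed
  also have "\<dots> = mass e * mass e * ?E"
    by (simp add: mass_def mult_ac)
  finally show ?thesis .
qed


text \<open>A smoothed Dirac measure of finite energy.\<close>

definition probe :: "real \<Rightarrow> 'a \<Rightarrow> 'a \<Rightarrow> ennreal" where
  "probe d x = mix (eta d) (return borel x) (\<lambda>_. 1)"

lemma probe_measurable [measurable]: "probe d x \<in> borel_measurable borel"
  unfolding probe_def by simp

text \<open>By symmetry, testing against the probe evaluates the averaged potential at x.\<close>

lemma energy_probe:
  assumes "sfin \<nu>" "g \<in> borel_measurable borel"
  shows "energy lborel (probe d x) \<nu> g = smooth d (pot \<nu> g) x"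
proof -
  have "energy lborel (probe d x) \<nu> g = (\<integral>\<^sup>+y. mix (eta d) (return borel x) (\<lambda>_. 1) y * pot \<nu> g y \<partial>lborel)"
    unfolding energy_def probe_def by (simp add: mult.commute)
  also have "\<dots> = (\<integral>\<^sup>+y. smooth d (pot \<nu> g) y * 1 \<partial>return borel x)"
    using assms by (intro mix_sym) auto
  also have "\<dots> = smooth d (pot \<nu> g) x"
    using assms by (subst nn_integral_return) auto
  finally show ?thesis .
qed

lemma energy_probe_finite:
  assumes d: "0 < d" shows "energy lborel (probe d x) lborel (probe d x) < \<infinity>"
proof -
  have "pot lborel (probe d x) y \<le> trunc_bound d" for y
  proof -
    have "pot lborel (probe d x) y = smooth d (U (return borel x)) y"
      unfolding pot_def probe_def using d by (intro mix_commute) auto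
    also have "\<dots> = mix (prof {d<..}) (return borel x) (\<lambda>_. 1) y"
      unfolding pot_def using d by (intro mix_eta_prof) auto
    also have "\<dots> \<le> trunc_bound d * emeasure (return borel x) UNIV"
      by (rule mix_trunc_le) simp
    finally show ?thesis by simp
  qed
  then have "smooth d (pot lborel (probe d x)) x \<le> smooth d (\<lambda>_. trunc_bound d) x" by (rule mix_mono)
  also have "\<dots> = trunc_bound d" using d by (simp add: mix_const emeasure_eta)
  finally show ?thesis
    using trunc_bound_finite[OF d] by (simp add: energy_probe le_less_trans)
qed

text \<open>Averaging over \<open>eta d\<close> removes the times up to d, so the small-time mean
  only delays times above d and \<open>prof_shift_bound\<close> applies. Testing the majorant
  against the probe is thereby sharp as e tends to 0.\<close>

lemma smooth_near_le:
  assumes [simp]: "sfin \<nu>" and e: "0 < e" "e < d"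
  shows "smooth d (near e (\<lambda>y. U \<nu> y + c)) x \<le>
    mass e * (ennreal ((1 - e / d) powr (\<alpha> / 2 - 1)) * U \<nu> x + c)"
proof -
  have d: "0 < d" using e by simp
  have "smooth d (near e (\<lambda>y. U \<nu> y + c)) x = near e (smooth d (\<lambda>y. U \<nu> y + c)) x"
    using d by (intro mix_commute) auto
  also have "smooth d (\<lambda>y. U \<nu> y + c) = (\<lambda>y. mix (prof {d<..}) \<nu> (\<lambda>_. 1) y + c)"
    using d by (auto simp: mix_add mix_const emeasure_eta pot_def mix_eta_prof)
  also have "near e \<dots> x = near e (mix (prof {d<..}) \<nu> (\<lambda>_. 1)) x + c * mass e"
    by (subst mix_add) (auto simp: mix_const mass_def)
  also have "near e (mix (prof {d<..}) \<nu> (\<lambda>_. 1)) x = (\<integral>\<^sup>+s. \<integral>\<^sup>+t. smear (s + t) \<nu> (\<lambda>_. 1) x \<partial>prof {d<..} \<partial>prof {..e})"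
    by (subst mix_mix) auto
  also have "\<dots> \<le> ennreal ((1 - e / d) powr (\<alpha> / 2 - 1)) * mass e * U \<nu> x"
    unfolding pot_def mix_def using e by (intro prof_shift_bound) auto
  finally show ?thesis by (simp add: distrib_left mult_ac)
qed

lemma pot_SUP_trunc:
  assumes "sfin \<nu>"
  shows "(SUP n. mix (prof {1 / real (Suc n)<..}) \<nu> (\<lambda>_. 1) x) = U \<nu> x"
  unfolding mix_def pot_def
proof (rule nn_integral_prof_SUP)
  show "incseq (\<lambda>n. {1 / real (Suc n)<..})"
    by (auto simp: incseq_def intro: le_less_trans[rotated] divide_left_mono)
  show "{0<..} \<subseteq> (\<Union>n. {1 / real (Suc n)<..})"
    using reals_Archimedean by (force simp: inverse_eq_divide)
qed (use assms in auto)

text \<open>The added constant makes one statement serve two purposes: c = 0 compares two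
  potentials, and the zero measure with c = 1 gives the maximum principle.\<close>

theorem domination:
  assumes [simp]: "sfin \<rho>" "sfin \<nu>" and fin: "emeasure \<rho> UNIV < \<top>"
    and en: "energy \<rho> (\<lambda>_. 1) \<rho> (\<lambda>_. 1) < \<top>" and c: "c < \<top>"
    and ae: "AE x in \<rho>. U \<rho> x \<le> U \<nu> x + c"
  shows "U \<rho> x \<le> U \<nu> x + c"
proof (cases "U \<nu> x = \<top>")
  case False
  define L where "L = energy \<rho> (\<lambda>_. 1) \<rho> (\<lambda>_. 1)"
  \<comment> \<open>The potentials of the densities \<open>\<kappa> n\<close> below are means of \<open>w\<close>, so \<open>\<kappa> n\<close> converges to \<open>\<rho>\<close> in energy,
    since \<open>w = U \<rho>\<close> almost everywhere with respect to \<open>\<rho>\<close>. Testing this convergence against \<open>probe d x\<close> bounds \<open>U \<rho> x\<close>.\<close>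
  define w where "w y = min (U \<rho> y) (U \<nu> y + c)" for y
  have [measurable]: "w \<in> borel_measurable borel" unfolding w_def by measurable
  have w_lsc: "seq_lsc w" unfolding w_def using c by (intro seq_lsc_min seq_lsc_add_const U_lsc) auto
  have smooth_U: "smooth e (U \<mu>) y \<le> U \<mu> y" if "0 < e" "sfin \<mu>" for e y \<mu>
    unfolding pot_def using that by (simp add: mix_eta_prof mix_prof_mono)
  have w_le: "w y \<le> U \<rho> y" "w y \<le> U \<nu> y + c" for y by (auto simp: w_def)
  have w_smooth: "smooth e w y \<le> w y" if "0 < e" for e y
  proof -
    have "smooth e w y \<le> smooth e (U \<rho>) y" by (rule mix_mono) (rule w_le)
    also have "\<dots> \<le> U \<rho> y" using that by (simp add: smooth_U)
    finally have 1: "smooth e w y \<le> U \<rho> y" .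
    have "smooth e w y \<le> smooth e (\<lambda>y. U \<nu> y + c) y" by (rule mix_mono) (rule w_le)
    also have "\<dots> = smooth e (U \<nu>) y + c" using that by (simp add: mix_add mix_const emeasure_eta)
    also have "\<dots> \<le> U \<nu> y + c" using that by (intro add_right_mono smooth_U) auto
    finally show ?thesis using 1 by (simp add: w_def)
  qed
  define E where "E n = 1 / real (Suc n)" for n
  have E: "0 < E n" "E \<longlonglongrightarrow> 0" for n
    unfolding E_def using LIMSEQ_Suc[OF lim_1_over_n] by auto
  \<comment> \<open>With this factor the small-time means preserve constants.\<close>
  define q where "q n = inverse (mass (E n))" for n
  have q: "q n * mass (E n) = 1" for n
    using ennreal_divide_self[of "mass (E n)"] mass_finite[OF E(1)] less_imp_neq[OF mass_pos[OF E(1)], symmetric]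
    unfolding q_def divide_ennreal_def by (simp add: mult.commute less_top)
  define \<kappa> where "\<kappa> n y = q n * (w y - smooth (E n) w y)" for n y
  have [measurable]: "\<kappa> n \<in> borel_measurable borel" for n unfolding \<kappa>_def by measurable
  have pot_\<kappa>: "pot lborel (\<kappa> n) y = q n * near (E n) w y" for n y
  proof -
    have "pot lborel (\<kappa> n) y = q n * pot lborel (\<lambda>y. w y - smooth (E n) w y) y"
      unfolding \<kappa>_def pot_def by (rule mix_cmult) auto
    also have "pot lborel (\<lambda>y. w y - smooth (E n) w y) y = near (E n) w y"
      using fin w_le w_smooth E by (intro pot_superaverage) auto
    finally show ?thesis .
  qed
  \<comment> \<open>The potential of \<open>\<kappa> n\<close> lies below that of the normalised
    average \<open>q n * h\<close> of \<rho>. Using this once for each argument of the energy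
    reduces the claim to \<open>energy_near_le\<close>.\<close>
  have energy_\<kappa>: "energy lborel (\<kappa> n) lborel (\<kappa> n) \<le> L" for n
  proof -
    define h where "h = mix (prof {..E n}) \<rho> (\<lambda>_. 1)"
    have [measurable]: "h \<in> borel_measurable borel" unfolding h_def by simp
    have *: "pot lborel h y = near (E n) (U \<rho>) y" for y
      unfolding pot_def h_def by (rule mix_commute) auto
    have pot_le: "pot lborel (\<kappa> n) y \<le> q n * pot lborel h y" for y
    proof -
      have "near (E n) w y \<le> near (E n) (U \<rho>) y" by (rule mix_mono) (rule w_le)
      then show ?thesis unfolding pot_\<kappa> * by (intro mult_left_mono) auto
    qed
    have "energy lborel (\<kappa> n) lborel (\<kappa> n) \<le> (\<integral>\<^sup>+y. q n * (pot lborel h y * \<kappa> n y) \<partial>lborel)"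
      unfolding energy_def by (intro nn_integral_mono) (metis mult.assoc mult_right_mono pot_le zero_le)
    also have "\<dots> = q n * energy lborel (\<kappa> n) lborel h"
      unfolding energy_def by (subst nn_integral_cmult) auto
    also have "energy lborel (\<kappa> n) lborel h = energy lborel h lborel (\<kappa> n)"
      by (rule energy_commute) auto
    also have "\<dots> \<le> (\<integral>\<^sup>+y. q n * (pot lborel h y * h y) \<partial>lborel)"
      unfolding energy_def by (intro nn_integral_mono) (metis mult.assoc mult_right_mono pot_le zero_le)
    also have "\<dots> = q n * energy lborel h lborel h"
      unfolding energy_def by (subst nn_integral_cmult) auto
    also have "\<dots> \<le> q n * (mass (E n) * mass (E n) * L)"
      unfolding h_def L_def by (intro mult_left_mono energy_near_le E) auto
    also have "q n * (q n * (mass (E n) * mass (E n) * L)) = (q n * mass (E n)) * (q n * mass (E n)) * L"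
      by (simp only: mult_ac)
    finally show ?thesis by (simp add: q mult_left_mono)
  qed
  define A where "A n = energy lborel (\<kappa> n) \<rho> (\<lambda>_. 1)" for n
  \<comment> \<open>The normalised small-time means of w have lower limit at least w, which equals
    \<open>U \<rho>\<close> almost everywhere for \<rho>; Fatou's lemma integrates this. With
    \<open>energy_\<kappa>\<close> it says that \<open>\<kappa> n\<close> tends to \<rho> in
    energy.\<close>
  have liminf_A: "L \<le> liminf A"
  proof -
    have "L = (\<integral>\<^sup>+y. U \<rho> y \<partial>\<rho>)" by (simp add: L_def energy_def)
    also have "\<dots> = (\<integral>\<^sup>+y. w y \<partial>\<rho>)"
      using ae by (intro nn_integral_cong_AE) (auto elim!: eventually_mono simp: w_def min_absorb1)
    also have "\<dots> \<le> (\<integral>\<^sup>+y. liminf (\<lambda>n. q n * near (E n) w y) \<partial>\<rho>)"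
      using liminf_near_ge[OF w_lsc _ E] by (intro nn_integral_mono) (simp add: q_def divide_ennreal_def mult.commute)
    also have "\<dots> \<le> liminf (\<lambda>n. \<integral>\<^sup>+y. q n * near (E n) w y \<partial>\<rho>)"
      by (rule nn_integral_liminf) (auto simp: sfin_measurable)
    also have "(\<lambda>n. \<integral>\<^sup>+y. q n * near (E n) w y \<partial>\<rho>) = A"
    proof
      fix n
      have "A n = energy \<rho> (\<lambda>_. 1) lborel (\<kappa> n)" unfolding A_def by (rule energy_commute) auto
      then show "(\<integral>\<^sup>+y. q n * near (E n) w y \<partial>\<rho>) = A n" by (simp add: energy_def pot_\<kappa>)
    qed
    finally show ?thesis .
  qed
  have main: "mix (prof {d<..}) \<rho> (\<lambda>_. 1) x \<le> U \<nu> x + c" if d: "0 < d" for d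
  proof -
    define C where "C = energy lborel (probe d x) lborel (probe d x)"
    define B where "B = mix (prof {d<..}) \<rho> (\<lambda>_. 1) x"
    \<comment> \<open>Collects the errors of order s in \<open>step\<close>: the energy of the
      probe, the factor 1 + s in front of \<open>U \<nu> x\<close>, and the defect s^2 in the
      energies divided by s.\<close>
    define K where "K = C + U \<nu> x + 1"
    have K: "K < \<top>" using energy_probe_finite[OF d, of x] False by (simp add: K_def C_def less_top)
    have B: "energy \<rho> (\<lambda>_. 1) lborel (probe d x) = B"
    proof -
      have "energy \<rho> (\<lambda>_. 1) lborel (probe d x) = energy lborel (probe d x) \<rho> (\<lambda>_. 1)"
        by (rule energy_commute) auto
      then show ?thesis using d by (simp add: energy_probe B_def pot_def mix_eta_prof)
    qed
    define c1 where "c1 n = (1 - E n / d) powr (\<alpha> / 2 - 1)" for n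
    have D: "energy lborel (\<kappa> n) lborel (probe d x) \<le> ennreal (c1 n) * U \<nu> x + c" if "E n < d" for n
    proof -
      have "energy lborel (\<kappa> n) lborel (probe d x) = energy lborel (probe d x) lborel (\<kappa> n)"
        by (rule energy_commute) auto
      also have "\<dots> = smooth d (\<lambda>y. q n * near (E n) w y) x"
        by (simp add: energy_probe pot_\<kappa>[abs_def])
      also have "\<dots> = q n * smooth d (near (E n) w) x" by (rule mix_cmult) auto
      also have "\<dots> \<le> q n * smooth d (near (E n) (\<lambda>y. U \<nu> y + c)) x"
        by (intro mult_left_mono mix_mono w_le) auto
      also have "\<dots> \<le> q n * (mass (E n) * (ennreal (c1 n) * U \<nu> x + c))"
        unfolding c1_def using E(1) that by (intro mult_left_mono smooth_near_le) auto
      also have "\<dots> = ennreal (c1 n) * U \<nu> x + c" by (simp add: mult.assoc[symmetric] q)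
      finally show ?thesis .
    qed
    \<comment> \<open>Cauchy-Schwarz in variational form: the energy of \<open>\<kappa> n\<close>
      plus s times the probe minus \<rho> is nonnegative. With n so large that \<open>A n\<close>
      misses L by at most s^2, the energies of \<rho> cancel and the rest is divided by 2 s.\<close>
    have step: "B \<le> ennreal s * K + (U \<nu> x + c)" if s: "0 < s" for s :: real
    proof -
      have "eventually (\<lambda>n. L \<le> A n + ennreal (s * s)) sequentially"
      proof (cases "L = 0")
        case False
        then have "L - ennreal (s * s) < L"
          using s en by (intro ennreal_between) (auto simp: L_def zero_less_iff_neq_zero)
        with liminf_A have "eventually (\<lambda>n. L - ennreal (s * s) < A n) sequentially"
          unfolding le_Liminf_iff by blast
        then show ?thesis
        proof eventually_elim
          case (elim n)
          show ?case
          proof (cases "ennreal (s * s) \<le> L")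
            case True
            then have "L = (L - ennreal (s * s)) + ennreal (s * s)" by (simp add: diff_add_cancel_ennreal)
            also have "\<dots> \<le> A n + ennreal (s * s)" using elim by (intro add_right_mono less_imp_le)
            finally show ?thesis .
          next
            case False
            then have "L \<le> 0 + ennreal (s * s)" by simp
            also have "\<dots> \<le> A n + ennreal (s * s)" by (intro add_right_mono) simp
            finally show ?thesis .
          qed
        qed
      qed simp
      moreover have "(\<lambda>n. c1 n) \<longlonglongrightarrow> (1 - 0 / d) powr (\<alpha> / 2 - 1)"
        unfolding c1_def using d by (intro tendsto_intros E) auto
      then have "eventually (\<lambda>n. c1 n < 1 + s) sequentially"
        using s by (intro order_tendstoD(2)) auto
      moreover have "eventually (\<lambda>n. E n < d) sequentially"
        using E(2) d by (rule order_tendstoD(2))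
      ultimately have "eventually (\<lambda>n. L \<le> A n + ennreal (s * s) \<and> c1 n < 1 + s \<and> E n < d) sequentially"
        by eventually_elim simp
      then obtain n where n: "L \<le> A n + ennreal (s * s)" "c1 n < 1 + s" "E n < d"
        by (auto dest: eventually_happens)
      define D where "D = energy lborel (\<kappa> n) lborel (probe d x)"
      have "2 * A n + 2 * (ennreal s * B) \<le> energy lborel (\<kappa> n) lborel (\<kappa> n) + L + ennreal s * ennreal s * C + 2 * (ennreal s * D)"
        using energy_psd3[of lborel \<rho> lborel "\<kappa> n" "\<lambda>_. 1" "probe d x" "ennreal s"]
        by (simp add: A_def B L_def C_def D_def)
      also have "\<dots> \<le> L + L + ennreal s * ennreal s * C + 2 * (ennreal s * D)"
        by (intro add_right_mono energy_\<kappa>)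
      finally have 1: "2 * A n + 2 * (ennreal s * B) \<le> 2 * L + (ennreal s * ennreal s * C + 2 * (ennreal s * D))"
        by (simp add: mult_2 add.assoc)
      have "2 * L + 2 * (ennreal s * B) \<le> 2 * (A n + ennreal (s * s)) + 2 * (ennreal s * B)"
        using n(1) by (intro add_right_mono mult_left_mono) auto
      also have "\<dots> = (2 * A n + 2 * (ennreal s * B)) + 2 * ennreal (s * s)"
        by (simp add: distrib_left ac_simps)
      also have "\<dots> \<le> 2 * L + (ennreal s * ennreal s * C + 2 * (ennreal s * D)) + 2 * ennreal (s * s)"
        using 1 by (rule add_right_mono)
      finally have "2 * L + 2 * (ennreal s * B) \<le> 2 * L + (ennreal s * ennreal s * C + 2 * (ennreal s * D) + 2 * ennreal (s * s))"
        by (simp only: add.assoc)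
      moreover have "2 * L \<noteq> \<top>" using en by (simp add: L_def ennreal_mult_eq_top_iff)
      ultimately have "2 * (ennreal s * B) \<le> ennreal s * ennreal s * C + 2 * (ennreal s * D) + 2 * ennreal (s * s)"
        by (simp add: ennreal_add_left_cancel_le)
      also have "\<dots> \<le> 2 * (ennreal s * ennreal s * C) + 2 * (ennreal s * D) + 2 * ennreal (s * s)"
        by (intro add_right_mono) (simp add: mult_2)
      also have "\<dots> = (2 * ennreal s) * (ennreal s * C + D + ennreal s)"
        using s by (simp add: distrib_left mult_ac ennreal_mult')
      finally have "(2 * ennreal s) * B \<le> (2 * ennreal s) * (ennreal s * C + D + ennreal s)"
        by (simp add: mult.assoc)
      then have "B \<le> ennreal s * C + D + ennreal s"
        using s by (subst (asm) ennreal_mult_le_mult_iff) (auto simp: ennreal_mult_eq_top_iff)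
      also have "\<dots> \<le> ennreal s * C + (ennreal (1 + s) * U \<nu> x + c) + ennreal s"
      proof -
        have "D \<le> ennreal (c1 n) * U \<nu> x + c" unfolding D_def by (rule D) (rule n)
        also have "\<dots> \<le> ennreal (1 + s) * U \<nu> x + c"
          using n(2) by (intro add_right_mono mult_right_mono ennreal_leI) auto
        finally show ?thesis by (intro add_mono) auto
      qed
      also have "\<dots> = ennreal s * K + (U \<nu> x + c)"
        using s by (simp add: K_def distrib_left distrib_right ac_simps)
      finally show ?thesis .
    qed
    show ?thesis
      unfolding B_def[symmetric]
    proof (rule ennreal_le_epsilon)
      fix e :: real assume e: "0 < e"
      obtain k where k: "K = ennreal k" "0 \<le> k" using K by (cases K) auto
      have "1 \<le> K" by (simp add: K_def)
      then have "k > 0" using k by (cases "k = 0") auto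
      have "B \<le> ennreal (e / k) * K + (U \<nu> x + c)" using e \<open>k > 0\<close> by (intro step) auto
      also have "ennreal (e / k) * K = ennreal e"
        using e \<open>k > 0\<close> by (simp add: k ennreal_mult'[symmetric])
      finally show "B \<le> U \<nu> x + c + ennreal e" by (simp add: add.commute)
    qed
  qed
  have "U \<rho> x = (SUP n. mix (prof {E n<..}) \<rho> (\<lambda>_. 1) x)"
    unfolding E_def by (rule pot_SUP_trunc[symmetric]) simp
  then show ?thesis using main E by (auto intro!: SUP_least)
qed (use c in auto)

end

section \<open>Vague compactness\<close>

text \<open>Schoenberg's space-filling curve: \<open>tooth\<close> applied to \<open>3 ^ p * t\<close> reads off the ternary digit of \<open>t\<close>
  at position \<open>p\<close>, and the digits at positions \<open>m * k + i\<close> are the binary digits of coordinate \<open>i\<close>.\<close>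

definition tooth :: "real \<Rightarrow> real" where
  "tooth u = max 0 (min 1 (1 / 2 - cos (pi * u)))"

lemma tooth_bounds: "0 \<le> tooth u" "tooth u \<le> 1"
  by (auto simp: tooth_def)

lemma tooth_periodic: "tooth (2 * of_int N + u) = tooth u"
proof -
  have "cos (pi * (2 * of_int N + u)) = cos (2 * pi * of_int N + pi * u)" by (simp add: algebra_simps)
  also have "\<dots> = cos (pi * u)" by (simp add: cos_add)
  finally show ?thesis by (simp add: tooth_def)
qed

lemma tooth_low: assumes "0 \<le> u" "u \<le> 1 / 3" shows "tooth u = 0"
proof -
  have "cos (pi / 3) \<le> cos (pi * u)" using assms by (intro cos_monotone_0_pi_le) auto
  then show ?thesis by (simp add: tooth_def cos_60)
qed

lemma tooth_high: assumes "2 / 3 \<le> u" "u \<le> 1" shows "tooth u = 1"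
proof -
  have "tooth u = max 0 (min 1 (1 / 2 + cos (pi * (1 - u))))"
    by (simp add: tooth_def right_diff_distrib cos_diff)
  moreover have "cos (pi / 3) \<le> cos (pi * (1 - u))" using assms by (intro cos_monotone_0_pi_le) auto
  ultimately show ?thesis by (simp add: cos_60)
qed

definition schoenberg :: "nat \<Rightarrow> nat \<Rightarrow> real \<Rightarrow> real" where
  "schoenberg m i t = (\<Sum>k. (1 / 2) ^ Suc k * tooth (3 ^ (m * k + i) * t))"

lemma continuous_on_schoenberg: "continuous_on UNIV (schoenberg m i)"
proof -
  let ?f = "\<lambda>k t. (1 / 2 :: real) ^ Suc k * tooth (3 ^ (m * k + i) * t)"
  have lim: "uniform_limit UNIV (\<lambda>n t. \<Sum>k<n. ?f k t) (\<lambda>t. suminf (\<lambda>k. ?f k t)) sequentially"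
  proof (rule Weierstrass_m_test)
    show "norm (?f k t) \<le> (1 / 2) ^ Suc k" for k t
      using tooth_bounds[of "3 ^ (m * k + i) * t"] by (simp add: abs_mult mult_left_le)
    show "summable (\<lambda>k. (1 / 2 :: real) ^ Suc k)"
      by (subst summable_Suc_iff) (simp add: summable_geometric)
  qed
  have "continuous_on UNIV (\<lambda>t. suminf (\<lambda>k. ?f k t))"
    by (rule uniform_limit_theorem[OF _ lim]) (auto simp: tooth_def intro!: always_eventually continuous_intros)
  then show ?thesis by (simp add: schoenberg_def[abs_def])
qed

lemma binary_expansion:
  fixes c :: real
  assumes "0 \<le> c" "c \<le> 1"
  obtains d :: "nat \<Rightarrow> bool" where "(\<lambda>k. (1 / 2) ^ Suc k * of_bool (d k)) sums c"
proof -
  \<comment> \<open>The remainders of the greedy expansion, generated by the doubling map.\<close>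
  define r where "r k = rec_nat c (\<lambda>_ x. if x \<ge> 1 / 2 then 2 * x - 1 else 2 * x) k" for k
  have r0: "r 0 = c" and rS: "r (Suc k) = (if r k \<ge> 1 / 2 then 2 * r k - 1 else 2 * r k)" for k
    by (auto simp: r_def)
  define d where "d k \<longleftrightarrow> r k \<ge> 1 / 2" for k
  have b: "0 \<le> r k \<and> r k \<le> 1" for k
    by (induction k) (use assms in \<open>auto simp: r0 rS\<close>)
  have sum: "(\<Sum>k<n. (1 / 2) ^ Suc k * of_bool (d k)) = c - (1 / 2) ^ n * r n" for n
    by (induction n) (auto simp: r0 rS d_def field_simps)
  have "(\<lambda>n. (1 / 2 :: real) ^ n * r n) \<longlonglongrightarrow> 0"
  proof (rule tendsto_sandwich[OF _ _ tendsto_const])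
    show "(\<lambda>n. (1 / 2 :: real) ^ n) \<longlonglongrightarrow> 0" by (rule LIMSEQ_power_zero) simp
  qed (use b in \<open>auto intro!: always_eventually mult_left_le\<close>)
  then have "(\<lambda>n. c - (1 / 2) ^ n * r n) \<longlonglongrightarrow> c - 0" by (intro tendsto_intros)
  then have "(\<lambda>k. (1 / 2) ^ Suc k * of_bool (d k)) sums c" unfolding sums_def sum by simp
  then show ?thesis by (rule that)
qed

text \<open>Using only the even digits 0 and 2 has two effects: 3^p t differs from its tail by an
  even integer, a period of \<open>tooth\<close>, and the tail lies in the first or the last third
  of [0, 1], where \<open>tooth\<close> is constant.\<close>

lemma ternary_point:
  fixes a :: "nat \<Rightarrow> bool"
  obtains t where "0 \<le> t" "t \<le> 1" "\<And>p. tooth (3 ^ p * t) = of_bool (a p)"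
proof -
  define T where "T p = (\<Sum>j. 2 * of_bool (a (p + j)) * (1 / 3 :: real) ^ Suc j)" for p
  have geo: "(\<lambda>j. 2 * (1 / 3 :: real) ^ Suc j) sums 1"
    using sums_mult[OF geometric_sums[of "1 / 3 :: real"], of "2 / 3"] by (simp add: mult.assoc)
  have sm: "summable (\<lambda>j. 2 * of_bool (a (p + j)) * (1 / 3 :: real) ^ Suc j)" for p
  proof (rule summable_comparison_test'[where N=0, OF sums_summable[OF geo]])
    fix j :: nat
    show "norm (2 * of_bool (a (p + j)) * (1 / 3 :: real) ^ Suc j) \<le> 2 * (1 / 3 :: real) ^ Suc j"
      by (cases "a (p + j)") simp_all
  qed
  have T0: "0 \<le> T p" for p unfolding T_def by (intro suminf_nonneg sm) auto
  have T1: "T p \<le> 1" for p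
  proof -
    have "T p \<le> (\<Sum>j. 2 * (1 / 3 :: real) ^ Suc j)"
      unfolding T_def
    proof (intro suminf_le sm sums_summable[OF geo])
      fix j show "2 * of_bool (a (p + j)) * (1 / 3 :: real) ^ Suc j \<le> 2 * (1 / 3 :: real) ^ Suc j"
        by (cases "a (p + j)") simp_all
    qed
    then show ?thesis using geo by (simp add: sums_iff)
  qed
  have rec: "3 * T p = 2 * of_bool (a p) + T (Suc p)" for p
  proof -
    have "T p = (\<Sum>j. 2 * of_bool (a (p + Suc j)) * (1 / 3 :: real) ^ Suc (Suc j)) + 2 * of_bool (a p) / 3"
      unfolding T_def using suminf_split_head[OF sm[of p]] by simp
    also have "(\<Sum>j. 2 * of_bool (a (p + Suc j)) * (1 / 3 :: real) ^ Suc (Suc j)) = T (Suc p) * (1 / 3)"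
      unfolding T_def by (subst suminf_mult2[OF sm]) (simp add: mult_ac)
    finally show ?thesis by simp
  qed
  have "\<exists>N::int. 3 ^ p * T 0 = 2 * of_int N + T p" for p
  proof (induction p)
    case 0
    show ?case by (rule exI[of _ 0]) simp
  next
    case (Suc p)
    then obtain N :: int where N: "3 ^ p * T 0 = 2 * of_int N + T p" by blast
    have "3 ^ Suc p * T 0 = 2 * of_int (3 * N + of_bool (a p)) + T (Suc p)"
      using N rec[of p] by (simp add: mult.assoc)
    then show ?case by blast
  qed
  then have "tooth (3 ^ p * T 0) = tooth (T p)" for p by (metis tooth_periodic)
  moreover have "tooth (T p) = of_bool (a p)" for p
    using rec[of p] T0[of "Suc p"] T1[of "Suc p"] T1[of p] by (cases "a p") (auto intro!: tooth_low tooth_high)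
  ultimately show ?thesis using T0[of 0] T1[of 0] by (intro that[of "T 0"]) auto
qed

lemma space_filling_curve:
  obtains \<phi> :: "real \<Rightarrow> 'a::euclidean_space"
  where "continuous_on UNIV \<phi>" "cball 0 1 \<subseteq> \<phi> ` {0..1}"
proof -
  let ?m = "DIM('a)"
  obtain idx :: "'a \<Rightarrow> nat" where idx: "bij_betw idx Basis {0..<?m}"
    using ex_bij_betw_finite_nat[of "Basis::'a set"] by auto
  have idx_less: "idx b < ?m" if "b \<in> Basis" for b using idx that by (auto simp: bij_betw_def)
  define \<phi> where "\<phi> t = (\<Sum>b\<in>Basis. (2 * schoenberg ?m (idx b) t - 1) *\<^sub>R (b::'a))" for t
  have "continuous_on UNIV \<phi>"
    unfolding \<phi>_def by (intro continuous_intros continuous_on_schoenberg)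
  moreover have "y \<in> \<phi> ` {0..1}" if y: "y \<in> cball 0 1" for y
  proof -
    have yb: "\<bar>y \<bullet> b\<bar> \<le> 1" if "b \<in> Basis" for b
      using y Basis_le_norm[OF that, of y] by simp
    \<comment> \<open>The curve covers the whole cube with coordinates in [-1, 1], which contains
      the unit ball. Each coordinate is rescaled to [0, 1] to have a binary expansion.\<close>
    define c where "c i = (1 + y \<bullet> inv_into Basis idx i) / 2" for i
    have "\<exists>d :: nat \<Rightarrow> bool. (\<lambda>k. (1 / 2) ^ Suc k * of_bool (d k)) sums c i" if "i < ?m" for i
    proof -
      have "inv_into Basis idx i \<in> Basis" using idx that by (intro inv_into_into) (auto simp: bij_betw_def)
      from yb[OF this] have "0 \<le> c i" "c i \<le> 1" by (auto simp: c_def)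
      then show ?thesis by (metis binary_expansion)
    qed
    then obtain d :: "nat \<Rightarrow> nat \<Rightarrow> bool" where d: "\<And>i. i < ?m \<Longrightarrow> (\<lambda>k. (1 / 2) ^ Suc k * of_bool (d i k)) sums c i"
      by metis
    obtain t where t: "0 \<le> t" "t \<le> 1" "\<And>p. tooth (3 ^ p * t) = of_bool (d (p mod ?m) (p div ?m))"
      using ternary_point[of "\<lambda>p. d (p mod ?m) (p div ?m)"] by blast
    have "schoenberg ?m i t = c i" if "i < ?m" for i
      using d[OF that] that unfolding schoenberg_def t(3) by (simp add: sums_iff)
    then have "\<phi> t = (\<Sum>b\<in>Basis. (2 * c (idx b) - 1) *\<^sub>R b)"
      unfolding \<phi>_def by (intro sum.cong refl) (simp add: idx_less)
    also have "\<dots> = (\<Sum>b\<in>Basis. (y \<bullet> b) *\<^sub>R b)"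
      using idx by (intro sum.cong refl) (auto simp: c_def bij_betw_def field_simps)
    also have "\<dots> = y" by (rule euclidean_representation)
    finally show ?thesis using t by force
  qed
  ultimately show ?thesis using that by blast
qed

text \<open>Choosing the least preimage makes measurability elementary: for 0 \<le> a < 1 the
  sublevel set is the compact image of [0, a] together with the complement of the whole
  image.\<close>

lemma borel_section:
  fixes \<phi> :: "real \<Rightarrow> 'a::euclidean_space"
  assumes \<phi>: "continuous_on UNIV \<phi>" and surj: "C \<subseteq> \<phi> ` {0..1}"
  obtains \<psi> :: "'a \<Rightarrow> real" where "\<psi> \<in> borel_measurable borel" "\<And>y. 0 \<le> \<psi> y \<and> \<psi> y \<le> 1" "\<And>y. y \<in> C \<Longrightarrow> \<phi> (\<psi> y) = y"
proof -
  let ?F = "\<lambda>y. {0..1} \<inter> \<phi> -` {y}"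
  define \<psi> where "\<psi> y = (if y \<in> \<phi> ` {0..1} then Inf (?F y) else 0)" for y
  have closed: "closed (?F y)" for y
    using continuous_closed_vimage[of "{y}" \<phi>] \<phi> by (auto simp: continuous_on_eq_continuous_at)
  have bdd: "bdd_below (?F y)" for y by (auto intro: bdd_belowI[of _ 0])
  have mem: "\<psi> y \<in> ?F y" if "y \<in> \<phi> ` {0..1}" for y
  proof -
    have "?F y \<noteq> {}" using that by auto
    from closed_contains_Inf[OF this bdd closed] show ?thesis using that by (simp add: \<psi>_def)
  qed
  have comp: "compact (\<phi> ` {0..a})" for a
    using \<phi> by (intro compact_continuous_image) (auto intro: continuous_on_subset)
  have "{y. \<psi> y \<le> a} \<in> sets borel" for a
  proof -
    have "{y. \<psi> y \<le> a} = (if a < 0 then {} else if a \<ge> 1 then UNIV else \<phi> ` {0..a} \<union> - \<phi> ` {0..1})"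
    proof (cases "0 \<le> a \<and> a < 1")
      case True
      have "\<psi> y \<le> a \<longleftrightarrow> y \<in> \<phi> ` {0..a}" if "y \<in> \<phi> ` {0..1}" for y
      proof
        assume "\<psi> y \<le> a"
        then show "y \<in> \<phi> ` {0..a}" using mem[OF that] by (auto intro!: image_eqI[of _ _ "\<psi> y"])
      next
        assume "y \<in> \<phi> ` {0..a}"
        then obtain t where "t \<in> ?F y" "t \<le> a" using True by auto
        then show "\<psi> y \<le> a" using that cInf_lower[OF _ bdd, of t y] by (simp add: \<psi>_def)
      qed
      moreover have "\<psi> y \<le> a" if "y \<notin> \<phi> ` {0..1}" for y using that True by (auto simp: \<psi>_def)
      moreover have "\<phi> ` {0..a} \<subseteq> \<phi> ` {0..1}" using True by auto
      ultimately show ?thesis using True by auto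
    next
      case False
      have "0 \<le> \<psi> y \<and> \<psi> y \<le> 1" for y using mem[of y] by (cases "y \<in> \<phi> ` {0..1}") (auto simp: \<psi>_def)
      then show ?thesis using False by (auto intro: order_trans simp: not_less)
    qed
    moreover have "\<phi> ` {0..a} \<in> sets borel" for a using comp by (rule borel_compact)
    ultimately show ?thesis by (auto intro: borel_comp)
  qed
  then have "\<psi> \<in> borel_measurable borel" by (simp add: borel_measurable_iff_le)
  moreover have "0 \<le> \<psi> y \<and> \<psi> y \<le> 1" for y using mem[of y] by (cases "y \<in> \<phi> ` {0..1}") (auto simp: \<psi>_def)
  moreover have "\<phi> (\<psi> y) = y" if "y \<in> C" for y using mem[of y] surj that by auto
  ultimately show ?thesis by (rule that)
qed

text \<open>The map y / (1 - |y|) inverts the compression x / (1 + |x|) of space into the open unit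
  ball. Points of norm at least 1 stand for infinity, where h is continued by its limit.\<close>

lemma continuous_on_compactified:
  fixes h :: "'a::euclidean_space \<Rightarrow> real"
  assumes h: "continuous_on UNIV h" "(h \<longlongrightarrow> L) at_infinity"
  defines "H \<equiv> \<lambda>y. if norm y < 1 then h (y /\<^sub>R (1 - norm y)) else L"
  shows "continuous_on UNIV H" "\<exists>B. \<forall>y. norm (H y) \<le> B"
proof -
  have "isCont H y" for y
  proof (cases "norm y < 1")
    case True
    have "eventually (\<lambda>z. z \<in> ball 0 1) (nhds y)" using True by (intro eventually_nhds_in_open) auto
    then have ev: "eventually (\<lambda>z. H z = h (z /\<^sub>R (1 - norm z))) (nhds y)"
      by eventually_elim (simp add: H_def)
    have "isCont (\<lambda>z. z /\<^sub>R (1 - norm z)) y" using True by (intro continuous_intros) auto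
    then have "isCont (\<lambda>z. h (z /\<^sub>R (1 - norm z))) y"
      by (rule isCont_o2) (use h(1) in \<open>simp add: continuous_on_eq_continuous_at\<close>)
    then show ?thesis using isCont_cong[OF ev] by simp
  next
    case False
    have "H y = L" using False by (simp add: H_def)
    moreover have "(H \<longlongrightarrow> L) (nhds y)"
    proof (rule tendstoI)
      fix e :: real assume e: "0 < e"
      from tendstoD[OF h(2) e] obtain R where R: "\<And>x. R \<le> norm x \<Longrightarrow> dist (h x) L < e"
        by (auto simp: eventually_at_infinity)
      define R' where "R' = max R 1"
      have R': "R' > 0" "R \<le> R'" by (auto simp: R'_def)
      have "R' / (1 + R') < 1" using R' by simp
      with False have "R' / (1 + R') < norm y" by simp
      then have "eventually (\<lambda>z. R' / (1 + R') < norm z) (nhds y)"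
        by (intro order_tendstoD(1)[OF tendsto_norm[OF filterlim_ident]])
      then show "eventually (\<lambda>z. dist (H z) L < e) (nhds y)"
      proof eventually_elim
        case (elim z)
        show ?case
        proof (cases "norm z < 1")
          case True
          have "R' * (1 - norm z) \<le> norm z" using elim R' by (simp add: field_simps)
          then have "R' \<le> norm z / (1 - norm z)" using True by (simp add: field_simps)
          also have "\<dots> = norm (z /\<^sub>R (1 - norm z))" using True by (simp add: field_simps)
          finally show ?thesis using R R' True by (simp add: H_def)
        qed (use e in \<open>simp add: H_def\<close>)
      qed
    qed
    moreover have "at y \<le> nhds y" by (simp add: at_within_def)
    ultimately show ?thesis unfolding isCont_def by (metis tendsto_mono)
  qed
  then show c: "continuous_on UNIV H" by (simp add: continuous_on_eq_continuous_at)
  show "\<exists>B. \<forall>y. norm (H y) \<le> B" 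
  proof -
    have "compact (H ` cball 0 1)" using c by (intro compact_continuous_image) (auto intro: continuous_on_subset)
    then have "bounded (H ` cball 0 1)" by (rule compact_imp_bounded)
    then obtain B where B: "\<And>x. x \<in> H ` cball 0 1 \<Longrightarrow> norm x \<le> B" by (auto simp only: bounded_iff)
    have "norm (H y) \<le> max B \<bar>L\<bar>" for y
    proof (cases "norm y < 1")
      case True
      then have "H y \<in> H ` cball 0 1" by (intro imageI) simp
      from B[OF this] show ?thesis by simp
    next
      case False
      then have "H y = L" unfolding H_def by simp
      then show ?thesis by simp
    qed
    then show ?thesis by blast
  qed
qed

lemma tight_unit_interval:
  assumes "\<And>n. real_distribution (P n)" "\<And>n. AE t in P n. 0 \<le> t \<and> t \<le> 1"
  shows "tight P"
proof -
  have "measure (P n) {-1<..2} = 1" for n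
  proof -
    interpret real_distribution "P n" by fact
    have "AE t in P n. t \<in> {-1<..2}" using assms(2)[of n] by eventually_elim auto
    then show ?thesis by (subst prob_eq_1) auto
  qed
  then have "\<exists>a b::real. a < b \<and> (\<forall>n. measure (P n) {a<..b} > 1 - e)" if "0 < e" for e
    using that by (intro exI[of _ "-1"] exI[of _ "2"]) simp
  then show ?thesis using assms(1) unfolding tight_def by blast
qed

text \<open>Here \<open>c\<close> is the mass that escapes to infinity. The space is compressed into the open unit ball, and a
  space-filling curve of the closed ball reduces the claim to Helly's theorem on \<open>[0, 1]\<close>.\<close>

theorem vague_compactness:
  fixes m :: "nat \<Rightarrow> 'a::euclidean_space measure"
  assumes sets: "\<And>n. sets (m n) = sets borel" and mass: "\<And>n. emeasure (m n) UNIV \<le> 1"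
  obtains r M c where "strict_mono r" "sets M = sets borel" "finite_measure M" "0 \<le> (c::real)"
    "\<And>h L. continuous_on UNIV h \<Longrightarrow> (h \<longlongrightarrow> L) at_infinity \<Longrightarrow>
      (\<lambda>n. \<integral>x. h x \<partial>m (r n)) \<longlonglongrightarrow> (\<integral>x. h x \<partial>M) + c * (L::real)"
proof -
  have sp: "space (m n) = UNIV" for n using sets_eq_imp_space_eq[OF sets] by simp
  have meas: "f \<in> borel_measurable borel \<Longrightarrow> f \<in> borel_measurable (m n)" for n and f :: "'a \<Rightarrow> real"
    by (subst measurable_cong_sets[OF sets refl])
  define a where "a n = measure (m n) UNIV" for n
  have fin: "finite_measure (m n)" for n
    using mass[of n] sp by (intro finite_measureI) (auto simp: top_unique)
  have a: "0 \<le> a n" "a n \<le> 1" and em: "emeasure (m n) UNIV = ennreal (a n)" for n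
  proof -
    interpret finite_measure "m n" by (rule fin)
    show "0 \<le> a n" by (simp add: a_def)
    show "emeasure (m n) UNIV = ennreal (a n)" by (simp add: a_def emeasure_eq_measure)
    then show "a n \<le> 1" using mass[of n] by (simp flip: ennreal_1)
  qed
  obtain \<phi> :: "real \<Rightarrow> 'a" where \<phi>: "continuous_on UNIV \<phi>" "cball 0 1 \<subseteq> \<phi> ` {0..1}"
    by (rule space_filling_curve)
  have [measurable]: "\<phi> \<in> borel_measurable borel" using \<phi>(1) by (rule borel_measurable_continuous_onI)
  obtain \<psi> :: "'a \<Rightarrow> real" where [measurable]: "\<psi> \<in> borel_measurable borel"
    and \<psi>: "\<And>y. 0 \<le> \<psi> y \<and> \<psi> y \<le> 1" "\<And>y. y \<in> cball 0 1 \<Longrightarrow> \<phi> (\<psi> y) = y"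
    using borel_section[OF \<phi>] by blast
  define S where "S x = x /\<^sub>R (1 + norm x)" for x :: 'a
  have S1: "norm (S x) < 1" for x
  proof -
    have "norm (S x) = norm x / (1 + norm x)" by (simp add: S_def field_simps)
    also have "\<dots> < 1" by (simp add: add_pos_nonneg)
    finally show ?thesis .
  qed
  have S2: "S x /\<^sub>R (1 - norm (S x)) = x" for x
  proof -
    have p: "1 + norm x > 0" by (simp add: add_pos_nonneg)
    have "norm (S x) = norm x / (1 + norm x)" by (simp add: S_def field_simps)
    then have "1 - norm (S x) = inverse (1 + norm x)" using p by (simp add: field_simps)
    then show ?thesis using p by (simp add: S_def)
  qed
  have [measurable]: "S \<in> borel_measurable borel" unfolding S_def by measurable
  have \<psi>S: "(\<lambda>x. \<psi> (S x)) \<in> m n \<rightarrow>\<^sub>M borel" for n by (rule meas) measurable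
  \<comment> \<open>A measure of mass 0 cannot be normalised and gets a default probability law
    instead; in \<open>eq\<close> its contribution is multiplied by \<open>a n\<close>, which is
    then 0.\<close>
  define P where "P n = (if a n = 0 then return borel 0 else distr (density (m n) (\<lambda>_. ennreal (1 / a n))) borel (\<lambda>x. \<psi> (S x)))" for n
  have setsP: "sets (P n) = sets borel" "space (P n) = UNIV" for n by (auto simp: P_def)
  have \<psi>S': "(\<lambda>x. \<psi> (S x)) \<in> density (m n) c \<rightarrow>\<^sub>M borel" for n c
    using \<psi>S[of n] by simp
  have "prob_space (P n)" for n
  proof (cases "a n = 0")
    case False
    show ?thesis
    proof
      show "emeasure (P n) (space (P n)) = 1"
        using False a(1)[of n] \<psi>S' unfolding setsP
        by (simp add: P_def emeasure_distr sp emeasure_density_const sets em ennreal_mult'[symmetric])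
    qed
  qed (auto simp: P_def intro: prob_space_return)
  then have realP: "real_distribution (P n)" for n
    by (simp add: real_distribution_def real_distribution_axioms_def setsP)
  have aeP: "AE t in P n. 0 \<le> t \<and> t \<le> 1" for n
  proof (cases "a n = 0")
    case True
    then have *: "P n = return borel 0" by (simp add: P_def)
    show ?thesis by (subst *, subst AE_return) auto
  next
    case False
    then have *: "P n = distr (density (m n) (\<lambda>_. ennreal (1 / a n))) borel (\<lambda>x. \<psi> (S x))" by (simp add: P_def)
    show ?thesis using \<psi>(1) \<psi>S' by (subst *, subst AE_distr_iff) auto
  qed
  have tight: "tight P" by (rule tight_unit_interval[OF realP aeP])
  \<comment> \<open>Normalising discards the total masses, so a subsequence along which these
    converge is fixed before Helly's theorem is applied.\<close>
  have "compact {0..1::real}" by simp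
  then obtain a0 s where s: "strict_mono s" "(a \<circ> s) \<longlonglongrightarrow> a0" and a0: "0 \<le> a0"
    unfolding compact_def using a by (metis atLeastAtMost_iff)
  obtain r Q where r: "strict_mono r" "real_distribution Q" "weak_conv_m (P \<circ> s \<circ> r) Q"
    using tight_imp_convergent_subsubsequence[OF tight s(1)] by blast
  interpret Q: real_distribution Q by fact
  have [measurable_cong]: "sets Q = sets borel" by (rule Q.events_eq_borel)
  \<comment> \<open>The parameters whose curve point lies in the open ball. What the limit law puts
    on this set is carried back to space; the remainder sits at infinity and becomes c.\<close>
  define V where "V = {t. norm (\<phi> t) < 1}"
  have [measurable]: "V \<in> sets borel" unfolding V_def by measurable
  define c where "c = a0 * measure Q (- V)"
  define D where "D = density Q (\<lambda>t. ennreal (a0 * indicator V t))"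
  define M where "M = distr D borel (\<lambda>t. \<phi> t /\<^sub>R (1 - norm (\<phi> t)))"
  have mM: "(\<lambda>t. \<phi> t /\<^sub>R (1 - norm (\<phi> t))) \<in> D \<rightarrow>\<^sub>M borel" unfolding D_def by measurable
  have "finite_measure M"
  proof -
    have "emeasure D UNIV = (\<integral>\<^sup>+t. ennreal (a0 * indicator V t) \<partial>Q)"
      unfolding D_def by (subst emeasure_density) auto
    also have "\<dots> \<le> (\<integral>\<^sup>+t. ennreal a0 \<partial>Q)"
      using a0 by (intro nn_integral_mono) (auto simp: indicator_def)
    also have "\<dots> < \<infinity>" by (simp add: Q.emeasure_space_1[simplified])
    finally have "emeasure D UNIV < \<infinity>" .
    moreover have "emeasure M (space M) = emeasure D UNIV"
      unfolding M_def using mM by (subst emeasure_distr) (auto simp: D_def)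
    ultimately show ?thesis by (intro finite_measureI) auto
  qed
  moreover have "(\<lambda>n. \<integral>x. h x \<partial>m ((s \<circ> r) n)) \<longlonglongrightarrow> (\<integral>x. h x \<partial>M) + c * L"
    if h: "continuous_on UNIV h" "(h \<longlongrightarrow> L) at_infinity" for h L
  proof -
    define H where "H y = (if norm y < 1 then h (y /\<^sub>R (1 - norm y)) else L)" for y
    have H: "continuous_on UNIV H" "\<exists>B. \<forall>y. norm (H y) \<le> B"
      unfolding H_def using continuous_on_compactified[OF h] by auto
    then obtain B where B: "\<And>y. norm (H y) \<le> B" by blast
    have [measurable]: "h \<in> borel_measurable borel" "H \<in> borel_measurable borel"
      using h(1) H(1) by (auto intro: borel_measurable_continuous_onI)
    have eq: "(\<integral>x. h x \<partial>m n) = a n * (\<integral>t. H (\<phi> t) \<partial>P n)" for n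
    proof (cases "a n = 0")
      case True
      then have "emeasure (m n) UNIV = 0" using em by simp
      then have "AE x in m n. False" using sp by (intro AE_I[of _ _ UNIV]) (auto simp: sets)
      then have "(\<integral>x. h x \<partial>m n) = (\<integral>x. 0 \<partial>m n)" by (intro integral_cong_AE) (auto intro: meas)
      then show ?thesis using True by simp
    next
      case False
      have "H (\<phi> (\<psi> (S x))) = h x" for x
        using S1[of x] by (simp add: \<psi>(2) H_def S2 less_imp_le)
      then have "(\<integral>t. H (\<phi> t) \<partial>P n) = (\<integral>x. h x \<partial>density (m n) (\<lambda>_. ennreal (1 / a n)))"
        using False \<psi>S' by (simp add: P_def integral_distr)
      also have "\<dots> = (1 / a n) * (\<integral>x. h x \<partial>m n)"
        using a(1) meas[of h n] by (subst integral_density) auto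
      finally show ?thesis using False by simp
    qed
    have cont: "isCont (\<lambda>t. H (\<phi> t)) t" for t
      using \<phi>(1) H(1) by (auto simp: continuous_on_eq_continuous_at intro: isCont_o2)
    have "(\<lambda>n. integral\<^sup>L ((P \<circ> s \<circ> r) n) (\<lambda>t. H (\<phi> t))) \<longlonglongrightarrow> integral\<^sup>L Q (\<lambda>t. H (\<phi> t))"
      by (rule weak_conv_imp_integral_bdd_continuous_conv[OF _ r(2,3) cont B]) (simp add: realP)
    moreover have "(\<lambda>n. (a \<circ> s) (r n)) \<longlonglongrightarrow> a0"
      using LIMSEQ_subseq_LIMSEQ[OF s(2) r(1)] by (simp add: o_def)
    ultimately have "(\<lambda>n. (a \<circ> s) (r n) * integral\<^sup>L ((P \<circ> s \<circ> r) n) (\<lambda>t. H (\<phi> t))) \<longlonglongrightarrow> a0 * integral\<^sup>L Q (\<lambda>t. H (\<phi> t))"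
      by (intro tendsto_mult)
    then have "(\<lambda>n. \<integral>x. h x \<partial>m ((s \<circ> r) n)) \<longlonglongrightarrow> a0 * integral\<^sup>L Q (\<lambda>t. H (\<phi> t))"
      by (simp add: eq)
    also have "a0 * integral\<^sup>L Q (\<lambda>t. H (\<phi> t)) = (\<integral>x. h x \<partial>M) + c * L"
    proof -
      have int: "integrable Q (\<lambda>t. indicator V t * H (\<phi> t))" "integrable Q (\<lambda>t. indicator (- V) t * L)"
      proof -
        have "0 \<le> B" using order_trans[OF norm_ge_zero B] .
        then show "integrable Q (\<lambda>t. indicator V t * H (\<phi> t))"
          using B by (intro Q.integrable_const_bound[of _ B]) (auto simp: indicator_def)
        show "integrable Q (\<lambda>t. indicator (- V) t * L)"
          by (intro Q.integrable_const_bound[of _ "\<bar>L\<bar>"]) (auto simp: indicator_def)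
      qed
      have "integral\<^sup>L Q (\<lambda>t. H (\<phi> t)) = integral\<^sup>L Q (\<lambda>t. indicator V t * H (\<phi> t) + indicator (- V) t * L)"
        by (intro Bochner_Integration.integral_cong) (auto simp: H_def V_def)
      also have "\<dots> = integral\<^sup>L Q (\<lambda>t. indicator V t * H (\<phi> t)) + measure Q (- V) * L"
        using int by (subst Bochner_Integration.integral_add) auto
      finally have "a0 * integral\<^sup>L Q (\<lambda>t. H (\<phi> t)) = integral\<^sup>L Q (\<lambda>t. (a0 * indicator V t) * H (\<phi> t)) + c * L"
        by (simp add: c_def distrib_left mult.assoc)
      also have "integral\<^sup>L Q (\<lambda>t. (a0 * indicator V t) * H (\<phi> t)) = integral\<^sup>L Q (\<lambda>t. (a0 * indicator V t) * h (\<phi> t /\<^sub>R (1 - norm (\<phi> t))))"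
        by (intro Bochner_Integration.integral_cong) (auto simp: H_def V_def indicator_def)
      also have "\<dots> = (\<integral>x. h x \<partial>M)"
        unfolding M_def using mM a0 by (subst integral_distr) (auto simp: D_def integral_density)
      finally show ?thesis .
    qed
    finally show ?thesis .
  qed
  moreover have "strict_mono (s \<circ> r)" using s(1) r(1) by (rule strict_mono_o)
  moreover have "0 \<le> c" using a0 by (simp add: c_def)
  ultimately show ?thesis using that[of "s \<circ> r" M c] by (auto simp: M_def)
qed

section \<open>Equilibrium measures of compact sets\<close>

lemma filterlim_norm_diff_at_top: "filterlim (\<lambda>y. norm (x - y)) at_top (at_infinity :: 'a::real_normed_vector filter)"
proof (rule filterlim_at_top_mono)
  show "filterlim (\<lambda>y::'a. - norm x + norm y) at_top at_infinity"
    by (rule filterlim_tendsto_add_at_top[OF tendsto_const filterlim_norm_at_top])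
  show "eventually (\<lambda>y. - norm x + norm y \<le> norm (x - y)) at_infinity"
    using norm_triangle_ineq2[of _ x] by (intro always_eventually allI) (simp add: norm_minus_commute algebra_simps)
qed

lemma tendsto_heat_at_infinity:
  assumes "0 < t"
  shows "((\<lambda>y. heat t (x - y :: 'a::euclidean_space)) \<longlongrightarrow> 0) at_infinity"
proof -
  have "filterlim (\<lambda>y. norm (x - y)) at_top at_infinity" by (rule filterlim_norm_diff_at_top)
  then have "filterlim (\<lambda>y. 1 / (4 * t) * (norm (x - y))\<^sup>2) at_top at_infinity"
    using assms by (intro filterlim_tendsto_pos_mult_at_top[OF tendsto_const] filterlim_pow_at_top) auto
  then have "filterlim (\<lambda>y. (norm (x - y))\<^sup>2 / (4 * t)) at_top at_infinity" by simp
  then have "((\<lambda>y. exp (- ((norm (x - y))\<^sup>2 / (4 * t)))) \<longlongrightarrow> 0) at_infinity"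
    by (intro filterlim_compose[OF exp_at_bot] filterlim_uminus_at_bot_at_top[THEN filterlim_compose])
  then have "((\<lambda>y. (4 * pi * t) powr (- real DIM('a) / 2) * exp (- ((norm (x - y))\<^sup>2 / (4 * t)))) \<longlongrightarrow> (4 * pi * t) powr (- real DIM('a) / 2) * 0) at_infinity"
    by (intro tendsto_mult tendsto_const)
  then show ?thesis using assms by (simp add: heat_eq)
qed

lemma continuous_on_heat: "0 < t \<Longrightarrow> continuous_on UNIV (\<lambda>y. heat t (x - y :: 'a::euclidean_space))"
  by (simp add: heat_eq) (intro continuous_intros, auto)

lemma heat_le: "0 < t \<Longrightarrow> heat t (x :: 'a::euclidean_space) \<le> heat t (0::'a)"
  by (simp add: heat_eq mult_left_le)

lemma sfin_finite: "sets \<nu> = sets borel \<Longrightarrow> emeasure \<nu> UNIV < \<top> \<Longrightarrow> sfin \<nu>"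
proof -
  assume \<nu>: "sets \<nu> = sets borel" "emeasure \<nu> UNIV < \<top>"
  then have "space \<nu> = UNIV" using sets_eq_imp_space_eq by force
  then interpret finite_measure \<nu> using \<nu> by (intro finite_measureI) auto
  show ?thesis using \<nu> by (simp add: sfin_def sigma_finite_measure_axioms)
qed

lemma smear_eq_integral:
  assumes \<nu>: "sets \<nu> = sets borel" "emeasure \<nu> UNIV < \<top>" and t: "0 < t"
  shows "smear t \<nu> (\<lambda>_. 1) (x::'a::euclidean_space) = ennreal (\<integral>y. heat t (x - y) \<partial>\<nu>)"
proof -
  have "space \<nu> = UNIV" using \<nu> sets_eq_imp_space_eq by force
  then interpret finite_measure \<nu> using \<nu> by (intro finite_measureI) auto
  have "(\<lambda>y. heat t (x - y)) \<in> borel_measurable \<nu>" by (subst measurable_cong_sets[OF \<nu>(1) refl]) measurable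
  then have "integrable \<nu> (\<lambda>y. heat t (x - y))"
    using heat_le[OF t] by (intro integrable_const_bound[of _ "heat t (0::'a)"]) auto
  then show ?thesis unfolding smear_def by (simp add: nn_integral_eq_integral)
qed

definition locally_finite :: "'a::euclidean_space measure \<Rightarrow> bool" where
  "locally_finite \<nu> \<longleftrightarrow> (\<forall>K. compact K \<longrightarrow> emeasure \<nu> K < \<top>)"

lemma radon_measure_iff: "radon_measure \<nu> \<longleftrightarrow> sets \<nu> = sets borel \<and> locally_finite \<nu>"
  by (simp add: radon_measure_def locally_finite_def)

lemma sfin_radon:
  assumes "radon_measure (\<nu> :: 'a::euclidean_space measure)" shows "sfin \<nu>"
proof -
  have s: "sets \<nu> = sets borel" using assms by (simp add: radon_measure_def)
  have "sigma_finite_measure \<nu>"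
  proof (rule sigma_finite_measure.intro, intro exI conjI)
    show "countable (range (\<lambda>n::nat. cball (0::'a) (real n)))" by simp
    show "range (\<lambda>n::nat. cball (0::'a) (real n)) \<subseteq> sets \<nu>"
      by (rule image_subsetI) (simp add: s)
    show "\<Union> (range (\<lambda>n::nat. cball (0::'a) (real n))) = space \<nu>"
    proof -
      have "\<exists>n. norm x \<le> real n" for x :: 'a by (rule real_arch_simple)
      then show ?thesis by (auto simp: sets_eq_imp_space_eq[OF s])
    qed
    show "\<forall>a\<in>range (\<lambda>n::nat. cball (0::'a) (real n)). emeasure \<nu> a \<noteq> \<infinity>"
      using assms by (simp add: radon_measure_def less_top)
  qed
  then show ?thesis using s by (simp add: sfin_def)
qed

context riesz
begin

abbreviation self_energy :: "'a measure \<Rightarrow> ennreal" where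
  "self_energy \<nu> \<equiv> energy \<nu> (\<lambda>_. 1) \<nu> (\<lambda>_. 1)"

lemma mutual_energy_eq:
  assumes "sfin \<mu>" "sfin \<nu>"
  shows "mutual_energy \<alpha> \<mu> \<nu> = energy \<mu> (\<lambda>_. 1) \<nu> (\<lambda>_. 1)"
proof -
  interpret N: sigma_finite_measure \<nu> using assms by (simp add: sfin_sigma_finite)
  have s: "sets (\<mu> \<Otimes>\<^sub>M \<nu>) = sets (borel \<Otimes>\<^sub>M borel)"
    using assms by (auto simp: sfin_sets intro!: sets_pair_measure_cong)
  have "(\<lambda>p. riesz_kernel \<alpha> (fst p) (snd p :: 'a)) \<in> borel_measurable (borel \<Otimes>\<^sub>M borel)"
    unfolding riesz_kernel_eq by (intro borel_measurable_nn_integral_sfin) auto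
  then have "(\<lambda>(x, y). riesz_kernel \<alpha> x (y :: 'a)) \<in> borel_measurable (\<mu> \<Otimes>\<^sub>M \<nu>)"
    by (simp add: split_def measurable_cong_sets[OF s refl])
  from N.nn_integral_fst[OF this] show ?thesis
    unfolding mutual_energy_def energy_def pot_def using assms(2)
    by (simp add: potential_eq[symmetric] potential_def)
qed

lemma U_null [simp]: "U (null_measure borel) x = 0"
  by (simp add: pot_def mix_def smear_def)

lemma borel_sublevel:
  assumes K: "K \<in> sets borel" and [simp]: "sfin \<nu>"
  shows "{x \<in> K. U \<nu> x < c} \<in> sets borel"
proof -
  have "{x. U \<nu> x < c} \<in> sets borel" by measurable
  then have "K \<inter> {x. U \<nu> x < c} \<in> sets borel" using K by (rule sets.Int[rotated])
  then show ?thesis by (simp add: Int_def)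
qed

lemma U_scale:
  assumes [simp]: "sfin \<nu>"
  shows "U (density \<nu> (\<lambda>_. c)) x = c * U \<nu> x"
proof -
  have "smear t (density \<nu> (\<lambda>_. c)) (\<lambda>_. 1) x = c * smear t \<nu> (\<lambda>_. 1) x" for t
    unfolding smear_def by (subst nn_integral_density) (auto simp: sfin_measurable nn_integral_cmult)
  then show ?thesis unfolding pot_def mix_def by (simp add: nn_integral_cmult)
qed

text \<open>Supplies competitors for the capacity. The normalised restriction has potential at most
  c times that of \<rho>, where c is the inverse of the mass of B, and hence energy at most c^2
  times that of \<rho>.\<close>

lemma restrict_normalize:
  assumes [simp]: "sfin \<rho>" and B[measurable]: "B \<in> sets borel" and pos: "emeasure \<rho> B > 0" "emeasure \<rho> B < \<top>"
    and en: "self_energy \<rho> < \<top>"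
  obtains \<sigma> where "sets \<sigma> = sets borel" "emeasure \<sigma> UNIV = 1" "emeasure \<sigma> (- B) = 0" "AE x in \<sigma>. x \<in> B" "self_energy \<sigma> < \<top>"
proof -
  define c where "c = inverse (emeasure \<rho> B)"
  have c: "c < \<top>" "c * emeasure \<rho> B = 1"
    using pos ennreal_divide_self[of "emeasure \<rho> B"] unfolding c_def divide_ennreal_def
    by (auto simp: mult.commute ennreal_inverse_eq_top_iff less_top[symmetric] top.not_eq_extremum[symmetric])
  define \<sigma> where "\<sigma> = density \<rho> (\<lambda>x. c * indicator B x)"
  have m: "(\<lambda>x. c * indicator B x) \<in> borel_measurable \<rho>" by (simp add: sfin_measurable)
  have Bs: "B \<in> sets \<rho>" by (simp add: sfin_sets)
  have sets: "sets \<sigma> = sets borel" by (simp add: \<sigma>_def sfin_sets)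
  have int: "(\<integral>\<^sup>+x. f x \<partial>\<sigma>) = c * (\<integral>\<^sup>+x. indicator B x * f x \<partial>\<rho>)" if "f \<in> borel_measurable borel" for f
    unfolding \<sigma>_def using that m
    by (subst nn_integral_density) (auto simp: sfin_measurable mult.assoc nn_integral_cmult)
  have em: "emeasure \<sigma> X = c * emeasure \<rho> (B \<inter> X)" if [measurable]: "X \<in> sets borel" for X
  proof -
    have "emeasure \<sigma> X = (\<integral>\<^sup>+x. indicator X x \<partial>\<sigma>)" using that sets by simp
    also have "\<dots> = c * (\<integral>\<^sup>+x. indicator (B \<inter> X) x \<partial>\<rho>)"
      by (subst int) (auto intro!: arg_cong2[where f="(*)"] nn_integral_cong split: split_indicator)
    finally show ?thesis by (simp add: sfin_sets)
  qed
  have one: "emeasure \<sigma> UNIV = 1" using em[of UNIV] c by simp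
  have "U \<sigma> x \<le> c * U \<rho> x" for x
  proof -
    have "smear t \<sigma> (\<lambda>_. 1) x \<le> c * smear t \<rho> (\<lambda>_. 1) x" for t
      unfolding smear_def by (subst int) (auto intro!: mult_left_mono nn_integral_mono simp: indicator_def)
    then show ?thesis unfolding pot_def mix_def
      by (subst nn_integral_cmult[symmetric]) (auto intro!: nn_integral_mono)
  qed
  then have "self_energy \<sigma> \<le> (\<integral>\<^sup>+x. c * U \<rho> x \<partial>\<sigma>)"
    unfolding energy_def by (auto intro!: nn_integral_mono)
  also have "\<dots> = c * (\<integral>\<^sup>+x. indicator B x * (c * U \<rho> x) \<partial>\<rho>)" by (rule int) auto
  also have "\<dots> \<le> c * (\<integral>\<^sup>+x. c * U \<rho> x \<partial>\<rho>)"
    by (intro mult_left_mono nn_integral_mono) (auto simp: indicator_def)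
  also have "\<dots> = c * (c * self_energy \<rho>)"
    unfolding energy_def by (subst nn_integral_cmult) (auto simp: sfin_measurable)
  also have "\<dots> < \<top>" using c en by (simp add: ennreal_mult_less_top)
  finally have "self_energy \<sigma> < \<top>" .
  moreover have "emeasure \<sigma> (- B) = 0" using em[of "- B"] by simp
  moreover from this have "AE x in \<sigma>. x \<in> B"
    by (intro AE_I[of _ _ "- B"]) (auto simp: sets)
  ultimately show ?thesis using that sets one by blast
qed

section \<open>Minimisation of the energy on a compact set\<close>

definition test_measures :: "'a set \<Rightarrow> 'a measure set" where
  "test_measures K = {\<nu>. sets \<nu> = sets borel \<and> emeasure \<nu> UNIV = 1 \<and> emeasure \<nu> (- K) = 0 \<and> self_energy \<nu> < \<top>}"

lemma test_measures_sfin: "\<nu> \<in> test_measures K \<Longrightarrow> sfin \<nu>"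
  by (auto simp: test_measures_def intro: sfin_finite)

text \<open>In the half-time form of the energy the integrands converge as soon as the heat
  integrals do. Fatou's lemma is then applied first in space and afterwards in time.\<close>

lemma self_energy_liminf:
  fixes m :: "nat \<Rightarrow> 'a measure" and M :: "'a measure"
  assumes m: "\<And>n. sets (m n) = sets borel" "\<And>n. emeasure (m n) UNIV < \<top>"
    and M: "sets M = sets borel" "emeasure M UNIV < \<top>"
    and lim: "\<And>t z. 0 < t \<Longrightarrow> (\<lambda>n. \<integral>y. heat t (z - y) \<partial>m n) \<longlonglongrightarrow> (\<integral>y. heat t (z - y) \<partial>M)"
  shows "self_energy M \<le> liminf (\<lambda>n. self_energy (m n))"
proof -
  have [simp]: "sfin (m n)" "sfin M" for n using m M by (auto intro: sfin_finite)
  let ?s = "\<lambda>t \<nu>. smear (t / 2) \<nu> (\<lambda>_. 1)"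
  have "self_energy M = (\<integral>\<^sup>+t. \<integral>\<^sup>+z. ?s t M z * ?s t M z \<partial>lborel \<partial>prof UNIV)"
    by (simp add: energy_eq_half_heat)
  also have "\<dots> \<le> (\<integral>\<^sup>+t. liminf (\<lambda>n. \<integral>\<^sup>+z. ?s t (m n) z * ?s t (m n) z \<partial>lborel) \<partial>prof UNIV)"
  proof (rule nn_integral_mono_AE)
    have "AE t in prof UNIV. 0 < t" by (rule AE_prof_pos) simp
    then show "AE t in prof UNIV. (\<integral>\<^sup>+z. ?s t M z * ?s t M z \<partial>lborel) \<le> liminf (\<lambda>n. \<integral>\<^sup>+z. ?s t (m n) z * ?s t (m n) z \<partial>lborel)"
    proof eventually_elim
      case (elim t)
      have "(\<integral>\<^sup>+z. ?s t M z * ?s t M z \<partial>lborel) \<le> (\<integral>\<^sup>+z. liminf (\<lambda>n. ?s t (m n) z * ?s t (m n) z) \<partial>lborel)"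
      proof (rule nn_integral_mono)
        fix z
        let ?F = "\<lambda>\<nu>::'a measure. \<integral>y. heat (t / 2) (z - y) \<partial>\<nu>"
        have nn: "0 \<le> ?F \<nu>" for \<nu> :: "'a measure" by (intro Bochner_Integration.integral_nonneg) auto
        have "(\<lambda>n. ennreal (?F (m n) * ?F (m n))) \<longlonglongrightarrow> ennreal (?F M * ?F M)"
          using elim by (intro tendsto_ennrealI tendsto_mult lim) auto
        then have "(\<lambda>n. ?s t (m n) z * ?s t (m n) z) \<longlonglongrightarrow> ?s t M z * ?s t M z"
          using elim by (simp add: smear_eq_integral[OF m] smear_eq_integral[OF M] ennreal_mult'[symmetric] nn)
        then show "?s t M z * ?s t M z \<le> liminf (\<lambda>n. ?s t (m n) z * ?s t (m n) z)"
          by (simp add: lim_imp_Liminf)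
      qed
      also have "\<dots> \<le> liminf (\<lambda>n. \<integral>\<^sup>+z. ?s t (m n) z * ?s t (m n) z \<partial>lborel)"
        by (rule nn_integral_liminf) auto
      finally show ?case .
    qed
  qed
  also have "\<dots> \<le> liminf (\<lambda>n. \<integral>\<^sup>+t. \<integral>\<^sup>+z. ?s t (m n) z * ?s t (m n) z \<partial>lborel \<partial>prof UNIV)"
    by (rule nn_integral_liminf) (auto intro!: borel_measurable_nn_integral_sfin)
  also have "\<dots> = liminf (\<lambda>n. self_energy (m n))" by (simp add: energy_eq_half_heat)
  finally show ?thesis .
qed


lemma test_minimizer:
  assumes K: "compact K" and ne: "test_measures K \<noteq> {}"
  obtains \<nu> where "\<nu> \<in> test_measures K" "\<And>\<sigma>. \<sigma> \<in> test_measures K \<Longrightarrow> self_energy \<nu> \<le> self_energy \<sigma>"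
proof -
  define V where "V = (INF \<sigma>\<in>test_measures K. self_energy \<sigma>)"
  obtain \<sigma>0 where "\<sigma>0 \<in> test_measures K" using ne by blast
  then have Vfin: "V < \<top>" unfolding V_def by (auto simp: test_measures_def intro: le_less_trans[OF INF_lower])
  have "\<exists>\<sigma>\<in>test_measures K. self_energy \<sigma> < V + ennreal (1 / real (Suc n))" for n
  proof -
    have "V < V + ennreal (1 / real (Suc n))"
      using Vfin by (auto simp: ennreal_add_left_cancel_less[of V 0, simplified])
    then show ?thesis unfolding V_def INF_less_iff .
  qed
  then obtain \<sigma> where \<sigma>: "\<And>n. \<sigma> n \<in> test_measures K" "\<And>n. self_energy (\<sigma> n) < V + ennreal (1 / real (Suc n))"
    by metis
  have \<sigma>': "sets (\<sigma> n) = sets borel" "emeasure (\<sigma> n) UNIV = 1" "emeasure (\<sigma> n) (- K) = 0" for n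
    using \<sigma>(1)[of n] by (auto simp: test_measures_def)
  obtain r M c where r: "strict_mono r" and M: "sets M = sets borel" "finite_measure M" and c: "0 \<le> c"
    and lim: "\<And>h L. continuous_on UNIV h \<Longrightarrow> (h \<longlongrightarrow> L) at_infinity \<Longrightarrow>
      (\<lambda>n. \<integral>x. h x \<partial>\<sigma> (r n)) \<longlonglongrightarrow> (\<integral>x. h x \<partial>M) + c * (L::real)"
    using vague_compactness[of \<sigma>] \<sigma>' by (metis order_refl)
  interpret M: finite_measure M by (rule M)
  have spM: "space M = UNIV" using sets_eq_imp_space_eq[OF M(1)] by simp
  have finM: "emeasure M UNIV < \<top>" by (simp add: less_top[symmetric])
  have measM: "f \<in> borel_measurable borel \<Longrightarrow> f \<in> borel_measurable M" for f :: "'a \<Rightarrow> real"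
    by (subst measurable_cong_sets[OF M(1) refl])
  have sp\<sigma>: "space (\<sigma> n) = UNIV" for n using sets_eq_imp_space_eq[OF \<sigma>'(1)] by simp
  have ae\<sigma>: "AE x in \<sigma> n. x \<in> K" for n
    using \<sigma>'(3) K by (intro AE_I[of _ _ "- K"]) (auto simp: \<sigma>'(1) borel_compact borel_comp)
  have "K \<noteq> {}"
    using \<sigma>'(2,3)[of 0] by auto
  \<comment> \<open>This function vanishes on K and is 1 far away. Its integrals along the sequence
    are 0, so the limit shows at once that no mass escapes and that the limit measure lives on
    K.\<close>
  define h where "h x = min 1 (infdist x K)" for x
  have h: "continuous_on UNIV h" unfolding h_def by (intro continuous_intros)
  have h_lim: "(h \<longlongrightarrow> 1) at_infinity"
  proof (rule tendsto_eventually)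
    obtain b where b: "\<And>x. x \<in> K \<Longrightarrow> norm x \<le> b" using compact_imp_bounded[OF K] by (auto simp: bounded_iff)
    have "h x = 1" if "b + 1 \<le> norm x" for x
    proof -
      have "1 \<le> infdist x K" unfolding infdist_notempty[OF \<open>K \<noteq> {}\<close>]
      proof (rule cINF_greatest[OF \<open>K \<noteq> {}\<close>])
        fix y assume "y \<in> K"
        then show "1 \<le> dist x y" using that b[of y] norm_triangle_ineq2[of x y] by (simp add: dist_norm)
      qed
      then show ?thesis by (simp add: h_def)
    qed
    then show "eventually (\<lambda>x. h x = 1) at_infinity" unfolding eventually_at_infinity by blast
  qed
  have h0: "h x \<ge> 0" for x by (simp add: h_def infdist_nonneg)
  have "(\<integral>x. h x \<partial>\<sigma> n) = 0" for n
  proof -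
    have "AE x in \<sigma> n. h x = 0" using ae\<sigma>[of n] by eventually_elim (simp add: h_def)
    then show ?thesis by (rule integral_eq_zero_AE)
  qed
  with lim[OF h h_lim] have hc: "(\<integral>x. h x \<partial>M) + c = 0"
    by (simp add: LIMSEQ_const_iff)
  moreover have "(\<integral>x. h x \<partial>M) \<ge> 0" using h0 by simp
  ultimately have c0: "c = 0" and "(\<integral>x. h x \<partial>M) = 0" using c by auto
  moreover have "integrable M h"
    using h h0 by (intro M.integrable_const_bound[of _ 1] measM borel_measurable_continuous_onI) (auto simp: h_def)
  ultimately have "AE x in M. h x = 0" using h0 by (simp add: integral_nonneg_eq_0_iff_AE)
  then have "AE x in M. x \<in> K"
  proof eventually_elim
    case (elim x)
    then have "infdist x K = 0" by (simp add: h_def min_def split: if_splits)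
    then show ?case using in_closed_iff_infdist_zero[OF compact_imp_closed[OF K] \<open>K \<noteq> {}\<close>] by simp
  qed
  then have MK: "emeasure M (- K) = 0"
    using K by (subst (asm) AE_iff_measurable[of "- K"]) (auto simp: M(1) spM borel_compact borel_comp)
  have "(\<lambda>n. \<integral>x. 1 \<partial>\<sigma> (r n)) \<longlonglongrightarrow> (\<integral>x. 1 \<partial>M) + c * 1"
    by (rule lim) auto
  then have "measure M UNIV = 1"
    using c0 \<sigma>'(2) by (simp add: sp\<sigma> spM measure_def LIMSEQ_const_iff)
  then have M1: "emeasure M UNIV = 1" by (simp add: M.emeasure_eq_measure)
  have "self_energy M \<le> liminf (\<lambda>n. self_energy (\<sigma> (r n)))"
  proof (rule self_energy_liminf)
    fix t :: real and z :: 'a assume t: "0 < t"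
    show "(\<lambda>n. \<integral>y. heat t (z - y) \<partial>\<sigma> (r n)) \<longlonglongrightarrow> (\<integral>y. heat t (z - y) \<partial>M)"
      using lim[OF continuous_on_heat[OF t] tendsto_heat_at_infinity[OF t], of z] by simp
  qed (use \<sigma>' M finM in auto)
  also have "\<dots> \<le> liminf (\<lambda>n. V + ennreal (1 / real (Suc n)))"
  proof (rule Liminf_mono[OF always_eventually], rule allI)
    fix n
    have "self_energy (\<sigma> (r n)) \<le> V + ennreal (1 / real (Suc (r n)))" using \<sigma>(2) by (rule less_imp_le)
    also have "\<dots> \<le> V + ennreal (1 / real (Suc n))"
      using seq_suble[OF r, of n] by (intro add_left_mono ennreal_leI divide_left_mono) auto
    finally show "self_energy (\<sigma> (r n)) \<le> V + ennreal (1 / real (Suc n))" .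
  qed
  also have "\<dots> = V"
  proof (rule lim_imp_Liminf)
    have "(\<lambda>n. 1 / real (Suc n)) \<longlonglongrightarrow> 0" using LIMSEQ_Suc[OF lim_1_over_n] by simp
    then have "(\<lambda>n. V + ennreal (1 / real (Suc n))) \<longlonglongrightarrow> V + ennreal 0"
      by (intro tendsto_add tendsto_const tendsto_ennrealI)
    then show "(\<lambda>n. V + ennreal (1 / real (Suc n))) \<longlonglongrightarrow> V" by simp
  qed simp
  finally have E: "self_energy M \<le> V" .
  then have "M \<in> test_measures K" using M MK M1 Vfin by (auto simp: test_measures_def)
  moreover have "self_energy M \<le> self_energy \<sigma>" if "\<sigma> \<in> test_measures K" for \<sigma>
    using E INF_lower[OF that, of self_energy] by (simp add: V_def)
  ultimately show ?thesis by (rule that)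
qed

end

lemma AE_False_iff: "(AE x in M. False) \<longleftrightarrow> emeasure M (space M) = 0"
  by (simp add: eventually_False ae_filter_eq_bot_iff)

context riesz
begin

lemma test_measures_mixture:
  assumes \<nu>: "\<nu> \<in> test_measures K" and \<sigma>: "\<sigma> \<in> test_measures K" and K: "K \<in> sets borel" and s: "0 \<le> s" "s \<le> 1"
  obtains \<kappa> where "\<kappa> \<in> test_measures K"
    "self_energy \<kappa> = ennreal (s * s) * self_energy \<sigma> + ennreal (2 * (s * (1 - s))) * energy \<nu> (\<lambda>_. 1) \<sigma> (\<lambda>_. 1) + ennreal ((1 - s) * (1 - s)) * self_energy \<nu>"
proof -
  have [simp]: "sfin \<nu>" "sfin \<sigma>" by (rule test_measures_sfin[OF \<nu>], rule test_measures_sfin[OF \<sigma>])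
  have \<nu>': "sets \<nu> = sets borel" "emeasure \<nu> UNIV = 1" "emeasure \<nu> (- K) = 0" "self_energy \<nu> < \<top>"
    and \<sigma>': "sets \<sigma> = sets borel" "emeasure \<sigma> UNIV = 1" "emeasure \<sigma> (- K) = 0" "self_energy \<sigma> < \<top>"
    using \<nu> \<sigma> by (auto simp: test_measures_def)
  have pr: "prob_space \<nu>" "prob_space \<sigma>"
    by (rule prob_spaceI, simp add: sets_eq_imp_space_eq[OF \<nu>'(1)] \<nu>'(2))
      (rule prob_spaceI, simp add: sets_eq_imp_space_eq[OF \<sigma>'(1)] \<sigma>'(2))
  \<comment> \<open>The convex combination is realised as a random choice: a coin with bias s
    selects \<open>\<sigma>\<close>, and otherwise \<open>\<nu>\<close>.\<close>
  define N where "N b = (if b then \<sigma> else \<nu>)" for b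
  define \<kappa> where "\<kappa> = bind (measure_pmf (bernoulli_pmf s)) N"
  have N: "N \<in> measurable (measure_pmf (bernoulli_pmf s)) (subprob_algebra borel)"
  proof -
    have "N b \<in> space (subprob_algebra borel)" for b
      using \<nu>'(1) \<sigma>'(1) pr by (cases b) (simp_all add: N_def space_subprob_algebra prob_space_imp_subprob_space)
    then show ?thesis by (simp only: measurable_pmf_measure1 Pi_iff ball_UNIV simp_thms)
  qed
  have int: "(\<integral>\<^sup>+x. f x \<partial>\<kappa>) = ennreal s * (\<integral>\<^sup>+x. f x \<partial>\<sigma>) + ennreal (1 - s) * (\<integral>\<^sup>+x. f x \<partial>\<nu>)"
    if "f \<in> borel_measurable borel" for f
  proof -
    have "(\<integral>\<^sup>+x. f x \<partial>\<kappa>) = (\<integral>\<^sup>+b. \<integral>\<^sup>+x. f x \<partial>N b \<partial>measure_pmf (bernoulli_pmf s))"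
      unfolding \<kappa>_def by (rule nn_integral_bind[OF that N])
    also have "\<dots> = (\<integral>\<^sup>+x. f x \<partial>N True) * ennreal s + (\<integral>\<^sup>+x. f x \<partial>N False) * ennreal (1 - s)"
      using s by (subst nn_integral_bernoulli_pmf) simp_all
    also have "\<dots> = ennreal s * (\<integral>\<^sup>+x. f x \<partial>\<sigma>) + ennreal (1 - s) * (\<integral>\<^sup>+x. f x \<partial>\<nu>)"
      unfolding N_def by (simp only: if_True if_False mult.commute)
    finally show ?thesis .
  qed
  have sets: "sets \<kappa> = sets borel"
    unfolding \<kappa>_def by (rule sets_bind_measurable[OF N]) simp
  have em: "emeasure \<kappa> X = ennreal s * emeasure \<sigma> X + ennreal (1 - s) * emeasure \<nu> X" if "X \<in> sets borel" for X
    using int[of "indicator X"] that sets \<nu>'(1) \<sigma>'(1) by simp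
  have U: "U \<kappa> x = ennreal s * U \<sigma> x + ennreal (1 - s) * U \<nu> x" for x
  proof -
    have "smear t \<kappa> (\<lambda>_. 1) x = ennreal s * smear t \<sigma> (\<lambda>_. 1) x + ennreal (1 - s) * smear t \<nu> (\<lambda>_. 1) x" for t
      unfolding smear_def by (subst int) auto
    then show ?thesis unfolding pot_def mix_def
      by (simp add: nn_integral_add nn_integral_cmult)
  qed
  let ?b = "energy \<nu> (\<lambda>_. 1) \<sigma> (\<lambda>_. 1)"
  have comm: "energy \<sigma> (\<lambda>_. 1) \<nu> (\<lambda>_. 1) = ?b" by (rule energy_commute) auto
  have "self_energy \<kappa> = ennreal s * (\<integral>\<^sup>+x. ennreal s * U \<sigma> x + ennreal (1 - s) * U \<nu> x \<partial>\<sigma>) +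
      ennreal (1 - s) * (\<integral>\<^sup>+x. ennreal s * U \<sigma> x + ennreal (1 - s) * U \<nu> x \<partial>\<nu>)"
    unfolding energy_def U by (simp add: int)
  also have "\<dots> = ennreal s * (ennreal s * self_energy \<sigma> + ennreal (1 - s) * ?b) +
      ennreal (1 - s) * (ennreal s * ?b + ennreal (1 - s) * self_energy \<nu>)"
    using comm unfolding energy_def by (simp add: nn_integral_add nn_integral_cmult sfin_measurable)
  also have "\<dots> = ennreal (s * s) * self_energy \<sigma> + (ennreal (s * (1 - s)) * ?b + ennreal (s * (1 - s)) * ?b) + ennreal ((1 - s) * (1 - s)) * self_energy \<nu>"
    using s by (simp add: distrib_left ennreal_mult' ac_simps)
  also have "ennreal (s * (1 - s)) * ?b + ennreal (s * (1 - s)) * ?b = ennreal (2 * (s * (1 - s))) * ?b"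
    using s by (simp add: mult_2[symmetric] ennreal_mult' mult.assoc)
  finally have E: "self_energy \<kappa> = ennreal (s * s) * self_energy \<sigma> + ennreal (2 * (s * (1 - s))) * ?b + ennreal ((1 - s) * (1 - s)) * self_energy \<nu>" .
  have b: "?b < \<top>" using energy_finite[of \<nu> \<sigma> "\<lambda>_. 1" "\<lambda>_. 1"] \<nu>' \<sigma>' by simp
  have "emeasure \<kappa> UNIV = 1"
    using em[of UNIV] \<nu>' \<sigma>' s by (simp add: ennreal_plus[symmetric] del: ennreal_plus)
  moreover have "emeasure \<kappa> (- K) = 0" using em[of "- K"] \<nu>' \<sigma>' K by (simp add: borel_comp)
  moreover have "self_energy \<kappa> < \<top>" unfolding E using b \<nu>' \<sigma>' by (simp add: ennreal_mult_less_top)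
  ultimately have "\<kappa> \<in> test_measures K" using sets by (simp add: test_measures_def)
  then show ?thesis using that E by blast
qed

text \<open>First-order condition: moving from the minimiser towards \<open>\<sigma>\<close> by a
  small weight s cannot decrease the energy, and the part linear in s gives the inequality.\<close>

lemma test_minimizer_variation:
  assumes \<nu>: "\<nu> \<in> test_measures K" and min: "\<And>\<sigma>. \<sigma> \<in> test_measures K \<Longrightarrow> self_energy \<nu> \<le> self_energy \<sigma>"
    and \<sigma>: "\<sigma> \<in> test_measures K" and K: "K \<in> sets borel"
  shows "self_energy \<nu> \<le> energy \<nu> (\<lambda>_. 1) \<sigma> (\<lambda>_. 1)"
proof -
  let ?b = "energy \<nu> (\<lambda>_. 1) \<sigma> (\<lambda>_. 1)"
  have "?b < \<top>" "self_energy \<nu> < \<top>" "self_energy \<sigma> < \<top>"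
    using energy_finite[of \<nu> \<sigma> "\<lambda>_. 1" "\<lambda>_. 1"] \<nu> \<sigma> test_measures_sfin by (auto simp: test_measures_def)
  then obtain b v a where r: "?b = ennreal b" "self_energy \<nu> = ennreal v" "self_energy \<sigma> = ennreal a"
    and nn: "0 \<le> b" "0 \<le> v" "0 \<le> a"
    by (metis ennreal_cases infinity_ennreal_def less_irrefl)
  have q: "2 * v - 2 * b \<le> s * (a - 2 * b + v)" if s: "0 < s" "s \<le> 1" for s
  proof -
    obtain \<kappa> where \<kappa>: "\<kappa> \<in> test_measures K"
      "self_energy \<kappa> = ennreal (s * s) * self_energy \<sigma> + ennreal (2 * (s * (1 - s))) * ?b + ennreal ((1 - s) * (1 - s)) * self_energy \<nu>"
      using test_measures_mixture[OF \<nu> \<sigma> K] s by (metis less_imp_le)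
    have "ennreal v \<le> ennreal (s * s * a + 2 * (s * (1 - s)) * b + (1 - s) * (1 - s) * v)"
      using min[OF \<kappa>(1)] s nn unfolding \<kappa>(2) r by (simp add: ennreal_mult'[symmetric] ennreal_plus[symmetric] del: ennreal_plus)
    then have "v \<le> s * s * a + 2 * (s * (1 - s)) * b + (1 - s) * (1 - s) * v"
      using s nn by (subst (asm) ennreal_le_iff) auto
    then have "s * (2 * v - 2 * b) \<le> s * (s * (a - 2 * b + v))" by (simp add: algebra_simps)
    then show ?thesis using s by simp
  qed
  have "v \<le> b"
  proof (rule ccontr)
    assume "\<not> v \<le> b"
    then have pos: "0 < 2 * v - 2 * b" by simp
    define M where "M = \<bar>a - 2 * b + v\<bar> + (2 * v - 2 * b)"
    \<comment> \<open>Small enough that the quadratic term costs at most half of the assumed linear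
      gain.\<close>
    define s where "s = (2 * v - 2 * b) / (2 * M)"
    have M: "M > 0" using pos by (simp add: M_def add_nonneg_pos)
    have "2 * v - 2 * b \<le> M" by (simp add: M_def)
    then have "2 * v - 2 * b \<le> 2 * M" using M by linarith
    then have s: "0 < s" "s \<le> 1" using pos M unfolding s_def by simp_all
    have "s * (a - 2 * b + v) \<le> s * M" using s pos by (intro mult_left_mono) (auto simp: M_def)
    also have "\<dots> = (2 * v - 2 * b) / 2" using M by (simp add: s_def)
    finally have "2 * v - 2 * b \<le> (2 * v - 2 * b) / 2" using q[OF s] by (rule order_trans[rotated])
    with pos show False by simp
  qed
  then show ?thesis by (simp add: r ennreal_leI)
qed

text \<open>If B were charged, the normalised restriction to B would be a unit measure of the
  excluded kind. Statements about test measures on K thus extend to all locally finite measures of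
  finite energy.\<close>

lemma null_set_of_test:
  assumes \<rho>: "sfin \<rho>" "locally_finite \<rho>" "self_energy \<rho> < \<top>"
    and B: "B \<in> sets borel" "B \<subseteq> K" and K: "compact K"
    and no: "\<And>\<sigma>. \<sigma> \<in> test_measures K \<Longrightarrow> AE x in \<sigma>. x \<in> B \<Longrightarrow> False"
  shows "emeasure \<rho> B = 0"
proof (rule ccontr)
  assume "emeasure \<rho> B \<noteq> 0"
  then have pos: "emeasure \<rho> B > 0" by (simp add: zero_less_iff_neq_zero)
  have Kb: "K \<in> sets \<rho>" using K \<rho>(1) by (simp add: sfin_sets borel_compact)
  have "emeasure \<rho> B \<le> emeasure \<rho> K" using B Kb by (intro emeasure_mono)
  also have "\<dots> < \<top>" using \<rho>(2) K by (simp add: locally_finite_def)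
  finally obtain \<sigma> where \<sigma>: "sets \<sigma> = sets borel" "emeasure \<sigma> UNIV = 1" "emeasure \<sigma> (- B) = 0" "AE x in \<sigma>. x \<in> B" "self_energy \<sigma> < \<top>"
    using restrict_normalize[OF \<rho>(1) B(1) pos _ \<rho>(3)] by blast
  have "emeasure \<sigma> (- K) \<le> emeasure \<sigma> (- B)" using B \<sigma>(1) by (intro emeasure_mono) (auto intro: borel_comp)
  then have "\<sigma> \<in> test_measures K" using \<sigma> by (simp add: test_measures_def)
  then show False using no \<sigma>(4) by blast
qed

lemma U_pos:
  assumes \<nu>: "sets \<nu> = sets borel" "emeasure \<nu> UNIV \<noteq> 0"
    and fin: "sfin \<nu>"
  shows "U \<nu> x \<noteq> 0"
proof
  assume "U \<nu> x = 0"
  then have "AE t in prof UNIV. smear t \<nu> (\<lambda>_. 1) x = 0"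
    unfolding pot_def mix_def using fin by (subst (asm) nn_integral_0_iff_AE) auto
  moreover have "AE t in prof UNIV. 0 < t" by (rule AE_prof_pos) simp
  ultimately have "AE t in prof UNIV. False"
  proof eventually_elim
    case (elim t)
    then have "AE y in \<nu>. ennreal (heat t (x - y)) * 1 = 0"
      unfolding smear_def using fin by (subst (asm) nn_integral_0_iff_AE) (auto simp: sfin_measurable)
    then have "AE y in \<nu>. False"
      using heat_pos[OF elim(2)] by (auto simp: ennreal_eq_0_iff not_le[symmetric])
    then have "emeasure \<nu> (space \<nu>) = 0" by (simp add: AE_False_iff)
    then show ?case using \<nu> sets_eq_imp_space_eq[OF \<nu>(1)] by simp
  qed
  then have "emeasure (prof UNIV) UNIV = 0" by (simp add: AE_False_iff)
  moreover have "emeasure (prof UNIV) UNIV \<ge> mass 1"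
    using nn_integral_prof_mono[of "{..1}" UNIV "\<lambda>_. 1"] by (simp add: mass_def)
  ultimately show False using mass_pos[of 1] by simp
qed

text \<open>Frostman's argument. Let \<nu> minimise the energy, with value V. By variation its
  potential is at least V on K outside a set that measures of finite energy do not charge. Its mean
  with respect to \<nu> is V, so it equals V almost everywhere for \<nu>, and domination turns this
  into an upper bound everywhere. The equilibrium measure is \<nu> divided by V.\<close>

theorem equilibrium_compact:
  assumes K: "compact K"
  obtains \<gamma> where "sets \<gamma> = sets borel" "emeasure \<gamma> UNIV < \<top>" "emeasure \<gamma> (- K) = 0" "self_energy \<gamma> < \<top>"
    "\<And>x. U \<gamma> x \<le> 1"
    "\<And>\<rho>. sfin \<rho> \<Longrightarrow> locally_finite \<rho> \<Longrightarrow> self_energy \<rho> < \<top> \<Longrightarrow> emeasure \<rho> {x \<in> K. U \<gamma> x < 1} = 0"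
proof (cases "test_measures K = {}")
  case True
  \<comment> \<open>Here K carries no unit measure of finite energy, and the zero measure is the
    right choice.\<close>
  have "emeasure \<rho> {x \<in> K. U (null_measure borel) x < 1} = 0" if "sfin \<rho>" "locally_finite \<rho>" "self_energy \<rho> < \<top>" for \<rho>
    using that K True by (intro null_set_of_test[where K=K]) (auto simp: borel_compact)
  moreover have "self_energy (null_measure borel) = 0" by (simp add: energy_def)
  ultimately show ?thesis using that[of "null_measure borel"] by simp
next
  case False
  have Kb: "K \<in> sets borel" using K by (rule borel_compact)
  obtain \<nu> where \<nu>: "\<nu> \<in> test_measures K" and min: "\<And>\<sigma>. \<sigma> \<in> test_measures K \<Longrightarrow> self_energy \<nu> \<le> self_energy \<sigma>"
    using test_minimizer[OF K False] by blast
  have \<nu>': "sets \<nu> = sets borel" "emeasure \<nu> UNIV = 1" "emeasure \<nu> (- K) = 0" "self_energy \<nu> < \<top>"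
    using \<nu> by (auto simp: test_measures_def)
  have sf[simp]: "sfin \<nu>" using \<nu> by (rule test_measures_sfin)
  have sp: "space \<nu> = UNIV" using sets_eq_imp_space_eq[OF \<nu>'(1)] by simp
  define V where "V = self_energy \<nu>"
  have lf: "locally_finite \<nu>"
    unfolding locally_finite_def
  proof (intro allI impI)
    fix C :: "'a set" assume "compact C"
    have "emeasure \<nu> C \<le> emeasure \<nu> UNIV" using \<nu>'(1) by (intro emeasure_mono) auto
    then show "emeasure \<nu> C < \<top>" using \<nu>'(2) by (auto intro: le_less_trans)
  qed
  have Vpos: "V \<noteq> 0"
  proof
    assume "V = 0"
    then have "AE x in \<nu>. U \<nu> x = 0"
      unfolding V_def energy_def by (subst (asm) nn_integral_0_iff_AE) (auto simp: sfin_measurable)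
    then have "AE x in \<nu>. False" using U_pos[OF \<nu>'(1) _ sf] \<nu>'(2) by simp
    then show False using \<nu>'(2) sp by (simp add: AE_False_iff)
  qed
  have Vfin: "V < \<top>" using \<nu>' by (simp add: V_def)
  have low: "emeasure \<rho> {x \<in> K. U \<nu> x < V} = 0" if "sfin \<rho>" "locally_finite \<rho>" "self_energy \<rho> < \<top>" for \<rho>
  proof (rule null_set_of_test[OF that _ _ K])
    show "{x \<in> K. U \<nu> x < V} \<in> sets borel" using Kb sf by (rule borel_sublevel)
    fix \<sigma> assume \<sigma>: "\<sigma> \<in> test_measures K" "AE x in \<sigma>. x \<in> {x \<in> K. U \<nu> x < V}"
    have [simp]: "sfin \<sigma>" using \<sigma>(1) by (rule test_measures_sfin)
    have \<sigma>1: "sets \<sigma> = sets borel" "emeasure \<sigma> UNIV = 1" using \<sigma>(1) by (auto simp: test_measures_def)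
    have sp\<sigma>: "space \<sigma> = UNIV" using sets_eq_imp_space_eq[OF \<sigma>1(1)] by simp
    have ge: "V \<le> (\<integral>\<^sup>+x. U \<nu> x \<partial>\<sigma>)"
    proof -
      have "V \<le> energy \<nu> (\<lambda>_. 1) \<sigma> (\<lambda>_. 1)" unfolding V_def by (rule test_minimizer_variation[OF \<nu> min \<sigma>(1) Kb])
      also have "\<dots> = energy \<sigma> (\<lambda>_. 1) \<nu> (\<lambda>_. 1)" by (rule energy_commute) auto
      finally show ?thesis by (simp add: energy_def)
    qed
    have le: "AE x in \<sigma>. U \<nu> x \<le> V" using \<sigma>(2) by eventually_elim (auto intro: less_imp_le)
    have int: "(\<integral>\<^sup>+x. V \<partial>\<sigma>) = V" using \<sigma>1 sp\<sigma> by simp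
    have "(\<integral>\<^sup>+x. U \<nu> x \<partial>\<sigma>) \<le> V" using nn_integral_mono_AE[OF le] int by simp
    have "(\<integral>\<^sup>+x. U \<nu> x \<partial>\<sigma>) < (\<integral>\<^sup>+x. V \<partial>\<sigma>)"
    proof (rule nn_integral_less)
      show "\<not> (AE x in \<sigma>. V \<le> U \<nu> x)"
      proof
        assume "AE x in \<sigma>. V \<le> U \<nu> x"
        with \<sigma>(2) have "AE x in \<sigma>. False" by eventually_elim auto
        then show False using \<sigma>1 sp\<sigma> by (simp add: AE_False_iff)
      qed
      show "(\<integral>\<^sup>+x. U \<nu> x \<partial>\<sigma>) \<noteq> \<infinity>" using \<open>_ \<le> V\<close> Vfin by (auto simp: top_unique)
    qed (use le in \<open>auto simp: sfin_measurable\<close>)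
    then show False using ge int by simp
  qed auto
  have aeK: "AE x in \<nu>. x \<in> K"
    using \<nu>'(3) Kb by (intro AE_I[of _ _ "- K"]) (auto simp: \<nu>'(1) borel_comp)
  have ge: "AE x in \<nu>. V \<le> U \<nu> x"
  proof -
    have "{x \<in> K. U \<nu> x < V} \<in> sets borel" using Kb sf by (rule borel_sublevel)
    then have "AE x in \<nu>. x \<notin> {x \<in> K. U \<nu> x < V}"
      using low[OF sf lf \<nu>'(4)] \<nu>'(1) by (intro AE_not_in) (auto intro: null_setsI)
    with aeK show ?thesis by eventually_elim auto
  qed
  have le: "AE x in \<nu>. U \<nu> x \<le> V"
  proof (rule ccontr)
    assume "\<not> ?thesis"
    then have "(\<integral>\<^sup>+x. V \<partial>\<nu>) < (\<integral>\<^sup>+x. U \<nu> x \<partial>\<nu>)"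
      using ge Vfin \<nu>'(2) sp by (intro nn_integral_less) (auto simp: sfin_measurable)
    then show False using \<nu>'(2) sp by (simp add: V_def energy_def)
  qed
  define \<gamma> where "\<gamma> = density \<nu> (\<lambda>_. inverse V)"
  have iV: "inverse V < \<top>" "inverse V * V = 1"
    using Vpos Vfin ennreal_divide_self[of V] unfolding divide_ennreal_def
    by (auto simp: mult.commute less_top[symmetric])
  have U\<gamma>: "U \<gamma> x = inverse V * U \<nu> x" for x unfolding \<gamma>_def by (rule U_scale) simp
  have \<gamma>: "sets \<gamma> = sets borel" "emeasure \<gamma> UNIV < \<top>" "emeasure \<gamma> (- K) = 0"
    using \<nu>' iV Kb by (auto simp: \<gamma>_def emeasure_density_const borel_comp)
  have [simp]: "sfin \<gamma>" using \<gamma> by (intro sfin_finite)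
  have e\<gamma>: "self_energy \<gamma> < \<top>"
    unfolding energy_def U\<gamma> using \<nu>'(4) iV
    by (simp add: \<gamma>_def nn_integral_density sfin_measurable nn_integral_cmult energy_def ennreal_mult_less_top)
  have U1: "U \<gamma> x \<le> 1" for x
  proof -
    have "AE x in \<nu>. U \<gamma> x \<le> 1"
      using le
    proof eventually_elim
      case (elim x)
      then have "inverse V * U \<nu> x \<le> inverse V * V" by (intro mult_left_mono) auto
      then show ?case by (simp add: U\<gamma> iV)
    qed
    then have "AE x in \<gamma>. U \<gamma> x \<le> 1"
      by (subst \<gamma>_def, subst AE_density) auto
    then have "AE x in \<gamma>. U \<gamma> x \<le> U (null_measure borel) x + 1" by simp
    from domination[OF _ _ \<gamma>(2) e\<gamma> _ this] show ?thesis
      by (simp add: sfin_finite)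
  qed
  have "emeasure \<rho> {x \<in> K. U \<gamma> x < 1} = 0" if "sfin \<rho>" "locally_finite \<rho>" "self_energy \<rho> < \<top>" for \<rho>
  proof -
    have "U \<gamma> x < 1 \<longleftrightarrow> U \<nu> x < V" for x
    proof -
      have "inverse V * U \<nu> x < inverse V * V \<longleftrightarrow> U \<nu> x < V"
        using iV Vpos Vfin by (subst not_le[symmetric], subst ennreal_mult_le_mult_iff) (auto simp: not_le ennreal_inverse_eq_0_iff less_top)
      then show ?thesis by (simp add: U\<gamma> iV)
    qed
    then show ?thesis using low[OF that] by simp
  qed
  then show ?thesis using that[OF \<gamma> e\<gamma> U1] by blast
qed

end

section \<open>Limits of increasing potentials\<close>

lemma bounded_of_limit_at_infinity:
  fixes h :: "'a::euclidean_space \<Rightarrow> real"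
  assumes "continuous_on UNIV h" "(h \<longlongrightarrow> L) at_infinity"
  obtains B where "\<And>x. \<bar>h x\<bar> \<le> B"
proof -
  obtain R where R: "\<And>x. R \<le> norm x \<Longrightarrow> dist (h x) L < 1"
    using tendstoD[OF assms(2), of 1] by (auto simp: eventually_at_infinity)
  have "compact (h ` cball 0 R)" using assms(1) by (intro compact_continuous_image) (auto intro: continuous_on_subset)
  then have "bounded (h ` cball 0 R)" by (rule compact_imp_bounded)
  then obtain B where B: "\<And>x. x \<in> h ` cball 0 R \<Longrightarrow> norm x \<le> B" by (auto simp only: bounded_iff)
  have "\<bar>h x\<bar> \<le> max B (\<bar>L\<bar> + 1)" for x
  proof (cases "norm x \<le> R")
    case True
    then have "h x \<in> h ` cball 0 R" by (intro imageI) simp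
    from B[OF this] show ?thesis by simp
  next
    case False
    then have "\<bar>h x - L\<bar> < 1" using R[of x] by (simp add: dist_real_def)
    then show ?thesis by linarith
  qed
  then show ?thesis by (rule that)
qed

lemma tendsto_shifted_norm_ratio:
  "((\<lambda>y. norm (x - y) / (1 + norm y)) \<longlongrightarrow> 1) (at_infinity :: 'a::real_normed_vector filter)"
proof -
  have "((\<lambda>y. norm (x - y) / (1 + norm y) - 1) \<longlongrightarrow> 0) (at_infinity :: 'a filter)"
  proof (rule Lim_null_comparison)
    show "eventually (\<lambda>y. norm (norm (x - y) / (1 + norm y) - 1) \<le> (norm x + 1) / (1 + norm y)) at_infinity"
    proof (intro always_eventually allI)
      fix y :: 'a
      have p: "1 + norm y > 0" by (simp add: add_pos_nonneg)
      have "\<bar>norm (x - y) - norm y\<bar> \<le> norm x"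
        using norm_triangle_ineq3[of "x - y" "- y"] by simp
      then have "\<bar>norm (x - y) - (1 + norm y)\<bar> \<le> norm x + 1" by linarith
      moreover have "norm (x - y) / (1 + norm y) - 1 = (norm (x - y) - (1 + norm y)) / (1 + norm y)"
        using p by (simp add: field_simps)
      ultimately show "norm (norm (x - y) / (1 + norm y) - 1) \<le> (norm x + 1) / (1 + norm y)"
        using p by (simp add: divide_right_mono)
    qed
    have "filterlim (\<lambda>y::'a. 1 + norm y) at_top at_infinity"
      by (rule filterlim_tendsto_add_at_top[OF tendsto_const filterlim_norm_at_top])
    then show "((\<lambda>y. (norm x + 1) / (1 + norm y)) \<longlongrightarrow> 0) (at_infinity :: 'a filter)"
      by (intro tendsto_divide_0[OF tendsto_const] filterlim_at_top_imp_at_infinity)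
  qed
  then show ?thesis by (rule LIM_zero_cancel)
qed

section \<open>The truncated kernel at infinity\<close>

context riesz
begin

definition ktrunc :: "real \<Rightarrow> 'a \<Rightarrow> real" where
  "ktrunc d x = enn2real (\<integral>\<^sup>+t. ennreal (heat t x) \<partial>prof {d<..})"

lemma ktrunc_nonneg: "0 \<le> ktrunc d x" by (simp add: ktrunc_def)

lemma nn_integral_trunc_le: "0 < d \<Longrightarrow> (\<integral>\<^sup>+t. ennreal (heat t x) \<partial>prof {d<..}) \<le> trunc_bound d" for x :: 'a
proof -
  assume d: "0 < d"
  have "AE t in prof {d<..}. 0 < t" by (rule AE_prof_pos) simp
  then show ?thesis unfolding trunc_bound_def
    by (intro nn_integral_mono_AE) (auto elim!: eventually_mono intro!: ennreal_leI heat_le)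
qed

lemma ennreal_ktrunc:
  assumes "0 < d"
  shows "ennreal (ktrunc d x) = (\<integral>\<^sup>+t. ennreal (heat t x) \<partial>prof {d<..})"
  unfolding ktrunc_def
  using nn_integral_trunc_le[OF assms, of x] trunc_bound_finite[OF assms] by (intro ennreal_enn2real) (auto intro: le_less_trans)

lemma continuous_on_ktrunc:
  assumes d: "0 < d"
  shows "continuous_on UNIV (ktrunc d)"
proof -
  have "isCont (ktrunc d) x" for x
    unfolding continuous_at_sequentially
  proof (intro allI impI)
    fix X :: "nat \<Rightarrow> 'a" assume "X \<longlonglongrightarrow> x"
    have ae: "AE t in prof {d<..}. 0 < t" by (rule AE_prof_pos) simp
    have "(\<lambda>n. \<integral>\<^sup>+t. ennreal (heat t (X n)) \<partial>prof {d<..}) \<longlonglongrightarrow> (\<integral>\<^sup>+t. ennreal (heat t x) \<partial>prof {d<..})"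
    proof (rule nn_integral_dominated_convergence[where w="\<lambda>t. ennreal (heat t (0::'a))"])
      show "AE t in prof {d<..}. ennreal (heat t (X j)) \<le> ennreal (heat t (0::'a))" for j
        using ae by eventually_elim (auto intro!: ennreal_leI heat_le)
      show "(\<integral>\<^sup>+t. ennreal (heat t (0::'a)) \<partial>prof {d<..}) < \<infinity>"
        using trunc_bound_finite[OF d] by (simp add: trunc_bound_def)
      show "AE t in prof {d<..}. (\<lambda>i. ennreal (heat t (X i))) \<longlonglongrightarrow> ennreal (heat t x)"
        using ae
      proof eventually_elim
        case (elim t)
        then show ?case using \<open>X \<longlonglongrightarrow> x\<close> by (auto simp: heat_eq intro!: tendsto_intros)
      qed
    qed auto
    then have "(\<lambda>n. ennreal (ktrunc d (X n))) \<longlonglongrightarrow> ennreal (ktrunc d x)"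
      by (simp add: ennreal_ktrunc[OF d])
    then have "(\<lambda>n. enn2real (ennreal (ktrunc d (X n)))) \<longlonglongrightarrow> ktrunc d x"
      by (rule tendsto_enn2real) (rule ktrunc_nonneg)
    then show "((ktrunc d) \<circ> X) \<longlonglongrightarrow> ktrunc d x" by (simp add: o_def ktrunc_nonneg)
  qed
  then show ?thesis by (simp add: continuous_on_eq_continuous_at)
qed

lemma mix_trunc_eq:
  assumes "sfin \<nu>" "0 < d"
  shows "mix (prof {d<..}) \<nu> (\<lambda>_. 1) x = (\<integral>\<^sup>+y. ennreal (ktrunc d (x - y)) \<partial>\<nu>)"
  unfolding mix_def smear_def mult_1_right ennreal_ktrunc[OF assms(2)]
  using assms by (intro nn_integral_swap) auto

lemma ktrunc_upper:
  assumes "0 < d" "x \<noteq> 0"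
  shows "ktrunc d x \<le> norm x powr (\<alpha> - real DIM('a))"
proof -
  have "ennreal (ktrunc d x) \<le> (\<integral>\<^sup>+t. ennreal (heat t x) \<partial>prof UNIV)"
    unfolding ennreal_ktrunc[OF assms(1)] by (intro nn_integral_prof_mono) auto
  also have "\<dots> = ennreal (norm x powr (\<alpha> - real DIM('a)))" by (rule nn_integral_heat_prof_nz[OF assms(2)])
  finally show ?thesis by simp
qed

text \<open>The deleted small times are negligible far away. Passing from x to z = x / sqrt 2 splits
  the factor exp (- |x|^2 / (8 t)) off the heat kernel; for t \<le> d it is at most exp (- |x|^2 /
  (8 d)), and the rest integrates to at most the full kernel at z.\<close>

lemma ktrunc_lower:
  assumes d: "0 < d" and x: "x \<noteq> 0"
  shows "norm x powr (\<alpha> - real DIM('a)) * (1 - (1 / sqrt 2) powr (\<alpha> - real DIM('a)) * exp (- (norm x)\<^sup>2 / (8 * d))) \<le> ktrunc d x"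
proof -
  let ?p = "\<alpha> - real DIM('a)"
  let ?e = "exp (- (norm x)\<^sup>2 / (8 * d))"
  define z where "z = (1 / sqrt 2) *\<^sub>R x"
  have z: "z \<noteq> 0" "norm z = (1 / sqrt 2) * norm x" using x by (auto simp: z_def)
  have z2: "(norm z)\<^sup>2 = (norm x)\<^sup>2 / 2" unfolding z(2) by (simp add: power_mult_distrib power_divide)
  have "(\<integral>\<^sup>+t. ennreal (heat t x) \<partial>prof {..d}) \<le> (\<integral>\<^sup>+t. ennreal ?e * ennreal (heat t z) \<partial>prof {..d})"
  proof (rule nn_integral_mono_AE)
    have "AE t in prof {..d}. t \<in> {..d} \<and> 0 < t" by (rule AE_prof) simp
    then show "AE t in prof {..d}. ennreal (heat t x) \<le> ennreal ?e * ennreal (heat t z)"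
    proof eventually_elim
      case (elim t)
      then have t: "0 < t" "t \<le> d" by auto
      have "(norm x)\<^sup>2 / (8 * d) \<le> (norm x)\<^sup>2 / (8 * t)" using t d by (intro divide_left_mono) auto
      then have "exp (- (norm x)\<^sup>2 / (8 * t)) \<le> ?e" by simp
      moreover have "heat t x = heat t z * exp (- (norm x)\<^sup>2 / (8 * t))"
      proof -
        have "- (norm x)\<^sup>2 / (4 * t) = - (norm z)\<^sup>2 / (4 * t) + - (norm x)\<^sup>2 / (8 * t)"
          using t unfolding z2 by (simp add: field_simps)
        then show ?thesis using t by (simp only: heat_eq exp_add mult.assoc)
      qed
      ultimately have "heat t x \<le> ?e * heat t z" by (simp add: mult.commute mult_left_mono)
      then show ?case by (simp add: ennreal_mult'[symmetric])
    qed
  qed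
  also have "\<dots> = ennreal ?e * (\<integral>\<^sup>+t. ennreal (heat t z) \<partial>prof {..d})" by (subst nn_integral_cmult) auto
  also have "\<dots> \<le> ennreal ?e * (\<integral>\<^sup>+t. ennreal (heat t z) \<partial>prof UNIV)"
    by (intro mult_left_mono nn_integral_prof_mono) auto
  also have "\<dots> = ennreal (?e * norm z powr ?p)"
    by (simp add: nn_integral_heat_prof_nz[OF z(1)] ennreal_mult')
  finally have near: "(\<integral>\<^sup>+t. ennreal (heat t x) \<partial>prof {..d}) \<le> ennreal (?e * norm z powr ?p)" .
  have "ennreal (norm x powr ?p) = (\<integral>\<^sup>+t. ennreal (heat t x) \<partial>prof {..d}) + ennreal (ktrunc d x)"
    unfolding ennreal_ktrunc[OF d] nn_integral_heat_prof_nz[OF x, symmetric] by (rule nn_integral_prof_split) measurable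
  also have "\<dots> \<le> ennreal (?e * norm z powr ?p) + ennreal (ktrunc d x)" using near by (rule add_right_mono)
  also have "\<dots> = ennreal (?e * norm z powr ?p + ktrunc d x)" by (simp add: ktrunc_nonneg)
  finally have "norm x powr ?p \<le> ?e * norm z powr ?p + ktrunc d x"
    by (subst (asm) ennreal_le_iff) (simp_all add: ktrunc_nonneg)
  moreover have "norm z powr ?p = (1 / sqrt 2) powr ?p * norm x powr ?p" unfolding z(2) by (rule powr_mult)
  ultimately show ?thesis by (simp add: algebra_simps)
qed

lemma tendsto_ktrunc_ratio:
  assumes d: "0 < d"
  shows "((\<lambda>y. ktrunc d (x - y) * (1 + norm y) powr (real DIM('a) - \<alpha>)) \<longlongrightarrow> 1) at_infinity"
proof -
  let ?p = "\<alpha> - real DIM('a)"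
  let ?C = "(1 / sqrt 2) powr ?p"
  note inf = filterlim_norm_diff_at_top[of x]
  have ne: "eventually (\<lambda>y. x - y \<noteq> 0) at_infinity"
    using filterlim_at_top_dense[THEN iffD1, OF inf, rule_format, of 0] by eventually_elim auto
  have 1: "((\<lambda>y. ktrunc d (x - y) / norm (x - y) powr ?p) \<longlongrightarrow> 1) at_infinity"
  proof (rule tendsto_sandwich[where h="\<lambda>_. 1"])
    show "eventually (\<lambda>y. 1 - ?C * exp (- (norm (x - y))\<^sup>2 / (8 * d)) \<le> ktrunc d (x - y) / norm (x - y) powr ?p) at_infinity"
      using ne by eventually_elim (use ktrunc_lower[OF d] in \<open>simp add: pos_le_divide_eq mult.commute\<close>)
    show "eventually (\<lambda>y. ktrunc d (x - y) / norm (x - y) powr ?p \<le> 1) at_infinity"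
      using ne by eventually_elim (use ktrunc_upper[OF d] in \<open>simp add: pos_divide_le_eq\<close>)
    have "filterlim (\<lambda>y. 1 / (8 * d) * (norm (x - y))\<^sup>2) at_top at_infinity"
      using d by (intro filterlim_tendsto_pos_mult_at_top[OF tendsto_const] filterlim_pow_at_top inf) auto
    then have "filterlim (\<lambda>y. (norm (x - y))\<^sup>2 / (8 * d)) at_top at_infinity" by simp
    then have "((\<lambda>y. exp (- ((norm (x - y))\<^sup>2 / (8 * d)))) \<longlongrightarrow> 0) at_infinity"
      by (intro filterlim_compose[OF exp_at_bot] filterlim_uminus_at_bot_at_top[THEN filterlim_compose])
    then have "((\<lambda>y. 1 - ?C * exp (- ((norm (x - y))\<^sup>2 / (8 * d)))) \<longlongrightarrow> 1 - ?C * 0) at_infinity"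
      by (intro tendsto_intros)
    then show "((\<lambda>y. 1 - ?C * exp (- (norm (x - y))\<^sup>2 / (8 * d))) \<longlongrightarrow> 1) at_infinity" by simp
  qed (rule tendsto_const)
  have 2: "((\<lambda>y. (norm (x - y) / (1 + norm y)) powr ?p) \<longlongrightarrow> 1 powr ?p) at_infinity"
    by (intro tendsto_powr tendsto_shifted_norm_ratio tendsto_const) simp
  have "((\<lambda>y. ktrunc d (x - y) / norm (x - y) powr ?p * (norm (x - y) / (1 + norm y)) powr ?p) \<longlongrightarrow> 1 * 1 powr ?p) at_infinity"
    by (rule tendsto_mult[OF 1 2])
  moreover have "eventually (\<lambda>y. ktrunc d (x - y) / norm (x - y) powr ?p * (norm (x - y) / (1 + norm y)) powr ?p =
      ktrunc d (x - y) * (1 + norm y) powr (real DIM('a) - \<alpha>)) at_infinity"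
    using ne
  proof eventually_elim
    case (elim y)
    have "(norm (x - y) / (1 + norm y)) powr ?p = norm (x - y) powr ?p / (1 + norm y) powr ?p" by (rule powr_divide)
    moreover have "1 / (1 + norm y) powr ?p = (1 + norm y) powr (real DIM('a) - \<alpha>)"
      using powr_minus_divide[of "1 + norm y" ?p] by simp
    moreover have "ktrunc d (x - y) / norm (x - y) powr ?p * (norm (x - y) powr ?p / (1 + norm y) powr ?p) =
        ktrunc d (x - y) * (1 / (1 + norm y) powr ?p)"
      using elim by simp
    ultimately show ?case by (simp only:)
  qed
  ultimately show ?thesis by (subst (asm) tendsto_cong) simp_all
qed

text \<open>The measures are compared after multiplication by \<open>(1 + norm y) powr (\<alpha> - n)\<close>: relative to this weight every
  truncated kernel tends to \<open>1\<close> at infinity, so that the escaping mass contributes the same constant at all points.\<close>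

lemma limit_of_potentials:
  fixes m :: "nat \<Rightarrow> 'a measure"
  assumes m: "\<And>n. sets (m n) = sets borel" "\<And>n. emeasure (m n) UNIV < \<top>"
    and U1: "\<And>n x. U (m n) x \<le> 1" and inc: "\<And>n x. U (m n) x \<le> U (m (Suc n)) x"
  obtains \<gamma> c where "radon_measure \<gamma>" "0 \<le> c" "\<And>x. (SUP n. U (m n) x) = U \<gamma> x + ennreal c"
proof -
  let ?q = "real DIM('a) - \<alpha>"
  have [simp]: "sfin (m n)" for n using m by (rule sfin_finite)
  define w where "w y = (1 + norm y) powr (- ?q)" for y :: 'a
  define w' where "w' y = (1 + norm y) powr ?q" for y :: 'a
  have ww: "w y * w' y = 1" "0 < w y" "0 < w' y" for y
    using add_pos_nonneg[of 1 "norm y"] unfolding w_def w'_def by (auto simp: powr_add[symmetric])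
  have [measurable]: "w \<in> borel_measurable borel" "w' \<in> borel_measurable borel" unfolding w_def w'_def by measurable
  have wc: "continuous_on UNIV w'" unfolding w'_def
    by (intro continuous_intros) (auto simp: add_pos_nonneg less_imp_neq[symmetric])
  define M where "M n = density (m n) (\<lambda>y. ennreal (w y))" for n
  have setsM: "sets (M n) = sets borel" for n by (simp add: M_def m)
  \<comment> \<open>The weight w lies below the Riesz kernel at the origin, so the weighted mass is
    at most the potential there. The measures themselves may have unbounded masses.\<close>
  have massM: "emeasure (M n) UNIV \<le> 1" for n
  proof -
    have "emeasure (M n) UNIV = (\<integral>\<^sup>+y. ennreal (w y) \<partial>m n)"
      unfolding M_def by (subst emeasure_density) (auto simp: sfin_measurable m)
    also have "\<dots> \<le> (\<integral>\<^sup>+y. riesz_kernel \<alpha> 0 y \<partial>m n)"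
    proof (rule nn_integral_mono)
      fix y
      have "w y \<le> norm y powr (\<alpha> - real DIM('a))" if "y \<noteq> 0"
        using that \<alpha>_less powr_mono2'[of "\<alpha> - real DIM('a)" "norm y" "1 + norm y"] by (simp add: w_def)
      then show "ennreal (w y) \<le> riesz_kernel \<alpha> 0 y" by (auto simp: riesz_kernel_def intro: ennreal_leI)
    qed
    also have "\<dots> = U (m n) 0" by (simp add: potential_eq[symmetric] potential_def pot_def)
    finally show ?thesis using U1[of n 0] by simp
  qed
  obtain r N c where r: "strict_mono r" and N: "sets N = sets borel" "finite_measure N" and c: "0 \<le> c"
    and lim: "\<And>h L. continuous_on UNIV h \<Longrightarrow> (h \<longlongrightarrow> L) at_infinity \<Longrightarrow>
      (\<lambda>n. \<integral>x. h x \<partial>M (r n)) \<longlonglongrightarrow> (\<integral>x. h x \<partial>N) + c * (L::real)"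
    by (rule vague_compactness[OF setsM massM]) (rule that; assumption)
  interpret N: finite_measure N by (rule N)
  have measN: "f \<in> borel_measurable borel \<Longrightarrow> f \<in> borel_measurable N" for f :: "'a \<Rightarrow> 'c::topological_space"
    by (subst measurable_cong_sets[OF N(1) refl])
  define \<gamma> where "\<gamma> = density N (\<lambda>y. ennreal (w' y))"
  have sets\<gamma>: "sets \<gamma> = sets borel" by (simp add: \<gamma>_def N)
  have radon: "radon_measure \<gamma>"
    unfolding radon_measure_def
  proof (intro conjI allI impI sets\<gamma>)
    fix K :: "'a set" assume K: "compact K"
    obtain b where b: "\<And>x. x \<in> K \<Longrightarrow> norm x \<le> b" using compact_imp_bounded[OF K] by (auto simp: bounded_iff)
    have Ks: "K \<in> sets N" using K N(1) by (simp add: borel_compact)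
    have "emeasure \<gamma> K = (\<integral>\<^sup>+y. ennreal (w' y) * indicator K y \<partial>N)"
      unfolding \<gamma>_def using Ks by (subst emeasure_density) (auto intro: measN)
    also have "\<dots> \<le> (\<integral>\<^sup>+y. ennreal ((1 + b) powr ?q) \<partial>N)"
      using b \<alpha>_less by (intro nn_integral_mono) (auto simp: w'_def indicator_def intro!: ennreal_leI powr_mono2)
    also have "\<dots> < \<infinity>"
      using N.emeasure_finite[of "space N"] by (auto simp: less_top[symmetric] ennreal_mult_eq_top_iff)
    finally show "emeasure \<gamma> K < \<infinity>" .
  qed
  have [simp]: "sfin \<gamma>" using radon by (rule sfin_radon)
  have trunc: "(SUP n. mix (prof {d<..}) (m n) (\<lambda>_. 1) x) = mix (prof {d<..}) \<gamma> (\<lambda>_. 1) x + ennreal c" if d: "0 < d" for d x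
  proof -
    define h where "h y = ktrunc d (x - y) * w' y" for y
    have hc: "continuous_on UNIV h"
      unfolding h_def by (intro continuous_intros wc continuous_on_compose2[OF continuous_on_ktrunc[OF d]]) auto
    have hl: "(h \<longlongrightarrow> 1) at_infinity" unfolding h_def w'_def by (rule tendsto_ktrunc_ratio[OF d])
    have hm[measurable]: "h \<in> borel_measurable borel" using hc by (rule borel_measurable_continuous_onI)
    have hn: "0 \<le> h y" for y unfolding h_def using ww(3)[of y] by (simp add: ktrunc_nonneg)
    obtain B where B: "\<And>y. \<bar>h y\<bar> \<le> B" using bounded_of_limit_at_infinity[OF hc hl] by blast
    have kt: "ktrunc d (x - y) = w y * h y" for y using ww(1)[of y] by (simp add: h_def mult.left_commute)
    have intN: "ennreal (\<integral>y. h y \<partial>N) = mix (prof {d<..}) \<gamma> (\<lambda>_. 1) x"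
    proof -
      have "integrable N h" using B by (intro N.integrable_const_bound[of _ B] measN hm) auto
      then have "ennreal (\<integral>y. h y \<partial>N) = (\<integral>\<^sup>+y. ennreal (h y) \<partial>N)" using hn by (simp add: nn_integral_eq_integral)
      also have "\<dots> = (\<integral>\<^sup>+y. ennreal (w' y) * ennreal (ktrunc d (x - y)) \<partial>N)"
        using ww(3) by (intro nn_integral_cong) (simp add: h_def mult.commute ennreal_mult'[symmetric] less_imp_le)
      also have "\<dots> = (\<integral>\<^sup>+y. ennreal (ktrunc d (x - y)) \<partial>\<gamma>)"
      proof -
        have "(\<lambda>y. ktrunc d (x - y)) \<in> borel_measurable borel"
          by (intro borel_measurable_continuous_onI continuous_on_compose2[OF continuous_on_ktrunc[OF d]] continuous_intros) auto
        then show ?thesis unfolding \<gamma>_def by (subst nn_integral_density) (auto intro!: measN)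
      qed
      finally show ?thesis using d by (simp add: mix_trunc_eq)
    qed
    have intM: "ennreal (\<integral>y. h y \<partial>M n) = mix (prof {d<..}) (m n) (\<lambda>_. 1) x" for n
    proof -
      interpret Mn: finite_measure "M n"
        using massM[of n] sets_eq_imp_space_eq[OF setsM[of n]] by (intro finite_measureI) (auto simp: top_unique)
      have hmM: "h \<in> borel_measurable (M n)" by (subst measurable_cong_sets[OF setsM refl]) (rule hm)
      have "integrable (M n) h" using B hmM by (intro Mn.integrable_const_bound[of _ B]) auto
      then have "ennreal (\<integral>y. h y \<partial>M n) = (\<integral>\<^sup>+y. ennreal (h y) \<partial>M n)" using hn by (simp add: nn_integral_eq_integral)
      also have "\<dots> = (\<integral>\<^sup>+y. ennreal (w y) * ennreal (h y) \<partial>m n)"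
        unfolding M_def by (subst nn_integral_density) (auto simp: sfin_measurable)
      also have "\<dots> = (\<integral>\<^sup>+y. ennreal (ktrunc d (x - y)) \<partial>m n)"
        using ww(2) by (intro nn_integral_cong) (simp add: kt ennreal_mult'[symmetric] less_imp_le)
      finally show ?thesis using d by (simp add: mix_trunc_eq)
    qed
    have "(\<lambda>n. ennreal (\<integral>y. h y \<partial>M (r n))) \<longlonglongrightarrow> ennreal ((\<integral>y. h y \<partial>N) + c * 1)"
      by (intro tendsto_ennrealI lim hc hl)
    also have "ennreal ((\<integral>y. h y \<partial>N) + c * 1) = mix (prof {d<..}) \<gamma> (\<lambda>_. 1) x + ennreal c"
      using c hn by (simp add: intN[symmetric] ennreal_plus)
    finally have A: "(\<lambda>n. mix (prof {d<..}) (m (r n)) (\<lambda>_. 1) x) \<longlonglongrightarrow> mix (prof {d<..}) \<gamma> (\<lambda>_. 1) x + ennreal c"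
      by (simp add: intM)
    \<comment> \<open>Truncation is averaging, so the truncated potentials increase with n. The
      limit along the subsequence is therefore the supremum of the whole sequence.\<close>
    have "incseq (\<lambda>n. mix (prof {d<..}) (m n) (\<lambda>_. 1) x)"
    proof (rule incseq_SucI)
      fix n
      have eq: "mix (prof {d<..}) (m n) (\<lambda>_. 1) x = smooth d (U (m n)) x" for n
        unfolding pot_def using d by (simp add: mix_eta_prof)
      show "mix (prof {d<..}) (m n) (\<lambda>_. 1) x \<le> mix (prof {d<..}) (m (Suc n)) (\<lambda>_. 1) x"
        unfolding eq by (intro mix_mono inc)
    qed
    then have "(\<lambda>n. mix (prof {d<..}) (m n) (\<lambda>_. 1) x) \<longlonglongrightarrow> (SUP n. mix (prof {d<..}) (m n) (\<lambda>_. 1) x)"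
      by (rule LIMSEQ_SUP)
    from LIMSEQ_subseq_LIMSEQ[OF this r] show ?thesis
      using A by (auto simp: o_def intro: LIMSEQ_unique)
  qed
  have "(SUP n. U (m n) x) = U \<gamma> x + ennreal c" for x
  proof -
    \<comment> \<open>The truncation is removed by exchanging two suprema, which works because c is
      the same for every cutoff.\<close>
    have "(SUP n. U (m n) x) = (SUP n. SUP k. mix (prof {1 / real (Suc k)<..}) (m n) (\<lambda>_. 1) x)"
      by (simp only: pot_SUP_trunc[OF \<open>sfin (m _)\<close>])
    also have "\<dots> = (SUP k. SUP n. mix (prof {1 / real (Suc k)<..}) (m n) (\<lambda>_. 1) x)"
      by (rule SUP_commute)
    also have "\<dots> = (SUP k. mix (prof {1 / real (Suc k)<..}) \<gamma> (\<lambda>_. 1) x + ennreal c)"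
      by (intro SUP_cong refl trunc) simp
    also have "\<dots> = U \<gamma> x + ennreal c"
      by (simp add: ennreal_SUP_add_left pot_SUP_trunc del: of_nat_Suc)
    finally show ?thesis .
  qed
  then show ?thesis using that radon c by blast
qed

end

section \<open>The inner equilibrium measure\<close>

text \<open>Superlevel sets of lower semicontinuous functions are open. For each rational level
  Lindelof's theorem selects countably many indices with the same union, and the rational levels
  determine the supremum.\<close>

lemma countable_SUP_lsc:
  fixes f :: "'i \<Rightarrow> 'a::{metric_space, second_countable_topology} \<Rightarrow> ennreal"
  assumes lsc: "\<And>i. i \<in> I \<Longrightarrow> seq_lsc (f i)"
  obtains J where "J \<subseteq> I" "countable J" "\<And>x. (SUP i\<in>I. f i x) = (SUP i\<in>J. f i x)"
proof -
  have op: "open {x. q < f i x}" if "i \<in> I" for q i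
  proof -
    have "closed {x. f i x \<le> q}"
      unfolding closed_sequential_limits
    proof (intro allI impI)
      fix X l assume X: "(\<forall>n. X n \<in> {x. f i x \<le> q}) \<and> X \<longlonglongrightarrow> l"
      have "f i l \<le> liminf (\<lambda>n. f i (X n))" using lsc[OF that] X by (auto simp: seq_lsc_def)
      also have "\<dots> \<le> liminf (\<lambda>n. q)" using X by (intro Liminf_mono always_eventually) auto
      also have "\<dots> = q" by (simp add: Liminf_const)
      finally show "l \<in> {x. f i x \<le> q}" by simp
    qed
    moreover have "{x. q < f i x} = - {x. f i x \<le> q}" by auto
    ultimately show ?thesis by auto
  qed
  have "\<exists>J\<subseteq>I. countable J \<and> (\<Union>i\<in>J. {x. q < f i x}) = (\<Union>i\<in>I. {x. q < f i x})" for q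
  proof -
    obtain F where F: "F \<subseteq> (\<lambda>i. {x. q < f i x}) ` I" "countable F" "\<Union>F = \<Union>((\<lambda>i. {x. q < f i x}) ` I)"
      using Lindelof[of "(\<lambda>i. {x. q < f i x}) ` I"] op by blast
    obtain J where "J \<subseteq> I" "countable J" "F = (\<lambda>i. {x. q < f i x}) ` J"
      using F(1,2) countable_subset_image[of F "\<lambda>i. {x. q < f i x}" I] by auto
    then show ?thesis using F(3) by auto
  qed
  then obtain J where J: "\<And>q. J q \<subseteq> I" "\<And>q. countable (J q)"
    "\<And>q. (\<Union>i\<in>J q. {x. q < f i x}) = (\<Union>i\<in>I. {x. q < f i x})" by metis
  define K where "K = (\<Union>r::rat. J (ennreal (real_of_rat r)))"
  have "K \<subseteq> I" "countable K" using J(1,2) by (auto simp: K_def)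
  moreover have "(SUP i\<in>I. f i x) = (SUP i\<in>K. f i x)" for x
  proof (rule antisym)
    show "(SUP i\<in>K. f i x) \<le> (SUP i\<in>I. f i x)" using \<open>K \<subseteq> I\<close> by (rule SUP_subset_mono) simp
    show "(SUP i\<in>I. f i x) \<le> (SUP i\<in>K. f i x)"
    proof (rule SUP_least, rule ccontr)
      fix i assume i: "i \<in> I" and "\<not> f i x \<le> (SUP i\<in>K. f i x)"
      then obtain r :: rat where r: "(SUP i\<in>K. f i x) < real_of_rat r" "real_of_rat r < f i x"
        using ennreal_rat_dense[of "SUP i\<in>K. f i x" "f i x"] by (auto simp: not_le)
      then have "x \<in> (\<Union>i\<in>J (ennreal (real_of_rat r)). {x. ennreal (real_of_rat r) < f i x})"
        using J(3)[of "ennreal (real_of_rat r)"] i by auto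
      then obtain j where "j \<in> J (ennreal (real_of_rat r))" "ennreal (real_of_rat r) < f j x" by auto
      then have "ennreal (real_of_rat r) < (SUP i\<in>K. f i x)"
        by (intro less_le_trans[OF _ SUP_upper[of j]]) (auto simp: K_def)
      then show False using r by simp
    qed
  qed
  ultimately show ?thesis by (rule that)
qed

section \<open>Carried measures, inner capacity and projections\<close>

lemma carried_by_subset:
  assumes "K \<subseteq> Q" "sets \<nu> = sets borel" "K \<in> sets borel" "emeasure \<nu> (- K) = 0"
  shows "carried_by \<nu> Q"
proof -
  have "- K \<in> null_sets (completion \<nu>)"
    using assms by (intro null_sets_completionI null_setsI) (auto intro: borel_comp)
  then have n: "- Q \<in> null_sets (completion \<nu>)"
    by (rule null_sets_completion_subset[rotated]) (use assms(1) in auto)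
  then have "space (completion \<nu>) - (- Q) \<in> sets (completion \<nu>)" by (intro sets.compl_sets) auto
  moreover have "space (completion \<nu>) = UNIV" using sets_eq_imp_space_eq[OF assms(2)] by simp
  ultimately show ?thesis using n by (simp add: carried_by_def Diff_eq)
qed

context riesz
begin

lemma pos_measures_sfin: "\<nu> \<in> pos_measures \<alpha> \<Longrightarrow> sfin \<nu>"
  by (auto simp: pos_measures_def intro: sfin_radon)

lemma potential_U: "sfin \<nu> \<Longrightarrow> potential \<alpha> \<nu> x = U \<nu> x"
  by (simp add: potential_eq pot_def)

lemma finite_pos_energy:
  assumes \<nu>: "sets \<nu> = sets borel" "emeasure \<nu> UNIV < \<top>" and en: "self_energy \<nu> < \<top>"
  shows "\<nu> \<in> pos_energy \<alpha>"
proof -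
  have [simp]: "sfin \<nu>" using \<nu> by (rule sfin_finite)
  have sp: "space \<nu> = UNIV" using sets_eq_imp_space_eq[OF \<nu>(1)] by simp
  have "emeasure \<nu> K < \<top>" if "compact K" for K
    using \<nu> emeasure_mono[of K UNIV \<nu>] by (auto intro: le_less_trans)
  then have "radon_measure \<nu>" using \<nu>(1) by (simp add: radon_measure_def)
  moreover have "\<exists>x. U \<nu> x \<noteq> \<infinity>"
  proof (rule ccontr)
    assume "\<not> ?thesis"
    then have inf: "U \<nu> x = \<top>" for x by simp
    then have "self_energy \<nu> = \<top> * emeasure \<nu> UNIV" by (simp add: energy_def sp)
    then have z: "emeasure \<nu> UNIV = 0" using en by (cases "emeasure \<nu> UNIV = 0") (auto simp: ennreal_top_mult)
    have "AE y in \<nu>. False" using z sp by (simp add: AE_False_iff)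
    then have "smear t \<nu> (\<lambda>_. 1) x = 0" for t x
      unfolding smear_def by (subst nn_integral_0_iff_AE) (auto simp: sfin_measurable)
    then have "U \<nu> x = 0" for x by (simp add: pot_def mix_def)
    then show False using inf by simp
  qed
  ultimately show ?thesis
    using en by (simp add: pos_energy_def pos_measures_def potential_U mutual_energy_eq)
qed

lemma capacity_zeroD:
  assumes "inner_capacity \<alpha> (Q :: 'a set) = 0" "\<sigma> \<in> pos_energy_on \<alpha> Q" "emeasure \<sigma> UNIV = 1"
  shows False
proof -
  let ?I = "INF \<nu> \<in> {\<nu> \<in> pos_energy_on \<alpha> Q. emeasure \<nu> UNIV = 1}. mutual_energy \<alpha> \<nu> \<nu>"
  have "?I = \<top>" using assms(1) by (simp add: inner_capacity_def)
  moreover have "?I \<le> mutual_energy \<alpha> \<sigma> \<sigma>" using assms(2,3) by (intro INF_lower) auto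
  moreover have "mutual_energy \<alpha> \<sigma> \<sigma> < \<top>" using assms(2) by (auto simp: pos_energy_on_def pos_energy_def)
  ultimately show False by simp
qed

lemma capacity_zeroI:
  assumes "\<And>\<sigma>. \<sigma> \<in> pos_energy_on \<alpha> (Q :: 'a set) \<Longrightarrow> emeasure \<sigma> UNIV = 1 \<Longrightarrow> False"
  shows "inner_capacity \<alpha> Q = 0"
proof -
  have "{\<nu> \<in> pos_energy_on \<alpha> Q. emeasure \<nu> UNIV = 1} = {}" using assms by blast
  then show ?thesis unfolding inner_capacity_def by (simp only: INF_empty) simp
qed

text \<open>Passes from a possibly non-Borel set to compact ones: measurability for the completion
  yields a Borel part of full measure, and inner regularity does the rest.\<close>

lemma carried_by_compact:
  assumes \<sigma>: "sets \<sigma> = sets borel" "emeasure \<sigma> UNIV = 1" and Q: "carried_by \<sigma> (Q :: 'a set)"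
  obtains K where "compact K" "K \<subseteq> Q" "emeasure \<sigma> K > 0"
proof -
  have sp: "space \<sigma> = UNIV" using sets_eq_imp_space_eq[OF \<sigma>(1)] by simp
  have Qs: "Q \<in> sets (completion \<sigma>)" and Qn: "- Q \<in> null_sets (completion \<sigma>)"
    using Q by (auto simp: carried_by_def)
  define B where "B = main_part \<sigma> Q"
  have B: "B \<in> sets borel" "B \<subseteq> Q"
  proof -
    show "B \<in> sets borel" using main_part_sets[OF Qs] \<sigma>(1) by (simp add: B_def)
    have "main_part \<sigma> Q \<union> null_part \<sigma> Q = Q" by (rule main_part_null_part_Un[OF Qs])
    then show "B \<subseteq> Q" unfolding B_def by blast
  qed
  have "emeasure (completion \<sigma>) (Q \<union> - Q) = emeasure (completion \<sigma>) Q"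
    using Qs Qn by (rule emeasure_Un_null_set)
  then have "emeasure (completion \<sigma>) Q = 1" using \<sigma> sp by (simp add: Un_commute)
  then have B1: "emeasure \<sigma> B = 1" using Qs by (simp add: B_def)
  have "emeasure \<sigma> B = (SUP K \<in> {K. K \<subseteq> B \<and> compact K}. emeasure \<sigma> K)"
    using \<sigma> sp B by (intro inner_regular) auto
  then have "0 < (SUP K \<in> {K. K \<subseteq> B \<and> compact K}. emeasure \<sigma> K)" using B1 by simp
  then obtain K where "K \<subseteq> B" "compact K" "emeasure \<sigma> K > 0" unfolding less_SUP_iff by blast
  then show ?thesis using that B by blast
qed

lemma null_measure_pos_energy: "(null_measure borel :: 'a measure) \<in> pos_energy \<alpha>"
  by (rule finite_pos_energy) (auto simp: energy_def)

text \<open>The distance from the measure to itself is 0, so the substance is that no distance is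
  negative. This needs positive definiteness, since \<open>sqrt\<close> is negative at negative
  arguments.\<close>

lemma self_projection:
  assumes "\<gamma> \<in> pos_energy_on \<alpha> (A :: 'a set)"
  shows "is_energy_projection \<alpha> A \<gamma> \<gamma>"
proof -
  define n :: "'a measure" where "n = null_measure borel"
  have n: "n \<in> pos_energy \<alpha>" unfolding n_def by (rule null_measure_pos_energy)
  have \<gamma>: "\<gamma> \<in> pos_energy \<alpha>" using assms by (simp add: pos_energy_on_def)
  define E where "E \<mu> \<nu> = energy \<mu> (\<lambda>_. 1) \<nu> (\<lambda>_. 1)" for \<mu> \<nu>
  have sf: "sfin \<nu>" if "\<nu> \<in> pos_energy \<alpha>" for \<nu> :: "'a measure" using that by (auto simp: pos_energy_def intro: pos_measures_sfin)
  have me: "mutual_energy \<alpha> \<mu> \<nu> = E \<mu> \<nu>" if "\<mu> \<in> pos_energy \<alpha>" "\<nu> \<in> pos_energy \<alpha>" for \<mu> \<nu>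
    unfolding E_def using that by (intro mutual_energy_eq sf)
  have fin: "E \<mu> \<nu> < \<top>" if "\<mu> \<in> pos_energy \<alpha>" "\<nu> \<in> pos_energy \<alpha>" for \<mu> \<nu>
  proof -
    have "mutual_energy \<alpha> \<mu> \<mu> < \<top>" "mutual_energy \<alpha> \<nu> \<nu> < \<top>" using that by (simp_all add: pos_energy_def)
    then have "E \<mu> \<mu> < \<top>" "E \<nu> \<nu> < \<top>" using that by (simp_all add: me)
    then show ?thesis
      using energy_finite[of \<mu> \<nu> "\<lambda>_. 1" "\<lambda>_. 1"] sf[OF that(1)] sf[OF that(2)] by (simp add: E_def)
  qed
  have comm: "E \<mu> \<nu> = E \<nu> \<mu>" if "\<mu> \<in> pos_energy \<alpha>" "\<nu> \<in> pos_energy \<alpha>" for \<mu> \<nu>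
    unfolding E_def using that by (intro energy_commute sf) auto
  have En: "E \<mu> n = 0" "E n \<mu> = 0" if "\<mu> \<in> pos_energy \<alpha>" for \<mu>
    using that comm[OF that n] by (simp_all add: E_def energy_def n_def)
  have self: "strong_dist \<alpha> (of_pos \<gamma>) (of_pos \<gamma>) = 0"
    by (simp add: strong_dist_def)
  have nonneg: "0 \<le> strong_dist \<alpha> (of_pos \<gamma>) \<sigma>" if "\<sigma> \<in> strong_closure \<alpha> A" for \<sigma>
  proof -
    obtain p q where \<sigma>: "\<sigma> = (p, q)" by (cases \<sigma>)
    have pq: "p \<in> pos_energy \<alpha>" "q \<in> pos_energy \<alpha>"
      using that unfolding strong_closure_def signed_energy_space_def \<sigma> by simp_all
    \<comment> \<open>The pair stands for p - q, so this is nonnegativity of the energy of \<gamma>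
      + q - p.\<close>
    have "2 * E \<gamma> p + 2 * (1 * E p q) \<le> E \<gamma> \<gamma> + E p p + 1 * 1 * E q q + 2 * (1 * E \<gamma> q)"
      unfolding E_def using \<gamma> pq by (intro energy_psd3 sf) auto
    then have "ennreal (2 * enn2real (E \<gamma> p) + 2 * enn2real (E p q)) \<le>
        ennreal (enn2real (E \<gamma> \<gamma>) + enn2real (E p p) + enn2real (E q q) + 2 * enn2real (E \<gamma> q))"
      using fin \<gamma> pq by (simp add: ennreal_plus ennreal_mult')
    then have "2 * enn2real (E \<gamma> p) + 2 * enn2real (E p q) \<le>
        enn2real (E \<gamma> \<gamma>) + enn2real (E p p) + enn2real (E q q) + 2 * enn2real (E \<gamma> q)"
      by (subst (asm) ennreal_le_iff) auto
    moreover have "energy_inner \<alpha> (of_pos \<gamma>) (of_pos \<gamma>) = enn2real (E \<gamma> \<gamma>)"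
      using \<gamma> n unfolding energy_inner_def of_pos_def n_def[symmetric] by (simp add: me En)
    moreover have "energy_inner \<alpha> (of_pos \<gamma>) \<sigma> = enn2real (E \<gamma> p) - enn2real (E \<gamma> q)"
      using \<gamma> n pq unfolding energy_inner_def of_pos_def n_def[symmetric] \<sigma> by (simp add: me En)
    moreover have "energy_inner \<alpha> \<sigma> \<sigma> = enn2real (E p p) + enn2real (E q q) - 2 * enn2real (E p q)"
      using pq comm[OF pq] unfolding energy_inner_def \<sigma> by (simp add: me)
    ultimately show ?thesis unfolding strong_dist_def by simp
  qed
  have "\<forall>e>0. \<exists>\<nu>\<in>pos_energy_on \<alpha> A. strong_dist \<alpha> (of_pos \<gamma>) (of_pos \<nu>) < e"
    using assms self by (intro allI impI bexI[of _ \<gamma>]) simp_all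
  moreover have "of_pos \<gamma> \<in> signed_energy_space \<alpha>"
    using \<gamma> n by (simp add: of_pos_def n_def signed_energy_space_def)
  ultimately have "of_pos \<gamma> \<in> strong_closure \<alpha> A" by (simp add: strong_closure_def)
  then show ?thesis using \<gamma> self nonneg by (simp add: is_energy_projection_def)
qed

theorem equilibrium_exists:
  assumes \<mu>: "\<mu> \<in> pos_measures \<alpha>" and bal: "is_inner_balayage \<alpha> (A :: 'a set) \<mu> \<mu>A"
    and less: "emeasure \<mu>A UNIV < emeasure \<mu> UNIV"
  shows "\<exists>\<gamma>. is_inner_equilibrium \<alpha> A \<gamma>"
proof -
  have [simp]: "sfin \<mu>" "sfin \<mu>A" using \<mu> bal by (auto simp: is_inner_balayage_def intro: pos_measures_sfin)
  have sp: "space \<mu> = UNIV" "space \<mu>A = UNIV"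
    using sets_eq_imp_space_eq[OF sfin_sets[of \<mu>]] sets_eq_imp_space_eq[OF sfin_sets[of \<mu>A]] by simp_all
  define \<K> where "\<K> = {K. compact K \<and> K \<subseteq> A}"
  define P where "P K \<gamma> \<longleftrightarrow> sets \<gamma> = sets borel \<and> emeasure \<gamma> UNIV < \<top> \<and> emeasure \<gamma> (- K) = 0 \<and> self_energy \<gamma> < \<top> \<and>
    (\<forall>x. U \<gamma> x \<le> 1) \<and> (\<forall>\<rho>. sfin \<rho> \<longrightarrow> locally_finite \<rho> \<longrightarrow> self_energy \<rho> < \<top> \<longrightarrow> emeasure \<rho> {x \<in> K. U \<gamma> x < 1} = 0)"
    for K \<gamma>
  have "\<exists>\<gamma>. P K \<gamma>" if "compact K" for K
  proof (rule equilibrium_compact[OF that])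
    fix \<gamma> assume a: "sets \<gamma> = sets borel" "emeasure \<gamma> UNIV < \<top>" "emeasure \<gamma> (- K) = 0" "self_energy \<gamma> < \<top>"
      "\<And>x. U \<gamma> x \<le> 1"
      "\<And>\<rho>. sfin \<rho> \<Longrightarrow> locally_finite \<rho> \<Longrightarrow> self_energy \<rho> < \<top> \<Longrightarrow> emeasure \<rho> {x \<in> K. U \<gamma> x < 1} = 0"
    show ?thesis
      unfolding P_def by (intro exI[of _ \<gamma>] conjI allI impI a)
  qed
  then obtain G where G0: "\<And>K. compact K \<Longrightarrow> P K (G K)" by metis
  have G: "sets (G K) = sets borel" "emeasure (G K) UNIV < \<top>" "emeasure (G K) (- K) = 0" "self_energy (G K) < \<top>" "U (G K) x \<le> 1"
    if "K \<in> \<K>" for K x using G0[of K] that unfolding P_def \<K>_def by blast+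
  have Gnull: "emeasure \<rho> {x \<in> K. U (G K) x < 1} = 0"
    if "K \<in> \<K>" "sfin \<rho>" "locally_finite \<rho>" "self_energy \<rho> < \<top>" for K \<rho>
    using G0[of K] that unfolding P_def \<K>_def by blast
  have Gsf[simp]: "sfin (G K)" if "K \<in> \<K>" for K using G[OF that] by (intro sfin_finite)
  have Glf: "locally_finite (G K)" if "K \<in> \<K>" for K
    unfolding locally_finite_def using G(1,2)[OF that] emeasure_mono[of _ UNIV "G K"] by (auto intro: le_less_trans)
  have Kb: "K \<in> sets borel" if "K \<in> \<K>" for K using that by (auto simp: \<K>_def intro: borel_compact)
  have GK: "AE x in G K. x \<in> K" if "K \<in> \<K>" for K
    using G(1,3)[OF that] Kb[OF that] by (intro AE_I[of _ _ "- K"]) (auto intro: borel_comp)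
  have meas: "{x \<in> K. U \<nu> x < 1} \<in> sets borel" if "K \<in> \<K>" "sfin \<nu>" for K \<nu>
    using Kb[OF that(1)] that(2) by (rule borel_sublevel)
  have AE_ge: "AE x in \<rho>. x \<in> K \<longrightarrow> 1 \<le> U \<nu> x" if "K \<in> \<K>" "sfin \<nu>" "sfin \<rho>" "emeasure \<rho> {x \<in> K. U \<nu> x < 1} = 0" for K \<nu> \<rho>
  proof -
    have "AE x in \<rho>. x \<notin> {x \<in> K. U \<nu> x < 1}"
      using that meas[OF that(1,2)] by (intro AE_not_in null_setsI) (auto simp: sfin_sets)
    then show ?thesis by eventually_elim (auto simp: not_less)
  qed
  \<comment> \<open>As \<open>U (G K)\<close> never exceeds 1, any potential that is at least 1
    almost everywhere for \<open>G K\<close> satisfies the hypothesis of \<open>domination\<close>.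
    All comparisons below go through this.\<close>
  have dom: "U (G K) x \<le> U \<nu> x" if K: "K \<in> \<K>" and \<nu>: "sfin \<nu>" and ae: "AE x in G K. 1 \<le> U \<nu> x" for K \<nu> x
  proof -
    have "AE x in G K. U (G K) x \<le> U \<nu> x + 0" using ae by eventually_elim (auto intro: order_trans[OF G(5)[OF K]])
    from domination[OF Gsf[OF K] \<nu> G(2)[OF K] G(4)[OF K] _ this] show ?thesis by simp
  qed
  have mono: "U (G K) x \<le> U (G K') x" if "K \<in> \<K>" "K' \<in> \<K>" "K \<subseteq> K'" for K K' x
  proof (rule dom[OF that(1)])
    have "AE x in G K. x \<in> K' \<longrightarrow> 1 \<le> U (G K') x"
      using that Gnull[OF that(2) Gsf[OF that(1)] Glf[OF that(1)] G(4)[OF that(1)]] by (intro AE_ge) auto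
    with GK[OF that(1)] show "AE x in G K. 1 \<le> U (G K') x" by eventually_elim (use that(3) in auto)
  qed (use that in simp)
  have below: "U (G K) x \<le> U \<nu> x" if K: "K \<in> \<K>" and \<nu>: "\<nu> \<in> equilibrium_class \<alpha> A" for K \<nu> x
  proof (rule dom[OF K])
    show sf: "sfin \<nu>" using \<nu> by (auto simp: equilibrium_class_def intro: pos_measures_sfin)
    \<comment> \<open>Otherwise the normalised restriction of \<open>G K\<close> would be a unit
      measure of finite energy carried by the exceptional set, whose inner capacity is 0.\<close>
    have "emeasure (G K) {x \<in> K. U \<nu> x < 1} = 0"
    proof (rule ccontr)
      assume "emeasure (G K) {x \<in> K. U \<nu> x < 1} \<noteq> 0"
      then have pos: "emeasure (G K) {x \<in> K. U \<nu> x < 1} > 0" by (simp add: zero_less_iff_neq_zero)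
      have "emeasure (G K) {x \<in> K. U \<nu> x < 1} \<le> emeasure (G K) UNIV" using G(1)[OF K] by (intro emeasure_mono) auto
      then have fin: "emeasure (G K) {x \<in> K. U \<nu> x < 1} < \<top>" using G(2)[OF K] by (rule le_less_trans)
      obtain \<sigma> where \<sigma>: "sets \<sigma> = sets borel" "emeasure \<sigma> UNIV = 1" "emeasure \<sigma> (- {x \<in> K. U \<nu> x < 1}) = 0" "self_energy \<sigma> < \<top>"
        by (rule restrict_normalize[OF Gsf[OF K] meas[OF K sf] pos fin G(4)[OF K]]) (rule that; assumption)
      have "\<sigma> \<in> pos_energy \<alpha>" using \<sigma> by (intro finite_pos_energy) auto
      moreover have "carried_by \<sigma> {x \<in> A. \<not> 1 \<le> potential \<alpha> \<nu> x}"
        using \<sigma> meas[OF K sf] K sf by (intro carried_by_subset[of "{x \<in> K. U \<nu> x < 1}"]) (auto simp: \<K>_def potential_U not_le)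
      ultimately have "\<sigma> \<in> pos_energy_on \<alpha> {x \<in> A. \<not> 1 \<le> potential \<alpha> \<nu> x}"
        by (simp add: pos_energy_on_def pos_measures_on_def pos_energy_def)
      moreover have "inner_capacity \<alpha> {x \<in> A. \<not> 1 \<le> potential \<alpha> \<nu> x} = 0"
        using \<nu> by (simp add: equilibrium_class_def nearly_everywhere_on_def)
      ultimately show False using capacity_zeroD \<sigma>(2) by blast
    qed
    then have "AE x in G K. x \<in> K \<longrightarrow> 1 \<le> U \<nu> x" using K sf by (intro AE_ge) auto
    with GK[OF K] show "AE x in G K. 1 \<le> U \<nu> x" by eventually_elim auto
  qed
  have bound: "(\<integral>\<^sup>+x. U (G K) x \<partial>\<mu>) \<le> emeasure \<mu>A UNIV" if K: "K \<in> \<K>" for K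
  proof -
    have "G K \<in> pos_energy \<alpha>" using G[OF K] by (intro finite_pos_energy)
    moreover have "carried_by (G K) A"
      using K G[OF K] Kb[OF K] by (intro carried_by_subset[of K]) (auto simp: \<K>_def)
    ultimately have GA: "G K \<in> pos_energy_on \<alpha> A"
      by (simp add: pos_energy_on_def pos_measures_on_def pos_energy_def)
    then have "mutual_energy \<alpha> \<mu> (G K) = mutual_energy \<alpha> \<mu>A (G K)"
      using bal self_projection[OF GA] \<open>G K \<in> pos_energy \<alpha>\<close> by (auto simp: is_inner_balayage_def)
    then have "(\<integral>\<^sup>+x. U (G K) x \<partial>\<mu>) = (\<integral>\<^sup>+x. U (G K) x \<partial>\<mu>A)"
      using K by (simp add: mutual_energy_eq energy_def)
    also have "\<dots> \<le> (\<integral>\<^sup>+x. 1 \<partial>\<mu>A)" using G(5)[OF K] by (intro nn_integral_mono) auto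
    finally show ?thesis by (simp add: sp)
  qed
  define u where "u x = (SUP K\<in>\<K>. U (G K) x)" for x
  have "\<And>K. K \<in> \<K> \<Longrightarrow> seq_lsc (U (G K))" by (intro U_lsc) simp
  then obtain C where C: "C \<subseteq> \<K>" "countable C" "\<And>x. u x = (SUP K\<in>C. U (G K) x)"
    using countable_SUP_lsc[of \<K> "\<lambda>K. U (G K)"] unfolding u_def by metis
  \<comment> \<open>Adding the empty set makes the family nonempty, so that
    \<open>from_nat_into\<close> enumerates it.\<close>
  define D where "D = insert {} C"
  have D: "D \<subseteq> \<K>" "countable D" "D \<noteq> {}" using C by (auto simp: D_def \<K>_def)
  \<comment> \<open>Finite unions turn the countable family into an increasing chain of compact sets
    with the same supremum of potentials.\<close>
  define L where "L j = (\<Union>i\<le>j. from_nat_into D i)" for j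
  have DK: "from_nat_into D i \<in> \<K>" for i using from_nat_into[OF D(3)] D(1) by blast
  have L: "L j \<in> \<K>" for j
    using DK by (auto simp: L_def \<K>_def intro!: compact_UN)
  have L_inc: "L j \<subseteq> L (Suc j)" for j by (auto simp: L_def intro: le_SucI)
  have u_L: "u x = (SUP j. U (G (L j)) x)" for x
  proof (rule antisym)
    show "(SUP j. U (G (L j)) x) \<le> u x" unfolding u_def using L by (intro SUP_least SUP_upper) auto
    show "u x \<le> (SUP j. U (G (L j)) x)"
      unfolding C(3)
    proof (rule SUP_least)
      fix K assume K: "K \<in> C"
      then obtain i where "from_nat_into D i = K" using from_nat_into_surj[OF D(2), of K] by (auto simp: D_def)
      then have "K \<subseteq> L i" by (auto simp: L_def)
      then show "U (G K) x \<le> (SUP j. U (G (L j)) x)"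
        using K C(1) L by (intro SUP_upper2[of i] mono) auto
    qed
  qed
  have u1: "u x \<le> 1" for x unfolding u_def using G(5) by (intro SUP_least) auto
  obtain \<gamma> c where \<gamma>: "radon_measure \<gamma>" and c: "0 \<le> c" and uc: "\<And>x. u x = U \<gamma> x + ennreal c"
  proof (rule limit_of_potentials[of "\<lambda>j. G (L j)"])
    show "U (G (L n)) x \<le> U (G (L (Suc n))) x" for n x by (intro mono L L_inc)
  qed (use G L u_L in auto)
  have [simp]: "sfin \<gamma>" using \<gamma> by (rule sfin_radon)
  have "c = 0"
  proof (rule ccontr)
    assume "c \<noteq> 0"
    then have cpos: "0 < c" using c by simp
    have "1 \<le> u x" for x
    proof (cases "c < 1")
      case False
      then have "1 \<le> ennreal c" by simp
      then show ?thesis unfolding uc by (simp add: add_increasing)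
    next
      case True
      \<comment> \<open>On each \<open>L j\<close>, almost everywhere for its equilibrium measure, u
        is at least 1 and so \<open>U \<gamma>\<close> is at least 1 - c. The factor k scales this
        bound to 1.\<close>
      define k where "k = 1 / (1 - c)"
      have k: "0 < k" "k * (1 - c) = 1" using True by (auto simp: k_def)
      define \<delta> where "\<delta> = density \<gamma> (\<lambda>_. ennreal k)"
      have U\<delta>: "U \<delta> x = ennreal k * U \<gamma> x" for x unfolding \<delta>_def by (rule U_scale) simp
      have "radon_measure \<delta>"
        using \<gamma> by (auto simp: radon_measure_def \<delta>_def emeasure_density_const borel_compact ennreal_mult_less_top)
      then have [simp]: "sfin \<delta>" by (rule sfin_radon)
      have le: "U (G (L j)) x \<le> U \<delta> x" for j x
      proof (rule dom[OF L])
        have "AE x in G (L j). x \<in> L j \<longrightarrow> 1 \<le> U (G (L j)) x"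
          using L Gnull[OF L Gsf[OF L] Glf[OF L] G(4)[OF L]] by (intro AE_ge) auto
        with GK[OF L] show "AE x in G (L j). 1 \<le> U \<delta> x"
        proof eventually_elim
          case (elim x)
          then have "1 \<le> u x" unfolding u_L by (intro SUP_upper2[of j]) auto
          then have "ennreal (1 - c) + ennreal c \<le> U \<gamma> x + ennreal c"
            using c True by (simp add: uc ennreal_plus[symmetric] del: ennreal_plus)
          then have "ennreal (1 - c) \<le> U \<gamma> x" by (simp add: add.commute[of _ "ennreal c"] ennreal_add_left_cancel_le)
          then have "ennreal k * ennreal (1 - c) \<le> ennreal k * U \<gamma> x" by (intro mult_left_mono) auto
          then show ?case using k True by (simp add: U\<delta> ennreal_mult'[symmetric])
        qed
      qed simp
      have "u x \<le> ennreal k * U \<gamma> x" unfolding u_L using le by (intro SUP_least) (simp add: U\<delta>)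
      moreover have "U \<gamma> x \<le> 1" using u1[of x] unfolding uc by (meson add_increasing2 le_iff_add order_trans zero_le)
      then obtain v where v: "U \<gamma> x = ennreal v" "0 \<le> v" by (cases "U \<gamma> x") (auto simp: top_unique)
      \<comment> \<open>Domination reads v + c \<le> v / (1 - c), where v is the value of
        \<open>U \<gamma>\<close> at x. For 0 < c < 1 this forces v + c \<ge> 1.\<close>
      ultimately have "ennreal (v + c) \<le> ennreal (k * v)"
        using c k by (simp add: uc ennreal_plus ennreal_mult')
      then have "v + c \<le> k * v" using k v by (subst (asm) ennreal_le_iff) auto
      then have "(v + c) * (1 - c) \<le> (k * v) * (1 - c)" using True by (intro mult_right_mono) auto
      also have "(k * v) * (1 - c) = v" using k(2) by (simp add: mult.commute mult.left_commute)
      finally have "c * 1 \<le> c * (v + c)" by (simp add: algebra_simps)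
      then have "1 \<le> v + c" using cpos by (simp only: mult_le_cancel_left_pos)
      then show ?thesis using v c by (simp add: uc ennreal_plus[symmetric] del: ennreal_plus)
    qed
    then have "(\<integral>\<^sup>+x. 1 \<partial>\<mu>) \<le> (\<integral>\<^sup>+x. u x \<partial>\<mu>)" by (intro nn_integral_mono) auto
    also have "\<dots> = (SUP j. \<integral>\<^sup>+x. U (G (L j)) x \<partial>\<mu>)"
      unfolding u_L using L mono[OF L L L_inc]
      by (intro nn_integral_monotone_convergence_SUP) (auto simp: sfin_measurable intro!: incseq_SucI le_funI)
    also have "\<dots> \<le> emeasure \<mu>A UNIV" using bound L by (intro SUP_least) auto
    finally show False using less by (simp add: sp)
  qed
  then have u\<gamma>: "u x = U \<gamma> x" for x by (simp add: uc)
  have pos: "\<gamma> \<in> pos_measures \<alpha>"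
  proof -
    have "U \<gamma> x \<noteq> \<infinity>" for x using u1[of x] by (auto simp: u\<gamma> top_unique)
    then show ?thesis using \<gamma> by (simp add: pos_measures_def potential_U)
  qed
  have mem: "\<gamma> \<in> equilibrium_class \<alpha> A"
    unfolding equilibrium_class_def nearly_everywhere_on_def
  proof (intro CollectI conjI pos capacity_zeroI)
    \<comment> \<open>A unit measure of finite energy carried by the exceptional set would charge a
      compact K inside it. There \<open>U (G K) \<le> u < 1\<close> at every point, so K must be a
      null set for that measure.\<close>
    fix \<sigma> assume \<sigma>: "\<sigma> \<in> pos_energy_on \<alpha> {x \<in> A. \<not> 1 \<le> potential \<alpha> \<gamma> x}" "emeasure \<sigma> UNIV = 1"
    have pe: "\<sigma> \<in> pos_energy \<alpha>" and ca: "carried_by \<sigma> {x \<in> A. \<not> 1 \<le> potential \<alpha> \<gamma> x}"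
      using \<sigma>(1) by (simp_all only: pos_energy_on_def pos_measures_on_def Int_iff mem_Collect_eq)
    have rad: "radon_measure \<sigma>" using pe by (auto simp: pos_energy_def pos_measures_def)
    then have sf[simp]: "sfin \<sigma>" by (rule sfin_radon)
    have en: "self_energy \<sigma> < \<top>" using pe by (simp add: pos_energy_def mutual_energy_eq)
    obtain K where K: "compact K" "K \<subseteq> {x \<in> A. \<not> 1 \<le> potential \<alpha> \<gamma> x}" "emeasure \<sigma> K > 0"
      using carried_by_compact[OF sfin_sets[OF sf] \<sigma>(2) ca] by blast
    have KK: "K \<in> \<K>" using K by (auto simp: \<K>_def)
    have "U (G K) x < 1" if "x \<in> K" for x
    proof -
      have "U (G K) x \<le> u x" unfolding u_def using KK by (intro SUP_upper)
      also have "\<dots> < 1" using that K(2) by (auto simp: u\<gamma> potential_U not_le)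
      finally show ?thesis .
    qed
    then have "{x \<in> K. U (G K) x < 1} = K" by auto
    then have "emeasure \<sigma> K = 0" using Gnull[OF KK sf _ en] rad by (simp add: radon_measure_iff)
    then show False using K(3) by simp
  qed
  have "potential \<alpha> \<gamma> x = (INF \<nu>\<in>equilibrium_class \<alpha> A. potential \<alpha> \<nu> x)" for x
  proof (rule antisym)
    show "(INF \<nu>\<in>equilibrium_class \<alpha> A. potential \<alpha> \<nu> x) \<le> potential \<alpha> \<gamma> x" using mem by (rule INF_lower)
    show "potential \<alpha> \<gamma> x \<le> (INF \<nu>\<in>equilibrium_class \<alpha> A. potential \<alpha> \<nu> x)"
    proof (rule INF_greatest)
      fix \<nu> assume \<nu>: "\<nu> \<in> equilibrium_class \<alpha> A"
      have sf: "sfin \<nu>" using \<nu> by (auto simp: equilibrium_class_def intro: pos_measures_sfin)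
      have "u x \<le> U \<nu> x" unfolding u_def using below[OF _ \<nu>] by (intro SUP_least)
      then show "potential \<alpha> \<gamma> x \<le> potential \<alpha> \<nu> x" using sf by (simp add: u\<gamma> potential_U)
    qed
  qed
  then show ?thesis using pos unfolding is_inner_equilibrium_def by blast
qed

end

theorem theorem8p6:
  fixes \<alpha> :: real and A \<Omega> :: "(real ^ 'n) set" and \<mu> \<mu>A :: "(real ^ 'n) measure"
  assumes "CARD('n) \<ge> 3"
    and "0 < \<alpha>" and "\<alpha> \<le> 2"
    and "inner_capacity \<alpha> A > 0"
    and "\<Omega> = - closure A" and "\<Omega> \<noteq> {}"
    and "\<mu> \<in> pos_measures_on \<alpha> \<Omega>"
    and "is_inner_balayage \<alpha> A \<mu> \<mu>A"
    and "emeasure \<mu>A UNIV < emeasure \<mu> UNIV"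
  shows "\<exists>\<gamma>. is_inner_equilibrium \<alpha> A \<gamma>"
proof -
  \<comment> \<open>The dimension is at least 3, so \<alpha> \<le> 2 < n, which is the condition
    relating order and dimension in the locale.\<close>
  interpret riesz \<alpha> "TYPE(real ^ 'n)"
    using assms(1-3) by unfold_locales auto
  show ?thesis
    using assms(7-9) by (intro equilibrium_exists) (auto simp: pos_measures_on_def)
qed

end
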